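(* Let $F$ be a finite extension of $\mathbb{Q}_p$ with ring of integers $\mathcal{O}_F$ and uniformizer $\varpi$, and let $G=\mathrm{GL}_2(F)$. Let $(\pi_1,V_1)$, $(\pi_2,V_2)$, $(\pi_3,V_3)$ be three irreducible, admissible, infinite dimensional complex representations of $G$ such that the product of their central characters is trivial. Assume that $\pi_1$ and $\pi_2$ are unramified principal series representations and that $\pi_3$ has conductor $n\geq 1$. Let $v_1,v_2,v_3$ be new vectors of $\pi_1,\pi_2,\pi_3$ respectively, let $\gamma=\begin{pmatrix}\varpi&0\\0&1\end{pmatrix}$, and put $v_1^*=\pi_1(\gamma^{-n})v_1$. Let $\ell$ be a non-zero $G$-invariant linear form on $V_1\otimes V_2\otimes V_3$. Then $v_1^*\otimes v_2\otimes v_3$ is a test vector for $\ell$, that is, $$\ell(v_1^*\otimes v_2\otimes v_3)\neq 0.$$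
   Context: $G$ acts diagonally on $V_1\otimes V_2\otimes V_3$, and a linear form $\ell$ on it is $G$-invariant if $\ell(\pi_1(g)x_1\otimes\pi_2(g)x_2\otimes\pi_3(g)x_3)=\ell(x_1\otimes x_2\otimes x_3)$ for all $g\in G$ and all $x_i\in V_i$. (Under the hypotheses of the claim, by a theorem of Prasad, a non-zero such $\ell$ exists, and it is unique up to scalar.) A test vector for $\ell$ is a vector of $V_1\otimes V_2\otimes V_3$ not in the kernel of $\ell$. Conductor and new vectors: let $K=\mathrm{GL}_2(\mathcal{O}_F)$ and, for $n\ge 1$, let $I_n=\left\{\begin{pmatrix}a&b\\c&d\end{pmatrix}\in K : c\equiv 0 \bmod \varpi^n\right\}$. For an irreducible, admissible, infinite dimensional representation $(\pi,V)$ of $G$ with central character $\omega$, put $V^0=V^K$ (the $K$-fixed vectors) and, for $n\ge1$, $V^n=\left\{v\in V : \pi\begin{pmatrix}a&b\\c&d\end{pmatrix}v=\omega(a)v \text{ for all } \begin{pmatrix}a&b\\c&d\end{pmatrix}\in I_n\right\}$. There is a minimal $n\geq 0$ with $V^n\neq\{0\}$; it is called the conductor of $\pi$. For this $n$ the space $V^n$ is one-dimensional, and any generator of it is called a new vector of $\pi$. The representation $\pi$ is unramified if its conductor is $0$, and ramified otherwise. *)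

theory Defs
  imports
    "HOL-Analysis.Analysis"
    "HOL-Algebra.Group"
    "HOL-Computational_Algebra.Polynomial"
    "HOL-Computational_Algebra.Primes"
    "HOL-Library.Poly_Mapping"
begin

section \<open>Finite extensions of the field of p-adic numbers\<close>

definition padic_abs :: "nat \<Rightarrow> rat \<Rightarrow> real" where
  "padic_abs p r =
     (if r = 0 then 0
      else real p powi (int (multiplicity (int p) (snd (quotient_of r)))
                        - int (multiplicity (int p) (fst (quotient_of r)))))"

text \<open>
  The field of p-adic numbers is the completion of the rationals for the p-adic absolute value.
  It occurs here as a subfield \<open>E\<close> of the ambient field (the carrier of the type), together with an
  absolute value \<open>N\<close> on \<open>E\<close>; the values of \<open>N\<close> outside \<open>E\<close> are irrelevant.
\<close>

definition subfield_set :: "'f::field set \<Rightarrow> bool" where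
  "subfield_set E \<longleftrightarrow> 0 \<in> E \<and> 1 \<in> E \<and>
     (\<forall>x\<in>E. \<forall>y\<in>E. x + y \<in> E \<and> x - y \<in> E \<and> x * y \<in> E) \<and> (\<forall>x\<in>E. inverse x \<in> E)"

definition absolute_value_on :: "'f::field set \<Rightarrow> ('f \<Rightarrow> real) \<Rightarrow> bool" where
  "absolute_value_on E N \<longleftrightarrow>
     (\<forall>x\<in>E. 0 \<le> N x \<and> (N x = 0 \<longleftrightarrow> x = 0)) \<and>
     (\<forall>x\<in>E. \<forall>y\<in>E. N (x * y) = N x * N y \<and> N (x + y) \<le> N x + N y)"

definition complete_for :: "'f::field set \<Rightarrow> ('f \<Rightarrow> real) \<Rightarrow> bool" where
  "complete_for E N \<longleftrightarrow>
     (\<forall>X. range X \<subseteq> E \<and> (\<forall>e>0. \<exists>M::nat. \<forall>i\<ge>M. \<forall>j\<ge>M. N (X i - X j) < e)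
        \<longrightarrow> (\<exists>x\<in>E. (\<lambda>i. N (X i - x)) \<longlonglongrightarrow> 0))"

definition padic_numbers_in :: "nat \<Rightarrow> 'f::field_char_0 set \<Rightarrow> ('f \<Rightarrow> real) \<Rightarrow> bool" where
  "padic_numbers_in p E N \<longleftrightarrow>
     subfield_set E \<and> absolute_value_on E N \<and>
     (\<forall>r. N (of_rat r) = padic_abs p r) \<and>
     (\<forall>x\<in>E. \<forall>e>0. \<exists>r. N (x - of_rat r) < e) \<and>
     complete_for E N"

definition finite_over :: "'f::field set \<Rightarrow> bool" where
  "finite_over E \<longleftrightarrow>
     (\<exists>B. finite B \<and> (\<forall>x. \<exists>c. (\<forall>b\<in>B. c b \<in> E) \<and> x = (\<Sum>b\<in>B. c b * b)))"

definition finite_extension_of_padics ::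
  "nat \<Rightarrow> 'f::field_char_0 set \<Rightarrow> ('f \<Rightarrow> real) \<Rightarrow> bool" where
  "finite_extension_of_padics p E N \<longleftrightarrow> prime p \<and> padic_numbers_in p E N \<and> finite_over E"

text \<open>The integral closure of the p-adic integers \<open>{x \<in> E. N x \<le> 1}\<close>.\<close>

definition ring_of_integers :: "'f::field set \<Rightarrow> ('f \<Rightarrow> real) \<Rightarrow> 'f set" where
  "ring_of_integers E N =
     {x. \<exists>P. lead_coeff P = 1 \<and> (\<forall>i. coeff P i \<in> {y\<in>E. N y \<le> 1}) \<and> poly P x = 0}"

text \<open>From here on \<open>R\<close> is the ring of integers of the field and \<open>\<tau>\<close> a uniformizer.\<close>

definition unit_set :: "'f::field set \<Rightarrow> 'f set" where
  "unit_set R = {u\<in>R. u \<noteq> 0 \<and> inverse u \<in> R}"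

definition uniformizer :: "'f::field set \<Rightarrow> 'f \<Rightarrow> bool" where
  "uniformizer R \<tau> \<longleftrightarrow> (\<lambda>y. \<tau> * y) ` R = R - unit_set R"

definition residue_card :: "'f::field set \<Rightarrow> 'f \<Rightarrow> nat" where
  "residue_card R \<tau> = card (R // {(x, y). x \<in> R \<and> y \<in> R \<and> x - y \<in> (\<lambda>z. \<tau> * z) ` R})"

definition valuation :: "'f::field set \<Rightarrow> 'f \<Rightarrow> 'f \<Rightarrow> int" where
  "valuation R \<tau> x = (THE k. \<exists>u\<in>unit_set R. x = \<tau> powi k * u)"

definition fabs :: "'f::field set \<Rightarrow> 'f \<Rightarrow> 'f \<Rightarrow> real" where
  "fabs R \<tau> x = (if x = 0 then 0 else real (residue_card R \<tau>) powi (- valuation R \<tau> x))"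

section \<open>The group of invertible two by two matrices\<close>

definition GL2 :: "('f::field^2^2) monoid" where
  "GL2 = \<lparr>carrier = {A. invertible A}, monoid.mult = (**), one = mat 1\<rparr>"

definition mat2 :: "'f::field \<Rightarrow> 'f \<Rightarrow> 'f \<Rightarrow> 'f \<Rightarrow> 'f^2^2" where
  "mat2 a b c d = vector [vector [a, b], vector [c, d]]"

definition GL2_topology :: "'f::field set \<Rightarrow> 'f \<Rightarrow> ('f^2^2) topology" where
  "GL2_topology R \<tau> = topology (\<lambda>U. U \<subseteq> carrier GL2 \<and>
     (\<forall>g\<in>U. \<exists>e>0. \<forall>h\<in>carrier GL2. (\<forall>i j. fabs R \<tau> (h$i$j - g$i$j) < e) \<longrightarrow> h \<in> U))"

lemma openin_GL2_topology:
  "openin (GL2_topology R \<tau>) U \<longleftrightarrow> U \<subseteq> carrier GL2 \<and>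
     (\<forall>g\<in>U. \<exists>e>0. \<forall>h\<in>carrier GL2. (\<forall>i j. fabs R \<tau> (h$i$j - g$i$j) < e) \<longrightarrow> h \<in> U)"
proof -
  let ?P = "\<lambda>U. U \<subseteq> carrier GL2 \<and>
     (\<forall>g\<in>U. \<exists>e>0. \<forall>h\<in>carrier GL2. (\<forall>i j. fabs R \<tau> (h$i$j - g$i$j) < e) \<longrightarrow> h \<in> U)"
  have "?P (S \<inter> T)" if S: "?P S" and T: "?P T" for S T
  proof (intro conjI ballI)
    show "S \<inter> T \<subseteq> carrier GL2" using S by blast
    fix g assume g: "g \<in> S \<inter> T"
    from S g obtain d where d: "d > 0"
      "\<forall>h\<in>carrier GL2. (\<forall>i j. fabs R \<tau> (h$i$j - g$i$j) < d) \<longrightarrow> h \<in> S" by blast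
    from T g obtain e where e: "e > 0"
      "\<forall>h\<in>carrier GL2. (\<forall>i j. fabs R \<tau> (h$i$j - g$i$j) < e) \<longrightarrow> h \<in> T" by blast
    show "\<exists>e>0. \<forall>h\<in>carrier GL2. (\<forall>i j. fabs R \<tau> (h$i$j - g$i$j) < e) \<longrightarrow> h \<in> S \<inter> T"
      using d e by (intro exI[of _ "min d e"]) auto
  qed
  moreover have "?P (\<Union>\<K>)" if K: "\<forall>S\<in>\<K>. ?P S" for \<K>
  proof (intro conjI ballI)
    show "\<Union>\<K> \<subseteq> carrier GL2" using K by blast
    fix g assume "g \<in> \<Union>\<K>"
    then obtain S where S: "S \<in> \<K>" "g \<in> S" by blast
    with K obtain e where "e > 0"
      "\<forall>h\<in>carrier GL2. (\<forall>i j. fabs R \<tau> (h$i$j - g$i$j) < e) \<longrightarrow> h \<in> S" by blast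
    with S show "\<exists>e>0. \<forall>h\<in>carrier GL2. (\<forall>i j. fabs R \<tau> (h$i$j - g$i$j) < e) \<longrightarrow> h \<in> \<Union>\<K>"
      by blast
  qed
  ultimately have "istopology ?P" unfolding istopology_def by blast
  then show ?thesis unfolding GL2_topology_def by (simp add: topology_inverse')
qed

definition open_subgroup :: "'f::field set \<Rightarrow> 'f \<Rightarrow> ('f^2^2) set \<Rightarrow> bool" where
  "open_subgroup R \<tau> U \<longleftrightarrow> subgroup U GL2 \<and> openin (GL2_topology R \<tau>) U"

definition maximal_compact :: "'f::field set \<Rightarrow> ('f^2^2) set" where
  "maximal_compact R = {k. (\<forall>i j. k$i$j \<in> R) \<and> det k \<in> unit_set R}"

definition congruence_subgroup :: "'f::field set \<Rightarrow> 'f \<Rightarrow> nat \<Rightarrow> ('f^2^2) set" where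
  "congruence_subgroup R \<tau> n = {k\<in>maximal_compact R. k$2$1 \<in> (\<lambda>y. \<tau> ^ n * y) ` R}"

section \<open>Representations\<close>

text \<open>
  A representation is a complex vector space, given by a type with a scalar multiplication \<open>s\<close>,
  together with an action \<open>\<pi>\<close> that is only relevant on invertible matrices.
\<close>

definition representation ::
  "(complex \<Rightarrow> 'v::ab_group_add \<Rightarrow> 'v) \<Rightarrow> ('f::field^2^2 \<Rightarrow> 'v \<Rightarrow> 'v) \<Rightarrow> bool" where
  "representation s \<pi> \<longleftrightarrow> vector_space s \<and>
     (\<forall>g\<in>carrier GL2. Vector_Spaces.linear s s (\<pi> g)) \<and>
     (\<forall>v. \<pi> (mat 1) v = v) \<and>
     (\<forall>g\<in>carrier GL2. \<forall>h\<in>carrier GL2. \<forall>v. \<pi> (g ** h) v = \<pi> g (\<pi> h v))"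

definition irreducible_rep ::
  "(complex \<Rightarrow> 'v::ab_group_add \<Rightarrow> 'v) \<Rightarrow> ('f::field^2^2 \<Rightarrow> 'v \<Rightarrow> 'v) \<Rightarrow> bool" where
  "irreducible_rep s \<pi> \<longleftrightarrow> (\<exists>v::'v. v \<noteq> 0) \<and>
     (\<forall>W. module.subspace s W \<and> (\<forall>g\<in>carrier GL2. \<pi> g ` W \<subseteq> W) \<longrightarrow> W = {0} \<or> W = UNIV)"

definition fin_dim :: "(complex \<Rightarrow> 'v::ab_group_add \<Rightarrow> 'v) \<Rightarrow> 'v set \<Rightarrow> bool" where
  "fin_dim s W \<longleftrightarrow> (\<exists>B. finite B \<and> W \<subseteq> module.span s B)"

text \<open>
  Admissibility as in Jacquet--Langlands: stabilizers of vectors are open, and the vectors fixed by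
  any open subgroup form a finite dimensional space.  It is the same to ask the latter for open
  compact subgroups only, since every open subgroup contains an open compact one.
\<close>

definition admissible ::
  "'f::field set \<Rightarrow> 'f \<Rightarrow> (complex \<Rightarrow> 'v::ab_group_add \<Rightarrow> 'v) \<Rightarrow> ('f^2^2 \<Rightarrow> 'v \<Rightarrow> 'v) \<Rightarrow> bool" where
  "admissible R \<tau> s \<pi> \<longleftrightarrow>
     (\<forall>v. openin (GL2_topology R \<tau>) {g\<in>carrier GL2. \<pi> g v = v}) \<and>
     (\<forall>U. open_subgroup R \<tau> U \<longrightarrow> fin_dim s {v. \<forall>g\<in>U. \<pi> g v = v})"

definition irr_adm_inf_rep ::
  "'f::field set \<Rightarrow> 'f \<Rightarrow> (complex \<Rightarrow> 'v::ab_group_add \<Rightarrow> 'v) \<Rightarrow> ('f^2^2 \<Rightarrow> 'v \<Rightarrow> 'v) \<Rightarrow> bool" where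
  "irr_adm_inf_rep R \<tau> s \<pi> \<longleftrightarrow> representation s \<pi> \<and> irreducible_rep s \<pi> \<and>
     admissible R \<tau> s \<pi> \<and> \<not> fin_dim s UNIV"

definition central_character ::
  "(complex \<Rightarrow> 'v::ab_group_add \<Rightarrow> 'v) \<Rightarrow> ('f::field^2^2 \<Rightarrow> 'v \<Rightarrow> 'v) \<Rightarrow> ('f \<Rightarrow> complex) \<Rightarrow> bool" where
  "central_character s \<pi> \<omega> \<longleftrightarrow> (\<forall>a v. a \<noteq> 0 \<longrightarrow> \<pi> (mat a) v = s (\<omega> a) v)"

definition level_space ::
  "'f::field set \<Rightarrow> 'f \<Rightarrow> (complex \<Rightarrow> 'v::ab_group_add \<Rightarrow> 'v) \<Rightarrow> ('f^2^2 \<Rightarrow> 'v \<Rightarrow> 'v)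
     \<Rightarrow> ('f \<Rightarrow> complex) \<Rightarrow> nat \<Rightarrow> 'v set" where
  "level_space R \<tau> s \<pi> \<omega> n =
     (if n = 0 then {v. \<forall>k\<in>maximal_compact R. \<pi> k v = v}
      else {v. \<forall>k\<in>congruence_subgroup R \<tau> n. \<pi> k v = s (\<omega> (k$1$1)) v})"

definition has_conductor ::
  "'f::field set \<Rightarrow> 'f \<Rightarrow> (complex \<Rightarrow> 'v::ab_group_add \<Rightarrow> 'v) \<Rightarrow> ('f^2^2 \<Rightarrow> 'v \<Rightarrow> 'v)
     \<Rightarrow> ('f \<Rightarrow> complex) \<Rightarrow> nat \<Rightarrow> bool" where
  "has_conductor R \<tau> s \<pi> \<omega> n \<longleftrightarrow> level_space R \<tau> s \<pi> \<omega> n \<noteq> {0} \<and>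
     (\<forall>m<n. level_space R \<tau> s \<pi> \<omega> m = {0})"

definition new_vector ::
  "'f::field set \<Rightarrow> 'f \<Rightarrow> (complex \<Rightarrow> 'v::ab_group_add \<Rightarrow> 'v) \<Rightarrow> ('f^2^2 \<Rightarrow> 'v \<Rightarrow> 'v)
     \<Rightarrow> ('f \<Rightarrow> complex) \<Rightarrow> 'v \<Rightarrow> bool" where
  "new_vector R \<tau> s \<pi> \<omega> v \<longleftrightarrow>
     (\<exists>n. has_conductor R \<tau> s \<pi> \<omega> n \<and> level_space R \<tau> s \<pi> \<omega> n = module.span s {v})"

definition quasicharacter :: "'f::field set \<Rightarrow> 'f \<Rightarrow> ('f \<Rightarrow> complex) \<Rightarrow> bool" where
  "quasicharacter R \<tau> \<eta> \<longleftrightarrow>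
     (\<forall>a. a \<noteq> 0 \<longrightarrow> \<eta> a \<noteq> 0) \<and>
     (\<forall>a b. a \<noteq> 0 \<and> b \<noteq> 0 \<longrightarrow> \<eta> (a * b) = \<eta> a * \<eta> b) \<and>
     (\<exists>e>0. \<forall>a. a \<noteq> 0 \<and> fabs R \<tau> (a - 1) < e \<longrightarrow> \<eta> a = 1)"

text \<open>
  The normalized smooth induction of the character \<open>(\<eta>, \<mu>)\<close> of the upper triangular subgroup.
  Functions on the group are extended by zero to all matrices.
\<close>

definition induced_space ::
  "'f::field set \<Rightarrow> 'f \<Rightarrow> ('f \<Rightarrow> complex) \<Rightarrow> ('f \<Rightarrow> complex) \<Rightarrow> ('f^2^2 \<Rightarrow> complex) set" where
  "induced_space R \<tau> \<eta> \<mu> =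
     {f. (\<forall>g. g \<notin> carrier GL2 \<longrightarrow> f g = 0) \<and>
         (\<forall>a b d. \<forall>g\<in>carrier GL2. a \<noteq> 0 \<and> d \<noteq> 0 \<longrightarrow>
            f (mat2 a b 0 d ** g) = \<eta> a * \<mu> d * complex_of_real (sqrt (fabs R \<tau> (a / d))) * f g) \<and>
         (\<exists>U. open_subgroup R \<tau> U \<and> (\<forall>u\<in>U. \<forall>g\<in>carrier GL2. f (g ** u) = f g))}"

text \<open>
  Principal series: isomorphic to the full induced representation, on which the group acts by right
  translation.  This is only used together with irreducibility.
\<close>

definition principal_series ::
  "'f::field set \<Rightarrow> 'f \<Rightarrow> (complex \<Rightarrow> 'v::ab_group_add \<Rightarrow> 'v) \<Rightarrow> ('f^2^2 \<Rightarrow> 'v \<Rightarrow> 'v) \<Rightarrow> bool" where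
  "principal_series R \<tau> s \<pi> \<longleftrightarrow>
     (\<exists>\<eta> \<mu> T. quasicharacter R \<tau> \<eta> \<and> quasicharacter R \<tau> \<mu> \<and>
        bij_betw T UNIV (induced_space R \<tau> \<eta> \<mu>) \<and>
        (\<forall>v w. T (v + w) = (\<lambda>x. T v x + T w x)) \<and>
        (\<forall>c v. T (s c v) = (\<lambda>x. c * T v x)) \<and>
        (\<forall>v. \<forall>g\<in>carrier GL2. \<forall>x\<in>carrier GL2. T (\<pi> g v) x = T v (x ** g)))"

definition unramified ::
  "'f::field set \<Rightarrow> 'f \<Rightarrow> (complex \<Rightarrow> 'v::ab_group_add \<Rightarrow> 'v) \<Rightarrow> ('f^2^2 \<Rightarrow> 'v \<Rightarrow> 'v)
     \<Rightarrow> ('f \<Rightarrow> complex) \<Rightarrow> bool" where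
  "unramified R \<tau> s \<pi> \<omega> \<longleftrightarrow> has_conductor R \<tau> s \<pi> \<omega> 0"

section \<open>Triple tensor products\<close>

text \<open>
  The tensor product is the quotient of the free complex vector space on triples of vectors by the
  subspace spanned by the multilinearity relations.
\<close>

definition free_scale :: "complex \<Rightarrow> ('x \<Rightarrow>\<^sub>0 complex) \<Rightarrow> ('x \<Rightarrow>\<^sub>0 complex)" where
  "free_scale c f = Poly_Mapping.map (\<lambda>z. c * z) f"

lemma lookup_free_scale [simp]:
  "Poly_Mapping.lookup (free_scale c f) x = c * Poly_Mapping.lookup f x"
  by (simp add: free_scale_def Poly_Mapping.map.rep_eq when_def)

lemma vector_space_free_scale: "vector_space free_scale"
  by unfold_locales (simp_all add: poly_mapping_eq_iff fun_eq_iff lookup_add algebra_simps)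

definition tensor_relations ::
  "(complex \<Rightarrow> 'a::ab_group_add \<Rightarrow> 'a) \<Rightarrow> (complex \<Rightarrow> 'b::ab_group_add \<Rightarrow> 'b)
     \<Rightarrow> (complex \<Rightarrow> 'c::ab_group_add \<Rightarrow> 'c) \<Rightarrow> ('a \<times> 'b \<times> 'c \<Rightarrow>\<^sub>0 complex) set" where
  "tensor_relations s1 s2 s3 =
     (let e = (\<lambda>x y z. Poly_Mapping.single (x, y, z) (1::complex)) in
       {e (x + x') y z - e x y z - e x' y z | x x' y z. True} \<union>
       {e x (y + y') z - e x y z - e x y' z | x y y' z. True} \<union>
       {e x y (z + z') - e x y z - e x y z' | x y z z'. True} \<union>
       {e (s1 c x) y z - free_scale c (e x y z) | c x y z. True} \<union>
       {e x (s2 c y) z - free_scale c (e x y z) | c x y z. True} \<union>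
       {e x y (s3 c z) - free_scale c (e x y z) | c x y z. True})"

definition tensor_eq ::
  "(complex \<Rightarrow> 'a::ab_group_add \<Rightarrow> 'a) \<Rightarrow> (complex \<Rightarrow> 'b::ab_group_add \<Rightarrow> 'b)
     \<Rightarrow> (complex \<Rightarrow> 'c::ab_group_add \<Rightarrow> 'c) \<Rightarrow> ('a \<times> 'b \<times> 'c \<Rightarrow>\<^sub>0 complex) rel" where
  "tensor_eq s1 s2 s3 = {(f, g). f - g \<in> module.span free_scale (tensor_relations s1 s2 s3)}"

lemma equiv_tensor_eq: "equiv UNIV (tensor_eq s1 s2 s3)"
proof -
  interpret vector_space free_scale by (rule vector_space_free_scale)
  let ?S = "span (tensor_relations s1 s2 s3)"
  have "g - f \<in> ?S" if "f - g \<in> ?S" for f g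
    using span_neg[OF that] by simp
  moreover have "f - h \<in> ?S" if "f - g \<in> ?S" "g - h \<in> ?S" for f g h
    using span_add[OF that] by simp
  ultimately have "sym (tensor_eq s1 s2 s3)" "trans (tensor_eq s1 s2 s3)"
    unfolding sym_def trans_def tensor_eq_def by blast+
  moreover have "refl (tensor_eq s1 s2 s3)"
    unfolding refl_on_def tensor_eq_def by (simp add: span_zero)
  ultimately show ?thesis by (simp add: equiv_def)
qed

definition tensor_space ::
  "(complex \<Rightarrow> 'a::ab_group_add \<Rightarrow> 'a) \<Rightarrow> (complex \<Rightarrow> 'b::ab_group_add \<Rightarrow> 'b)
     \<Rightarrow> (complex \<Rightarrow> 'c::ab_group_add \<Rightarrow> 'c) \<Rightarrow> ('a \<times> 'b \<times> 'c \<Rightarrow>\<^sub>0 complex) set set" where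
  "tensor_space s1 s2 s3 = UNIV // tensor_eq s1 s2 s3"

definition pure_tensor ::
  "(complex \<Rightarrow> 'a::ab_group_add \<Rightarrow> 'a) \<Rightarrow> (complex \<Rightarrow> 'b::ab_group_add \<Rightarrow> 'b)
     \<Rightarrow> (complex \<Rightarrow> 'c::ab_group_add \<Rightarrow> 'c) \<Rightarrow> 'a \<Rightarrow> 'b \<Rightarrow> 'c \<Rightarrow> ('a \<times> 'b \<times> 'c \<Rightarrow>\<^sub>0 complex) set" where
  "pure_tensor s1 s2 s3 x y z = tensor_eq s1 s2 s3 `` {Poly_Mapping.single (x, y, z) 1}"

text \<open>Addition and scalar multiplication on the quotient are induced from representatives.\<close>

definition tensor_linear_form ::
  "(complex \<Rightarrow> 'a::ab_group_add \<Rightarrow> 'a) \<Rightarrow> (complex \<Rightarrow> 'b::ab_group_add \<Rightarrow> 'b)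
     \<Rightarrow> (complex \<Rightarrow> 'c::ab_group_add \<Rightarrow> 'c) \<Rightarrow> (('a \<times> 'b \<times> 'c \<Rightarrow>\<^sub>0 complex) set \<Rightarrow> complex) \<Rightarrow> bool" where
  "tensor_linear_form s1 s2 s3 l \<longleftrightarrow>
     (let cls = (\<lambda>f. tensor_eq s1 s2 s3 `` {f}) in
       (\<forall>f g. l (cls (f + g)) = l (cls f) + l (cls g)) \<and>
       (\<forall>c f. l (cls (free_scale c f)) = c * l (cls f)))"

definition invariant_form ::
  "(complex \<Rightarrow> 'a::ab_group_add \<Rightarrow> 'a) \<Rightarrow> (complex \<Rightarrow> 'b::ab_group_add \<Rightarrow> 'b)
     \<Rightarrow> (complex \<Rightarrow> 'c::ab_group_add \<Rightarrow> 'c)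
     \<Rightarrow> ('f::field^2^2 \<Rightarrow> 'a \<Rightarrow> 'a) \<Rightarrow> ('f^2^2 \<Rightarrow> 'b \<Rightarrow> 'b) \<Rightarrow> ('f^2^2 \<Rightarrow> 'c \<Rightarrow> 'c)
     \<Rightarrow> (('a \<times> 'b \<times> 'c \<Rightarrow>\<^sub>0 complex) set \<Rightarrow> complex) \<Rightarrow> bool" where
  "invariant_form s1 s2 s3 \<pi>1 \<pi>2 \<pi>3 l \<longleftrightarrow>
     (\<forall>g\<in>carrier GL2. \<forall>x y z.
        l (pure_tensor s1 s2 s3 (\<pi>1 g x) (\<pi>2 g y) (\<pi>3 g z)) = l (pure_tensor s1 s2 s3 x y z))"

end

theory Submission
  imports Defs "HOL-Real_Asymp.Real_Asymp"
begin

text \<open>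
  Let \<open>L\<close> be the trilinear form and suppose that it vanishes on the vector of the theorem. Averaging
  over a congruence subgroup \<open>I\<^sub>d\<close> with \<open>d \<le> n\<close> projects onto vectors of level \<open>d\<close>, which are multiples of
  \<open>v\<^sub>3\<close> or zero; hence \<open>L\<close> vanishes on \<open>\<gamma>\<^sup>i v\<^sub>1 \<otimes> \<gamma>\<^sup>j v\<^sub>2 \<otimes> v\<close> for all \<open>v\<close> when \<open>\<bar>i - j\<bar> \<le> n\<close>. When
  \<open>\<bar>i - j\<bar> > n\<close> and \<open>v = v\<^sub>3\<close>, the Hecke relations of \<open>v\<^sub>1\<close> and \<open>v\<^sub>2\<close> (which express that the spherical
  vectors are unique) reduce \<open>\<bar>i - j\<bar>\<close>. So the subspace \<open>W\<close> of all \<open>v\<close> in the third representation with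
  \<open>L (\<gamma>\<^sup>i v\<^sub>1 \<otimes> \<gamma>\<^sup>j v\<^sub>2 \<otimes> v) = 0\<close> for all \<open>i, j\<close> contains \<open>v\<^sub>3\<close>; it is stable under the diagonal torus, whose
  units act trivially modulo \<open>W\<close>.

  Any such \<open>W\<close> is the whole space. The translates of \<open>v\<^sub>3\<close> correspond to the oriented paths of length \<open>n\<close>
  in the Bruhat--Tits tree. The path of \<open>g v\<^sub>3\<close> is moved within its torus orbit modulo \<open>W\<close> by all elements
  which occur in a suitable average: either an average which vanishes because \<open>n\<close> is the conductor, when
  one branch of the path off the standard apartment is longer than the other, or, when both branches
  have the same length, an average over a conjugate of \<open>I\<^sub>n\<close>, whose value is a translate of \<open>v\<^sub>3\<close> by the
  torus. In both cases \<open>g v\<^sub>3 \<in> W\<close>. Finally the Cartan decomposition and the irreducibility of the first two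
  representations give \<open>L = 0\<close>.
\<close>

section \<open>The ring of integers of a finite extension of the p-adic numbers\<close>

text \<open>A spherical vector moved by \<open>shift k\<close> belongs to the vertex k of the
  standard apartment, and \<open>v3\<close> to the path from the vertex 0 to the vertex -n. When 0 <
  - val u < val c < n, the path of \<open>upper u (lower c v3)\<close> has branches of lengths - val
  u and n - val c off the apartment, so the sign of val c - val u - n tells which one is longer. In
  general the correction val (1 + u c) enters, and val (1 + u c) + val c - val u is compared with n.
  An average helps only if all its terms can be compared with a single one. The last edge of the
  longer branch can be moved by diagonal units close to 1 which fix the shorter branch; this
  dictates the end of the path at which the average is taken. With equal lengths such units move
  both ends, and the average runs over the stabilizer of a whole segment of the apartment. The
  central character disappears at the outset: scalar units fix \<open>v1\<close> and
  \<open>v2\<close>, so the first two central characters are trivial on units, hence so is the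
  third, and level spaces consist of invariant vectors.\<close>

locale padic_extension =
  fixes p :: nat and E :: "'f::field_char_0 set" and N :: "'f \<Rightarrow> real"
  assumes finite_extension: "finite_extension_of_padics p E N"
begin

section \<open>The absolute value on the p-adic numbers\<close>

lemma prime_p: "prime p"
  and subfield_E: "subfield_set E"
  and absolute_value: "absolute_value_on E N"
  and N_of_rat: "N (of_rat r) = padic_abs p r"
  and dense_rat: "x \<in> E \<Longrightarrow> e > 0 \<Longrightarrow> \<exists>r. N (x - of_rat r) < e"
  and finite_over_E: "finite_over E"
  using finite_extension unfolding finite_extension_of_padics_def padic_numbers_in_def by blast+

lemma E_0 [simp]: "0 \<in> E" and E_1 [simp]: "1 \<in> E"
  and E_add [intro]: "x \<in> E \<Longrightarrow> y \<in> E \<Longrightarrow> x + y \<in> E"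
  and E_diff [intro]: "x \<in> E \<Longrightarrow> y \<in> E \<Longrightarrow> x - y \<in> E"
  and E_mult [intro]: "x \<in> E \<Longrightarrow> y \<in> E \<Longrightarrow> x * y \<in> E"
  and E_inverse [intro]: "x \<in> E \<Longrightarrow> inverse x \<in> E"
  using subfield_E unfolding subfield_set_def by blast+

lemma E_minus [intro]: "x \<in> E \<Longrightarrow> - x \<in> E"
  using E_diff[of 0 x] by simp

lemma E_divide [intro]: "x \<in> E \<Longrightarrow> y \<in> E \<Longrightarrow> x / y \<in> E"
  by (auto simp: divide_inverse)

lemma E_power [intro]: "x \<in> E \<Longrightarrow> x ^ k \<in> E"
  by (induction k) auto

lemma E_of_nat [simp]: "of_nat k \<in> E"
  by (induction k) auto

lemma E_of_int [simp]: "of_int k \<in> E"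
  by (cases k) (auto simp del: of_nat_Suc)

lemma E_of_rat [simp]: "of_rat r \<in> E"
  by (cases r) (auto simp: of_rat_rat)

lemma E_sum: "(\<And>i. i \<in> I \<Longrightarrow> f i \<in> E) \<Longrightarrow> sum f I \<in> E"
  by (induction I rule: infinite_finite_induct) auto

lemma N_nonneg: "x \<in> E \<Longrightarrow> 0 \<le> N x"
  and N_eq_0: "x \<in> E \<Longrightarrow> N x = 0 \<longleftrightarrow> x = 0"
  and N_mult: "x \<in> E \<Longrightarrow> y \<in> E \<Longrightarrow> N (x * y) = N x * N y"
  and N_triangle: "x \<in> E \<Longrightarrow> y \<in> E \<Longrightarrow> N (x + y) \<le> N x + N y"
  using absolute_value unfolding absolute_value_on_def by blast+

lemma N_0 [simp]: "N 0 = 0" by (simp add: N_eq_0)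

lemma p_gt_1: "real p > 1"
  using prime_gt_1_nat[OF prime_p] by simp

lemma N_of_int: "k \<noteq> 0 \<Longrightarrow> N (of_int k) = real p powi (- int (multiplicity (int p) k))"
  using N_of_rat[of "of_int k"] by (simp add: padic_abs_def quotient_of_int)

lemma N_of_int_le_1: "N (of_int k) \<le> 1"
proof (cases "k = 0")
  case False
  then show ?thesis using p_gt_1
    by (simp add: N_of_int power_int_minus inverse_le_1_iff)
qed simp

lemma N_of_int_eq_1: "\<not> int p dvd k \<Longrightarrow> N (of_int k) = 1"
  using N_of_int[of k] by (cases "k = 0") (auto simp: not_dvd_imp_multiplicity_0)

lemma N_p: "N (of_nat p) = 1 / real p"
proof -
  have "multiplicity (int p) (int p) = 1"
    using p_gt_1 by (intro multiplicity_self) auto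
  then show ?thesis using N_of_int[of "int p"] p_gt_1
    by (simp add: power_int_minus divide_inverse)
qed

lemma N_1 [simp]: "N 1 = 1"
  using N_of_int[of 1] by simp

lemma N_minus: "x \<in> E \<Longrightarrow> N (- x) = N x"
  using N_mult[of "-1" x] N_of_int[of "-1"] multiplicity_unit_right[of "- 1" "int p"]
  by (simp add: E_minus)

lemma N_inverse: "x \<in> E \<Longrightarrow> N (inverse x) = inverse (N x)"
proof (cases "x = 0")
  case False
  assume x: "x \<in> E"
  with False have "N x * N (inverse x) = 1"
    using N_mult[of x "inverse x"] by auto
  then show ?thesis by (metis inverse_unique)
qed simp

lemma N_divide: "x \<in> E \<Longrightarrow> y \<in> E \<Longrightarrow> N (x / y) = N x / N y"
  by (simp add: divide_inverse N_mult N_inverse E_inverse)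

lemma N_power: "x \<in> E \<Longrightarrow> N (x ^ k) = N x ^ k"
  by (induction k) (auto simp: N_mult E_power)

lemma N_sum_triangle: "(\<And>i. i \<in> I \<Longrightarrow> f i \<in> E) \<Longrightarrow> N (sum f I) \<le> (\<Sum>i\<in>I. N (f i))"
proof (induction I rule: infinite_finite_induct)
  case (insert i I)
  then have "N (f i + sum f I) \<le> N (f i) + N (sum f I)"
    by (intro N_triangle E_sum) auto
  with insert show ?case by force
qed auto

text \<open>The binomial theorem bounds \<open>N (x + y) ^ k\<close> by a linear function of \<open>k\<close> times \<open>M ^ k\<close>.\<close>

lemma N_ultrametric:
  assumes "x \<in> E" "y \<in> E" "N x \<le> M" "N y \<le> M"
  shows "N (x + y) \<le> M"
proof (rule ccontr)
  assume "\<not> N (x + y) \<le> M"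
  then have less: "M < N (x + y)" by simp
  have M0: "M \<ge> 0" using assms N_nonneg[of x] by simp
  have "M \<noteq> 0"
  proof
    assume "M = 0"
    with assms have "x = 0" "y = 0"
      using N_nonneg[of x] N_nonneg[of y] N_eq_0[of x] N_eq_0[of y] by auto
    with less \<open>M = 0\<close> show False by simp
  qed
  with M0 have M: "M > 0" by simp
  define t where "t = N (x + y) / M"
  have t: "t > 1" using less M by (simp add: t_def)
  have bound: "t ^ k \<le> real k + 1" for k
  proof -
    have "N ((x + y) ^ k) \<le> (\<Sum>i\<le>k. N (of_nat (k choose i) * x ^ i * y ^ (k - i)))"
      unfolding binomial_ring using assms by (intro N_sum_triangle) (auto intro!: E_mult E_power)
    also have "\<dots> \<le> (\<Sum>i\<le>k. M ^ k)"
    proof (rule sum_mono)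
      fix i assume i: "i \<in> {..k}"
      have "N (of_nat (k choose i) * x ^ i * y ^ (k - i))
          = N (of_nat (k choose i)) * N x ^ i * N y ^ (k - i)"
        using assms by (simp add: N_mult N_power E_mult E_power)
      also have "\<dots> \<le> 1 * M ^ i * M ^ (k - i)"
        using assms M N_nonneg N_of_int_le_1[of "int (k choose i)"]
        by (intro mult_mono power_mono mult_nonneg_nonneg zero_le_power) auto
      also have "\<dots> = M ^ k"
        using i by (simp flip: power_add)
      finally show "N (of_nat (k choose i) * x ^ i * y ^ (k - i)) \<le> M ^ k" .
    qed
    also have "\<dots> = (real k + 1) * M ^ k" by simp
    finally show ?thesis using assms M
      by (simp add: t_def power_divide N_power E_add divide_le_eq)
  qed
  have "filterlim (\<lambda>k::nat. t ^ k - (real k + 1)) at_top sequentially"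
    using t by real_asymp
  then have "eventually (\<lambda>k. t ^ k - (real k + 1) > 0) sequentially"
    unfolding filterlim_at_top_dense by blast
  then obtain k where "t ^ k - (real k + 1) > 0"
    by (auto simp: eventually_sequentially)
  with bound[of k] show False by simp
qed

lemma N_sum_le:
  assumes "\<And>i. i \<in> I \<Longrightarrow> f i \<in> E \<and> N (f i) \<le> M" "0 \<le> M"
  shows "N (sum f I) \<le> M"
  using assms
proof (induction I rule: infinite_finite_induct)
  case (insert i I)
  then show ?case by (auto intro!: N_ultrametric E_sum)
qed auto

lemma N_diff_le: "x \<in> E \<Longrightarrow> y \<in> E \<Longrightarrow> N x \<le> M \<Longrightarrow> N y \<le> M \<Longrightarrow> N (x - y) \<le> M"
  using N_ultrametric[of x "- y"] by (simp add: E_minus N_minus)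

text \<open>A rational number whose distance from x is less than \<open>N x\<close> has the same
  absolute value as x, so the values on \<open>E\<close> are those of the rational numbers.\<close>

lemma N_discrete:
  assumes "x \<in> E" "x \<noteq> 0"
  obtains k where "N x = real p powi k"
proof -
  have pos: "N x > 0" using assms N_nonneg[of x] N_eq_0[of x] by auto
  obtain r where r: "N (x - of_rat r) < N x" using dense_rat[OF assms(1) pos] by blast
  have "N (of_rat r) = N x"
  proof (rule antisym)
    show "N (of_rat r) \<le> N x"
      using N_diff_le[of x "x - of_rat r" "N x"] r assms by (auto simp: E_diff)
    show "N x \<le> N (of_rat r)"
    proof (rule ccontr)
      assume "\<not> N x \<le> N (of_rat r)"
      then have "N x \<le> max (N (x - of_rat r)) (N (of_rat r))"
        using N_ultrametric[of "x - of_rat r" "of_rat r"] assms by (auto simp: E_diff)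
      with r \<open>\<not> N x \<le> N (of_rat r)\<close> show False by simp
    qed
  qed
  moreover have "r \<noteq> 0" using r by auto
  ultimately show ?thesis using that N_of_rat[of r] by (metis padic_abs_def)
qed

section \<open>The p-adic integers and their residues\<close>

definition Zp :: "'f set" where "Zp = {x \<in> E. N x \<le> 1}"

lemma Zp_0 [simp]: "0 \<in> Zp" and Zp_1 [simp]: "1 \<in> Zp"
  and Zp_of_int [simp]: "of_int k \<in> Zp"
  and Zp_of_nat [simp]: "of_nat j \<in> Zp"
  and Zp_add [intro]: "x \<in> Zp \<Longrightarrow> y \<in> Zp \<Longrightarrow> x + y \<in> Zp"
  and Zp_diff [intro]: "x \<in> Zp \<Longrightarrow> y \<in> Zp \<Longrightarrow> x - y \<in> Zp"
  and Zp_minus [intro]: "x \<in> Zp \<Longrightarrow> - x \<in> Zp"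
  and Zp_mult [intro]: "x \<in> Zp \<Longrightarrow> y \<in> Zp \<Longrightarrow> x * y \<in> Zp"
  using N_of_int_le_1[of k] N_of_int_le_1[of "int j"] N_nonneg
  by (auto simp: Zp_def N_mult N_minus intro: N_ultrametric N_diff_le mult_le_one)

lemma Zp_imp_E: "x \<in> Zp \<Longrightarrow> x \<in> E" by (simp add: Zp_def)

lemma Zp_divide: "x \<in> E \<Longrightarrow> y \<in> E \<Longrightarrow> N x \<le> N y \<Longrightarrow> x / y \<in> Zp"
  using N_nonneg[of y] N_nonneg[of x] by (auto simp: Zp_def N_divide divide_le_eq_1)

lemma Zp_divide_p:
  assumes "x \<in> E" "N x < 1"
  shows "x / of_nat p \<in> Zp"
proof (cases "x = 0")
  case False
  then obtain k where k: "N x = real p powi k" using N_discrete assms by blast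
  have "k < 0"
    using assms(2) k one_le_power_int[of "real p" k] p_gt_1 by (cases "k < 0") linarith+
  then have "real p powi k \<le> real p powi (- 1)"
    using p_gt_1 by (intro power_int_increasing) auto
  then have "N x \<le> N (of_nat p)" using k by (simp add: N_p power_int_minus divide_inverse)
  then show ?thesis using assms by (intro Zp_divide) auto
qed simp

text \<open>A rational number a / b close to x is p-integral, so p does not divide b, and a times an
  inverse of b modulo p is the residue.\<close>

lemma Zp_residue:
  assumes "x \<in> Zp"
  obtains c where "c < p" "N (x - of_nat c) < 1"
proof -
  have x: "x \<in> E" "N x \<le> 1" using assms by (auto simp: Zp_def)
  obtain r where r: "N (x - of_rat r) < 1" using dense_rat[OF x(1), of 1] by auto
  obtain a b where ab: "quotient_of r = (a, b)" by (cases "quotient_of r")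
  have b: "b > 0" "coprime a b" and r_eq: "r = of_int a / of_int b"
    using quotient_of_denom_pos[OF ab] quotient_of_coprime[OF ab] quotient_of_div[OF ab] by auto
  have Nr: "N (of_rat r) \<le> 1"
    using N_diff_le[of x "x - of_rat r" 1] r x by (auto simp: E_diff)
  have nb: "\<not> int p dvd b"
  proof
    assume "int p dvd b"
    have na: "\<not> int p dvd a"
    proof
      assume "int p dvd a"
      with \<open>int p dvd b\<close> b(2) have "is_unit (int p)" using coprime_common_divisor by blast
      with p_gt_1 show False by auto
    qed
    have "N (of_int b) < 1"
    proof -
      obtain k where "b = int p * k" using \<open>int p dvd b\<close> by blast
      then have "N (of_int b) = N (of_nat p) * N (of_int k)"
        using N_mult[of "of_nat p" "of_int k"] by simp
      also have "\<dots> \<le> N (of_nat p)"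
        using N_of_int_le_1[of k] N_p p_gt_1 by (intro mult_left_le) auto
      also have "\<dots> < 1" using N_p p_gt_1 by simp
      finally show ?thesis .
    qed
    moreover have "N (of_rat r) * N (of_int b) = 1"
    proof -
      have "of_rat r * (of_int b :: 'f) = of_int a"
        using b r_eq by (simp add: of_rat_divide)
      then show ?thesis using N_mult[of "of_rat r" "of_int b"] N_of_int_eq_1[OF na] by simp
    qed
    moreover have "N (of_rat r) * N (of_int b) \<le> N (of_int b)"
      using Nr N_nonneg[of "of_int b"] by (simp add: mult_left_le_one_le N_nonneg)
    ultimately show False by simp
  qed
  have "coprime b (int p)"
    using prime_imp_coprime[of "int p" b] nb prime_p by (simp add: coprime_commute)
  then obtain y z where yz: "b * y + int p * z = 1"
    by (metis bezout_int coprime_imp_gcd_eq_1 mult.commute)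
  define c where "c = (a * y) mod int p"
  have p0: "int p > 0" using p_gt_1 by simp
  have "int p dvd a - c * b"
  proof -
    have "a - c * b = (a * y - c) * b + a * (1 - b * y)" by (simp add: algebra_simps)
    also have "1 - b * y = int p * z" using yz by simp
    finally show ?thesis unfolding c_def by (metis dvd_add dvd_minus_mod dvd_mult dvd_mult2 dvd_triv_left)
  qed
  then obtain k where k: "a - c * b = int p * k" by blast
  have "N (of_rat r - of_int c) < 1"
  proof -
    have "(of_rat r - of_int c) * of_int b = (of_int (a - c * b) :: 'f)"
      using b r_eq by (simp add: of_rat_divide algebra_simps)
    then have "N (of_rat r - of_int c) * N (of_int b) = N (of_int (a - c * b))"
      using N_mult[of "of_rat r - of_int c" "of_int b"] by (simp add: E_diff)
    also have "\<dots> = N (of_nat p) * N (of_int k)"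
      using k N_mult[of "of_nat p" "of_int k"] by simp
    also have "\<dots> \<le> N (of_nat p)"
      using N_of_int_le_1[of k] N_p p_gt_1 by (intro mult_left_le) auto
    also have "\<dots> < 1" using N_p p_gt_1 by simp
    finally show ?thesis using N_of_int_eq_1[OF nb] by simp
  qed
  then have "N (x - of_int c) \<le> max (N (x - of_rat r)) (N (of_rat r - of_int c))"
    using N_ultrametric[of "x - of_rat r" "of_rat r - of_int c"] x by (auto simp: E_diff)
  then have "N (x - of_int c) < 1" using r \<open>N (of_rat r - of_int c) < 1\<close> by simp
  moreover have "c \<ge> 0" "c < int p" using p0 by (auto simp: c_def)
  ultimately show ?thesis using that[of "nat c"] by (metis int_nat_eq of_int_of_nat_eq zless_nat_conj nat_less_iff)
qed


section \<open>Finitely generated modules over the p-adic integers\<close>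

inductive_set zspan :: "'f set \<Rightarrow> 'f set" for X where
  zspan_0: "0 \<in> zspan X"
| zspan_step: "y \<in> zspan X \<Longrightarrow> a \<in> Zp \<Longrightarrow> x \<in> X \<Longrightarrow> y + a * x \<in> zspan X"

lemma zspan_base: "x \<in> X \<Longrightarrow> x \<in> zspan X"
  using zspan_step[OF zspan_0, of 1 x X] by simp

lemma zspan_add:
  assumes "x \<in> zspan X" "y \<in> zspan X" shows "x + y \<in> zspan X"
  using assms(2)
proof (induction y rule: zspan.induct)
  case (zspan_step y a z)
  then show ?case using zspan.zspan_step[of "x + y" X a z] by (simp add: add.assoc)
qed (simp add: assms)

lemma zspan_scale: "x \<in> zspan X \<Longrightarrow> a \<in> Zp \<Longrightarrow> a * x \<in> zspan X"
proof (induction x rule: zspan.induct)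
  case (zspan_step y b z)
  then show ?case using zspan.zspan_step[of "a * y" X "a * b" z]
    by (auto simp: algebra_simps)
qed (simp add: zspan_0)

lemma zspan_diff: "x \<in> zspan X \<Longrightarrow> y \<in> zspan X \<Longrightarrow> x - y \<in> zspan X"
  using zspan_add[of x X "- 1 * y"] zspan_scale[of y X "-1"] by (simp add: Zp_minus)

lemma zspan_sum: "(\<And>i. i \<in> I \<Longrightarrow> f i \<in> zspan X) \<Longrightarrow> sum f I \<in> zspan X"
  by (induction I rule: infinite_finite_induct) (auto simp: zspan_0 zspan_add)

lemma zspan_subset:
  assumes "X \<subseteq> zspan Y" shows "zspan X \<subseteq> zspan Y"
proof
  fix x assume "x \<in> zspan X"
  then show "x \<in> zspan Y"
    by induction (use assms in \<open>auto intro: zspan_0 zspan_add zspan_scale\<close>)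
qed

lemma zspan_mult_subset:
  assumes "x \<in> zspan X" "\<And>u. u \<in> X \<Longrightarrow> c * u \<in> zspan Y"
  shows "c * x \<in> zspan Y"
  using assms(1)
proof induction
  case (zspan_step y a u)
  then have "c * y + a * (c * u) \<in> zspan Y"
    using assms(2) by (blast intro: zspan_add zspan_scale)
  then show ?case by (simp add: algebra_simps)
qed (simp add: zspan_0)

lemma zspan_mult:
  assumes "x \<in> zspan X" "y \<in> zspan Y"
  shows "x * y \<in> zspan ((\<lambda>(u, v). u * v) ` (X \<times> Y))"
proof -
  have "u * y \<in> zspan ((\<lambda>(u, v). u * v) ` (X \<times> Y))" if "u \<in> X" for u
    using that by (intro zspan_mult_subset[OF assms(2)] zspan_base) auto
  then have "y * x \<in> zspan ((\<lambda>(u, v). u * v) ` (X \<times> Y))"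
    by (intro zspan_mult_subset[OF assms(1)]) (simp add: mult.commute)
  then show ?thesis by (simp add: mult.commute)
qed

lemma zspan_image_finite:
  assumes "x \<in> zspan (f ` I)" "finite I"
  shows "\<exists>a. (\<forall>i\<in>I. a i \<in> Zp) \<and> x = (\<Sum>i\<in>I. a i * f i)"
  using assms(1)
proof induction
  case zspan_0
  show ?case by (intro exI[of _ "\<lambda>_. 0"]) simp
next
  case (zspan_step y b z)
  then obtain a i where a: "\<forall>i\<in>I. a i \<in> Zp" "y = (\<Sum>i\<in>I. a i * f i)" and i: "i \<in> I" "z = f i"
    by blast
  have "(\<Sum>j\<in>I. (a(i := a i + b)) j * f j) = (\<Sum>j\<in>I. a j * f j + (if j = i then b * f i else 0))"
    by (intro sum.cong) (auto simp: algebra_simps)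
  also have "\<dots> = y + b * z"
    using assms(2) i a by (simp add: sum.distrib)
  finally show ?case using a i zspan_step
    by (intro exI[of _ "a(i := a i + b)"]) auto
qed

lemma zspan_insertE:
  assumes "x \<in> zspan (insert b B)"
  obtains c y where "c \<in> Zp" "y \<in> zspan B" "x = c * b + y"
proof -
  have "\<exists>c y. c \<in> Zp \<and> y \<in> zspan B \<and> x = c * b + y"
    using assms
  proof induction
    case zspan_0
    show ?case by (intro exI[of _ 0]) (auto intro: zspan.zspan_0)
  next
    case (zspan_step z a u)
    then obtain c y where cy: "c \<in> Zp" "y \<in> zspan B" "z = c * b + y" by blast
    show ?case
    proof (cases "u = b")
      case True
      then show ?thesis using cy zspan_step
        by (intro exI[of _ "c + a"] exI[of _ y]) (auto simp: algebra_simps)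
    next
      case False
      then show ?thesis using cy zspan_step
        by (intro exI[of _ c] exI[of _ "y + a * u"]) (auto intro: zspan.zspan_step)
    qed
  qed
  then show ?thesis using that by blast
qed

lemma Zp_norm_power:
  assumes "x \<in> Zp" "x \<noteq> 0"
  obtains m :: nat where "N x = (1 / real p) ^ m"
proof -
  obtain k where k: "N x = real p powi k" using N_discrete assms Zp_imp_E by blast
  have "k \<le> 0"
  proof (rule ccontr)
    assume "\<not> k \<le> 0"
    then have "real p powi k > 1"
      using p_gt_1 by (auto simp: power_int_def intro!: one_less_power)
    with k assms show False by (simp add: Zp_def)
  qed
  then have "real p powi k = (1 / real p) ^ nat (- k)"
    by (auto simp: power_int_def power_divide divide_inverse power_inverse)
  with k that show ?thesis by metis
qed

text \<open>The nonzero values are powers of 1 / p with natural exponents, so a largest value is one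
  with a least exponent.\<close>

lemma Zp_max_norm:
  fixes c :: "nat \<Rightarrow> 'f"
  assumes "\<And>k. c k \<in> Zp"
  obtains k0 where "\<And>k. N (c k) \<le> N (c k0)"
proof (cases "\<exists>k. c k \<noteq> 0")
  case False
  then show ?thesis using that by force
next
  case True
  define P where "P m \<longleftrightarrow> (\<exists>k. c k \<noteq> 0 \<and> N (c k) = (1 / real p) ^ m)" for m
  have "\<exists>m. P m" using True Zp_norm_power assms unfolding P_def by metis
  then have "P (LEAST m. P m)" by (metis LeastI_ex)
  then obtain k0 where k0: "c k0 \<noteq> 0" "N (c k0) = (1 / real p) ^ (LEAST m. P m)"
    unfolding P_def by blast
  have "N (c k) \<le> N (c k0)" for k
  proof (cases "c k = 0")
    case True
    then show ?thesis using N_nonneg[of "c k0"] assms Zp_imp_E by simp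
  next
    case False
    then obtain m where m: "N (c k) = (1 / real p) ^ m" using Zp_norm_power assms by metis
    then have "P m" using False unfolding P_def by blast
    then have "(LEAST m. P m) \<le> m" by (rule Least_le)
    then show ?thesis unfolding m k0(2) using p_gt_1 by (intro power_decreasing) auto
  qed
  then show ?thesis using that by blast
qed

text \<open>The coefficient of \<open>b\<close> is eliminated with the help of a term in which it has maximal absolute value.\<close>

lemma zspan_noetherian:
  fixes x :: "nat \<Rightarrow> 'f"
  assumes "finite B" "\<And>k. x k \<in> zspan B"
  shows "\<exists>K. x K \<in> zspan (x ` {..<K})"
  using assms
proof (induction B arbitrary: x rule: finite_induct)
  case empty
  have "y = 0" if "y \<in> zspan {}" for y using that by induction auto
  then show ?case using empty by (metis zspan_0)
next
  case (insert b B)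
  have "\<forall>k. \<exists>c y. c \<in> Zp \<and> y \<in> zspan B \<and> x k = c * b + y"
    using zspan_insertE[OF insert.prems] by metis
  then obtain c y where cy: "\<And>k. c k \<in> Zp" "\<And>k. y k \<in> zspan B" "\<And>k. x k = c k * b + y k"
    by metis
  obtain k0 where k0: "\<And>k. N (c k) \<le> N (c k0)" using Zp_max_norm cy(1) by blast
  define q where "q k = c k / c k0" for k
  have q: "q k \<in> Zp" for k
    unfolding q_def using k0 cy(1) Zp_imp_E by (intro Zp_divide) auto
  have cq: "c k = q k * c k0" for k
  proof (cases "c k0 = 0")
    case True
    then have "N (c k) = 0" using k0[of k] N_nonneg[of "c k"] cy(1)[THEN Zp_imp_E] by simp
    then show ?thesis using True N_eq_0[of "c k"] cy(1)[THEN Zp_imp_E] by simp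
  qed (simp add: q_def)
  define z where "z k = x (Suc (k0 + k)) - q (Suc (k0 + k)) * x k0" for k
  have "z k = y (Suc (k0 + k)) - q (Suc (k0 + k)) * y k0" for k
    unfolding z_def using cy(3) cq[of "Suc (k0 + k)"] by (simp add: algebra_simps)
  then have "\<And>k. z k \<in> zspan B"
    using cy(2) q by (metis zspan_diff zspan_scale)
  from insert.IH[of z, OF this] obtain K where K: "z K \<in> zspan (z ` {..<K})" by blast
  let ?Y = "x ` {..<Suc (k0 + K)}"
  have "z ` {..<K} \<subseteq> zspan ?Y"
  proof clarify
    fix k assume "k < K"
    then show "z k \<in> zspan ?Y"
      unfolding z_def by (intro zspan_diff zspan_scale q) (auto intro!: zspan_base)
  qed
  with K have "z K \<in> zspan ?Y" using zspan_subset by blast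
  moreover have "q (Suc (k0 + K)) * x k0 \<in> zspan ?Y"
    by (intro zspan_scale zspan_base q) auto
  ultimately have "x (Suc (k0 + K)) \<in> zspan ?Y"
    unfolding z_def using zspan_add by fastforce
  then show ?case by blast
qed

section \<open>Integral elements\<close>

definition int_ring :: "'f set" where "int_ring = ring_of_integers E N"

text \<open>Integrality in terms of modules: with \<open>zspan_noetherian\<close> it yields that
  sums and products of integral elements are integral without the construction of a
  polynomial.\<close>

lemma int_ring_iff_zspan: "x \<in> int_ring \<longleftrightarrow> (\<exists>K. x ^ K \<in> zspan ((\<lambda>i. x ^ i) ` {..<K}))"
proof
  assume "x \<in> int_ring"
  then obtain P where P: "lead_coeff P = 1" "\<And>i. coeff P i \<in> Zp" "poly P x = 0"
    by (auto simp: int_ring_def ring_of_integers_def Zp_def)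
  have "x ^ degree P = - (\<Sum>i<degree P. coeff P i * x ^ i)"
    using P by (simp add: poly_altdef lessThan_Suc_atMost[symmetric] eq_neg_iff_add_eq_0 add.commute)
  also have "\<dots> = (\<Sum>i<degree P. - coeff P i * x ^ i)" by (simp add: sum_negf)
  also have "\<dots> \<in> zspan ((\<lambda>i. x ^ i) ` {..<degree P})"
    using P by (intro zspan_sum zspan_scale zspan_base Zp_minus) auto
  finally show "\<exists>K. x ^ K \<in> zspan ((\<lambda>i. x ^ i) ` {..<K})" by blast
next
  assume "\<exists>K. x ^ K \<in> zspan ((\<lambda>i. x ^ i) ` {..<K})"
  then obtain K a where a: "\<And>i. i < K \<Longrightarrow> a i \<in> Zp" "x ^ K = (\<Sum>i<K. a i * x ^ i)"
    using zspan_image_finite[of _ "\<lambda>i. x ^ i"] by (metis finite_lessThan lessThan_iff)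
  define P where "P = monom 1 K - (\<Sum>i<K. monom (a i) i)"
  have coeff: "coeff P j = (if j < K then - a j else if j = K then 1 else 0)" for j
    by (simp add: P_def coeff_sum)
  have "degree P = K"
    by (rule antisym) (auto simp: coeff intro!: degree_le le_degree)
  then have "lead_coeff P = 1" by (simp add: coeff)
  moreover have "coeff P j \<in> Zp" for j using a(1) by (auto simp: coeff Zp_minus)
  moreover have "poly P x = 0"
    using a(2) by (simp add: P_def poly_monom poly_sum)
  ultimately show "x \<in> int_ring" by (auto simp: int_ring_def ring_of_integers_def Zp_def)
qed

lemma int_ring_relation:
  assumes "x \<in> int_ring"
  obtains K a where "\<And>i. i < K \<Longrightarrow> a i \<in> Zp" "x ^ K = (\<Sum>i<K. a i * x ^ i)"
proof -
  obtain K where K: "x ^ K \<in> zspan ((\<lambda>i. x ^ i) ` {..<K})" using assms int_ring_iff_zspan by blast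
  then show ?thesis using that zspan_image_finite[OF K] by auto
qed

lemma Zp_subset_int_ring: "x \<in> Zp \<Longrightarrow> x \<in> int_ring"
  unfolding int_ring_iff_zspan
  using zspan_scale[OF zspan_base, of "1" "(\<lambda>i. x ^ i) ` {..<1}" x]
  by (intro exI[of _ 1]) auto

lemma int_ring_powers:
  assumes "x \<in> int_ring"
  obtains X where "finite X" "\<And>k. x ^ k \<in> zspan X"
proof -
  obtain K where K: "x ^ K \<in> zspan ((\<lambda>i. x ^ i) ` {..<K})" using assms int_ring_iff_zspan by blast
  have "x ^ k \<in> zspan ((\<lambda>i. x ^ i) ` {..<K})" for k
  proof (induction k)
    case 0
    show ?case using K by (cases "K = 0") (auto intro: zspan_base intro!: image_eqI[of _ _ 0])
  next
    case (Suc k)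
    have "x * x ^ i \<in> zspan ((\<lambda>i. x ^ i) ` {..<K})" if "i < K" for i
    proof (cases "Suc i = K")
      case True
      with K show ?thesis by auto
    next
      case False
      with that show ?thesis by (intro zspan_base image_eqI[of _ _ "Suc i"]) auto
    qed
    then show ?case unfolding power_Suc by (intro zspan_mult_subset[OF Suc]) auto
  qed
  then show ?thesis using that by blast
qed

text \<open>In a finitely generated module one of the powers of x is a combination of the earlier
  ones, and this is a monic equation for x.\<close>

lemma int_ring_intro:
  assumes "finite X" "\<And>k. x ^ k \<in> zspan X"
  shows "x \<in> int_ring"
  unfolding int_ring_iff_zspan using zspan_noetherian[OF assms] by simp

lemma int_ring_mult [intro]: "x \<in> int_ring \<Longrightarrow> y \<in> int_ring \<Longrightarrow> x * y \<in> int_ring"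
  and int_ring_add [intro]: "x \<in> int_ring \<Longrightarrow> y \<in> int_ring \<Longrightarrow> x + y \<in> int_ring"
proof -
  assume "x \<in> int_ring" "y \<in> int_ring"
  then obtain X Y where XY: "finite X" "\<And>k. x ^ k \<in> zspan X" "finite Y" "\<And>k. y ^ k \<in> zspan Y"
    using int_ring_powers by metis
  let ?Z = "(\<lambda>(u, v). u * v) ` (X \<times> Y)"
  have fin: "finite ?Z" using XY by auto
  have Z: "x ^ i * y ^ j \<in> zspan ?Z" for i j using XY by (intro zspan_mult) auto
  show "x * y \<in> int_ring" using fin by (rule int_ring_intro) (simp add: power_mult_distrib Z)
  show "x + y \<in> int_ring" using fin
    by (rule int_ring_intro) (auto simp: binomial_ring mult.assoc intro!: zspan_sum zspan_scale Z)
qed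

lemma int_ring_0 [simp]: "0 \<in> int_ring" and int_ring_1 [simp]: "1 \<in> int_ring" and int_ring_of_nat [simp]: "of_nat k \<in> int_ring"
  by (auto intro: Zp_subset_int_ring)

lemma int_ring_minus [intro]: "x \<in> int_ring \<Longrightarrow> - x \<in> int_ring"
  using int_ring_mult[of "- 1" x] Zp_subset_int_ring[of "-1"] by (simp add: Zp_minus)

lemma int_ring_diff [intro]: "x \<in> int_ring \<Longrightarrow> y \<in> int_ring \<Longrightarrow> x - y \<in> int_ring"
  using int_ring_add[of x "- y"] by auto

lemma int_ring_power [intro]: "x \<in> int_ring \<Longrightarrow> x ^ k \<in> int_ring"
  by (induction k) auto

lemma int_ring_sum: "(\<And>i. i \<in> I \<Longrightarrow> f i \<in> int_ring) \<Longrightarrow> sum f I \<in> int_ring"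
  by (induction I rule: infinite_finite_induct) auto

lemma p_nonzero [simp]: "(of_nat p :: 'f) \<noteq> 0"
  using p_gt_1 by simp

text \<open>In a monic equation of degree K for 1 / p the leading term would have absolute value p^K
  and every other term at most p^(K - 1).\<close>

lemma inverse_p_notin_int_ring: "inverse (of_nat p) \<notin> int_ring"
proof
  let ?x = "inverse (of_nat p) :: 'f"
  assume "?x \<in> int_ring"
  then obtain K a where a: "\<And>i. i < K \<Longrightarrow> a i \<in> Zp" "?x ^ K = (\<Sum>i<K. a i * ?x ^ i)"
    using int_ring_relation by blast
  have xE: "?x \<in> E" by auto
  have Nx: "N ?x = real p" using N_p by (simp add: N_inverse)
  have K: "K > 0" using a(2) by (cases K) auto
  have "N (\<Sum>i<K. a i * ?x ^ i) \<le> real p ^ (K - 1)"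
  proof (rule N_sum_le)
    fix i assume "i \<in> {..<K}"
    then have i: "i < K" by simp
    have "N (a i * ?x ^ i) = N (a i) * real p ^ i"
      using a(1)[OF i] xE Nx by (simp add: N_mult N_power E_power Zp_imp_E)
    also have "\<dots> \<le> 1 * real p ^ (K - 1)"
      using a(1)[OF i] i p_gt_1 N_nonneg
      by (intro mult_mono power_increasing) (auto simp: Zp_def)
    finally show "a i * ?x ^ i \<in> E \<and> N (a i * ?x ^ i) \<le> real p ^ (K - 1)"
      using a(1)[OF i] xE by (auto intro: Zp_imp_E)
  qed simp
  moreover have "N (?x ^ K) = real p ^ K" using xE Nx by (simp add: N_power)
  ultimately have "real p ^ K \<le> real p ^ (K - 1)" using a(2) by simp
  moreover have "real p ^ (K - 1) < real p ^ K" using K p_gt_1 by (intro power_strict_increasing) auto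
  ultimately show False by simp
qed

section \<open>Linear algebra over the p-adic numbers\<close>

lemma homogeneous_system:
  assumes "finite J" "finite I" "card J < card I" "\<And>i j. i \<in> I \<Longrightarrow> j \<in> J \<Longrightarrow> c i j \<in> E"
  shows "\<exists>e. (\<forall>i\<in>I. e i \<in> E) \<and> (\<exists>i\<in>I. e i \<noteq> 0) \<and> (\<forall>j\<in>J. (\<Sum>i\<in>I. e i * c i j) = 0)"
  using assms
proof (induction J arbitrary: I c rule: finite_induct)
  case empty
  then show ?case by (intro exI[of _ "\<lambda>_. 1"]) (auto simp: card_gt_0_iff)
next
  case (insert j J)
  show ?case
  proof (cases "\<forall>i\<in>I. c i j = 0")
    case True
    have "card J < card I" using insert by simp
    from insert.IH[OF insert.prems(1) this insert.prems(3)] True show ?thesis by auto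
  next
    case False
    then obtain k where k: "k \<in> I" "c k j \<noteq> 0" by blast
    define d where "d i l = c i l - c i j / c k j * c k l" for i l
    have "card J < card (I - {k})" using insert k by simp
    moreover have "d i l \<in> E" if "i \<in> I - {k}" "l \<in> J" for i l
      unfolding d_def using that k insert.prems(3) by (intro E_diff E_mult E_divide) auto
    ultimately obtain e where e: "\<forall>i\<in>I - {k}. e i \<in> E" "\<exists>i\<in>I - {k}. e i \<noteq> 0"
      "\<forall>l\<in>J. (\<Sum>i\<in>I - {k}. e i * d i l) = 0"
      using insert.IH[of "I - {k}" d] insert.prems(1) by auto
    define e' where "e' = e(k := - (\<Sum>i\<in>I - {k}. e i * (c i j / c k j)))"
    have *: "(\<Sum>i\<in>I. e' i * c i l) = (\<Sum>i\<in>I - {k}. e i * d i l)" for l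
    proof -
      have "(\<Sum>i\<in>I. e' i * c i l) = e' k * c k l + (\<Sum>i\<in>I - {k}. e' i * c i l)"
        using insert.prems(1) k by (simp add: sum.remove)
      also have "(\<Sum>i\<in>I - {k}. e' i * c i l) = (\<Sum>i\<in>I - {k}. e i * c i l)"
        by (intro sum.cong) (auto simp: e'_def)
      finally have "(\<Sum>i\<in>I. e' i * c i l) = e' k * c k l + (\<Sum>i\<in>I - {k}. e i * c i l)" .
      moreover have "(\<Sum>i\<in>I - {k}. e i * d i l)
          = (\<Sum>i\<in>I - {k}. e i * c i l) - (\<Sum>i\<in>I - {k}. e i * (c i j / c k j)) * c k l"
        by (simp add: d_def right_diff_distrib sum_subtractf sum_distrib_right mult.assoc)
      ultimately show ?thesis by (simp add: e'_def)
    qed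
    have "(\<Sum>i\<in>I. e' i * c i j) = 0" unfolding * using k by (simp add: d_def)
    moreover have "e' k \<in> E"
      unfolding e'_def fun_upd_same using e insert.prems(3) k
      by (intro E_minus E_sum E_mult E_divide) auto
    ultimately show ?thesis
      using e * by (intro exI[of _ e']) (auto simp: e'_def)
  qed
qed

text \<open>The bound d is the size of a finite generating set of the field over \<open>E\<close>.
  Division by a coefficient of maximal absolute value makes all coefficients integral and one of
  them a unit.\<close>

lemma linear_dependence:
  obtains d :: nat where "\<And>(I :: nat set) r. finite I \<Longrightarrow> d < card I \<Longrightarrow>
    \<exists>e. (\<forall>i\<in>I. e i \<in> Zp) \<and> (\<exists>i\<in>I. N (e i) = 1) \<and> (\<Sum>i\<in>I. e i * r i) = 0"
proof -
  obtain B where B: "finite B" "\<And>x. \<exists>c. (\<forall>b\<in>B. c b \<in> E) \<and> x = (\<Sum>b\<in>B. c b * b)"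
    using finite_over_E unfolding finite_over_def by blast
  have "\<exists>e. (\<forall>i\<in>I. e i \<in> Zp) \<and> (\<exists>i\<in>I. N (e i) = 1) \<and> (\<Sum>i\<in>I. e i * r i) = 0"
    if I: "finite I" "card B < card I" for I :: "nat set" and r
  proof -
    have "\<forall>i. \<exists>c. (\<forall>b\<in>B. c b \<in> E) \<and> r i = (\<Sum>b\<in>B. c b * b)"
      using B(2) by blast
    from choice[OF this] obtain c where
      c: "\<And>i b. b \<in> B \<Longrightarrow> c i b \<in> E" "\<And>i. r i = (\<Sum>b\<in>B. c i b * b)" by blast
    obtain e where e: "\<forall>i\<in>I. e i \<in> E" "\<exists>i\<in>I. e i \<noteq> 0" "\<forall>b\<in>B. (\<Sum>i\<in>I. e i * c i b) = 0"
      using homogeneous_system[OF B(1) I, of c] c(1) by blast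
    have "(\<Sum>i\<in>I. e i * r i) = (\<Sum>b\<in>B. (\<Sum>i\<in>I. e i * c i b) * b)"
      unfolding c(2) sum_distrib_left sum_distrib_right
      by (subst sum.swap) (simp add: mult.assoc)
    also have "\<dots> = 0" using e(3) by simp
    finally have er: "(\<Sum>i\<in>I. e i * r i) = 0" .
    define M where "M = Max ((\<lambda>i. N (e i)) ` I)"
    have "M \<in> (\<lambda>i. N (e i)) ` I" unfolding M_def using I e by (intro Max_in) auto
    then obtain k where k: "k \<in> I" "M = N (e k)" by blast
    have le: "N (e i) \<le> N (e k)" if "i \<in> I" for i
      unfolding k(2)[symmetric] M_def using that I by (intro Max_ge) auto
    have ek: "e k \<noteq> 0"
    proof
      assume "e k = 0"
      then have "N (e i) = 0" if "i \<in> I" for i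
        using le[OF that] N_nonneg[of "e i"] e(1) that by simp
      then show False using e N_eq_0 by blast
    qed
    have "(\<Sum>i\<in>I. e i / e k * r i) = (\<Sum>i\<in>I. e i * r i) / e k"
      by (simp add: sum_divide_distrib)
    then show ?thesis using er ek le e k
      by (intro exI[of _ "\<lambda>i. e i / e k"]) (auto intro!: Zp_divide bexI[of _ k])
  qed
  then show ?thesis using that by blast
qed

lemma p_power_scale_Zp:
  assumes "x \<in> E"
  obtains k where "\<And>l. k \<le> l \<Longrightarrow> x * of_nat p ^ l \<in> Zp"
proof -
  have "filterlim (\<lambda>k. real p ^ k) at_top sequentially"
    using p_gt_1 by real_asymp
  then obtain k where k: "\<And>l. l \<ge> k \<Longrightarrow> N x \<le> real p ^ l"
    unfolding filterlim_at_top eventually_sequentially by blast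
  have "x * of_nat p ^ l \<in> Zp" if "k \<le> l" for l
  proof -
    have "N (x * of_nat p ^ l) = N x * (1 / real p) ^ l"
      using assms N_mult[of x "of_nat p ^ l"] N_power[of "of_nat p" l] N_p by (simp add: E_power)
    also have "\<dots> \<le> real p ^ l * (1 / real p) ^ l"
      using k[OF that] by (intro mult_right_mono) auto
    also have "\<dots> = 1" using p_gt_1 by (simp add: power_divide)
    finally show ?thesis using assms by (auto simp: Zp_def intro!: E_mult E_power)
  qed
  then show ?thesis using that by blast
qed

text \<open>Denominators are cleared in an algebraic equation for x: in the equation for p^l x, the
  coefficient of index i is multiplied by p^(l (m - i)), which is integral for large l.\<close>

lemma p_power_scale_int_ring:
  obtains k where "of_nat p ^ k * x \<in> int_ring"
proof -
  obtain d where d: "\<And>(I :: nat set) r. finite I \<Longrightarrow> d < card I \<Longrightarrow>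
    \<exists>e. (\<forall>i\<in>I. e i \<in> Zp) \<and> (\<exists>i\<in>I. N (e i) = 1) \<and> (\<Sum>i\<in>I. e i * r i) = 0"
    using linear_dependence by blast
  obtain e where e: "\<And>i. i \<le> d \<Longrightarrow> e i \<in> Zp" "\<exists>i\<le>d. N (e i) = 1" "(\<Sum>i\<le>d. e i * x ^ i) = 0"
    using d[of "{..d}" "\<lambda>i. x ^ i"] by auto
  define m where "m = Max {i. i \<le> d \<and> e i \<noteq> 0}"
  have "m \<in> {i. i \<le> d \<and> e i \<noteq> 0}"
    unfolding m_def using e(2) by (intro Max_in) auto
  then have m: "m \<le> d" "e m \<noteq> 0" by auto
  have big: "e i = 0" if "i \<le> d" "m < i" for i
    using that Max_ge[of "{i. i \<le> d \<and> e i \<noteq> 0}" i] unfolding m_def[symmetric] by auto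
  have "(\<Sum>i\<le>d. e i * x ^ i) = (\<Sum>i\<le>m. e i * x ^ i)"
    using m big by (intro sum.mono_neutral_right) auto
  with e(3) have *: "e m * x ^ m = - (\<Sum>i<m. e i * x ^ i)"
    by (simp add: lessThan_Suc_atMost[symmetric] eq_neg_iff_add_eq_0 add.commute)
  define b where "b i = - e i / e m" for i
  have xm: "x ^ m = (\<Sum>i<m. b i * x ^ i)"
  proof -
    have "x ^ m = (- (\<Sum>i<m. e i * x ^ i)) / e m" using * m by (simp add: field_simps)
    also have "\<dots> = (\<Sum>i<m. - (e i * x ^ i)) / e m" by (simp only: sum_negf)
    also have "\<dots> = (\<Sum>i<m. b i * x ^ i)"
      unfolding sum_divide_distrib by (intro sum.cong) (auto simp: b_def)
    finally show ?thesis .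
  qed
  have bE: "b i \<in> E" if "i < m" for i
    unfolding b_def using e(1)[of i] e(1)[of m] m that by (intro E_divide E_minus) (auto intro: Zp_imp_E)
  have "\<forall>i. \<exists>k. i < m \<longrightarrow> (\<forall>l\<ge>k. b i * of_nat p ^ l \<in> Zp)"
    using p_power_scale_Zp bE by metis
  then obtain k where k: "\<And>i l. i < m \<Longrightarrow> k i \<le> l \<Longrightarrow> b i * of_nat p ^ l \<in> Zp" by metis
  define l where "l = (\<Sum>i<m. k i)"
  have kl: "k i \<le> l" if "i < m" for i
    unfolding l_def using that by (intro member_le_sum) auto
  have "(of_nat p ^ l * x) ^ m = (\<Sum>i<m. (b i * of_nat p ^ (l * (m - i))) * (of_nat p ^ l * x) ^ i)"
  proof -
    have "of_nat p ^ (l * m) * (b i * x ^ i) = (b i * of_nat p ^ (l * (m - i))) * (of_nat p ^ l * x) ^ i"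
      if "i < m" for i
    proof -
      have "l * m = l * (m - i) + l * i" using that by (simp flip: distrib_left)
      then have "of_nat p ^ (l * m) = (of_nat p ^ (l * (m - i)) * of_nat p ^ (l * i) :: 'f)"
        by (simp only: power_add)
      then show ?thesis by (simp add: power_mult_distrib power_mult[of _ l i])
    qed
    then have "of_nat p ^ (l * m) * (\<Sum>i<m. b i * x ^ i)
        = (\<Sum>i<m. (b i * of_nat p ^ (l * (m - i))) * (of_nat p ^ l * x) ^ i)"
      unfolding sum_distrib_left by (intro sum.cong) auto
    then show ?thesis using xm by (simp add: power_mult_distrib power_mult[of _ l m])
  qed
  also have "\<dots> \<in> zspan ((\<lambda>i. (of_nat p ^ l * x) ^ i) ` {..<m})"
  proof (rule zspan_sum)
    fix i assume "i \<in> {..<m}"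
    then have i: "i < m" by simp
    then have "k i \<le> l * (m - i)"
      using kl[OF i] by (metis le_trans mult.commute mult_le_mono1 nat_mult_1 Suc_leI zero_less_diff One_nat_def)
    with i show "b i * of_nat p ^ (l * (m - i)) * (of_nat p ^ l * x) ^ i
        \<in> zspan ((\<lambda>i. (of_nat p ^ l * x) ^ i) ` {..<m})"
      by (intro zspan_scale zspan_base k) auto
  qed
  finally show ?thesis using that int_ring_iff_zspan by blast
qed

text \<open>A monic equation of least degree for r has a nonzero constant term, as r could be
  cancelled otherwise. This term is a multiple of r and divides a power of p.\<close>

lemma int_ring_divides_p_power:
  assumes "r \<in> int_ring" "r \<noteq> 0"
  obtains j s where "s \<in> int_ring" "of_nat p ^ j = r * s"
proof -
  define P where "P K \<longleftrightarrow> (\<exists>a. (\<forall>i<K. a i \<in> Zp) \<and> r ^ K = (\<Sum>i<K. a i * r ^ i))" for K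
  have "\<exists>K. P K" unfolding P_def
    using int_ring_relation[OF assms(1)] by blast
  define K where "K = (LEAST K. P K)"
  have "P K" using \<open>\<exists>K. P K\<close> unfolding K_def by (rule LeastI_ex)
  then obtain a where a: "\<And>i. i < K \<Longrightarrow> a i \<in> Zp" "r ^ K = (\<Sum>i<K. a i * r ^ i)"
    unfolding P_def by blast
  obtain k where k: "K = Suc k" using a(2) by (cases K) auto
  have split: "(\<Sum>i<K. a i * r ^ i) = a 0 + r * (\<Sum>i<k. a (Suc i) * r ^ i)"
    unfolding k sum.lessThan_Suc_shift by (simp add: sum_distrib_left algebra_simps)
  have a0: "a 0 \<noteq> 0"
  proof
    assume "a 0 = 0"
    with split a(2) k assms(2) have "r ^ k = (\<Sum>i<k. a (Suc i) * r ^ i)" by simp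
    then have "P k" unfolding P_def using a(1) k by (intro exI[of _ "\<lambda>i. a (Suc i)"]) auto
    then have "K \<le> k" unfolding K_def by (rule Least_le)
    then show False using k by simp
  qed
  define s where "s = r ^ k - (\<Sum>i<k. a (Suc i) * r ^ i)"
  have s: "a 0 = r * s" using split a(2) k by (simp add: s_def algebra_simps)
  have sO: "s \<in> int_ring" unfolding s_def
    using a(1) k assms by (intro int_ring_diff int_ring_power int_ring_sum int_ring_mult) (auto intro: Zp_subset_int_ring)
  obtain j where "inverse (a 0) * of_nat p ^ j \<in> Zp"
    using p_power_scale_Zp[of "inverse (a 0)"] a(1)[of 0] k by (auto intro: Zp_imp_E)
  then have "s * (inverse (a 0) * of_nat p ^ j) \<in> int_ring" using sO Zp_subset_int_ring by blast
  moreover have "of_nat p ^ j = r * (s * (inverse (a 0) * of_nat p ^ j))"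
    using s a0 by (simp add: field_simps)
  ultimately show ?thesis using that by blast
qed

end

section \<open>Fields with a discrete valuation ring and a finite residue field\<close>

locale dvr_field =
  fixes R :: "'f::field set" and \<tau> :: 'f
  assumes R_0 [simp]: "0 \<in> R" and R_1 [simp]: "1 \<in> R"
    and R_add: "x \<in> R \<Longrightarrow> y \<in> R \<Longrightarrow> x + y \<in> R"
    and R_minus: "x \<in> R \<Longrightarrow> - x \<in> R"
    and R_mult: "x \<in> R \<Longrightarrow> y \<in> R \<Longrightarrow> x * y \<in> R"
    and tau_in_R: "\<tau> \<in> R" and tau_nonzero [simp]: "\<tau> \<noteq> 0" and tau_not_unit: "inverse \<tau> \<notin> R"
    and unit_decomposition: "x \<noteq> 0 \<Longrightarrow> \<exists>k. \<exists>u\<in>unit_set R. x = \<tau> powi k * u"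
    and finite_residue: "\<exists>S. finite S \<and> S \<subseteq> R \<and> (\<forall>x\<in>R. \<exists>s\<in>S. \<exists>y\<in>R. x - s = \<tau> * y)"
begin

abbreviation val :: "'f \<Rightarrow> int" where "val \<equiv> valuation R \<tau>"

lemma R_power: "x \<in> R \<Longrightarrow> x ^ k \<in> R"
  by (induction k) (auto intro: R_mult)

lemma unit_iff: "u \<in> unit_set R \<longleftrightarrow> u \<noteq> 0 \<and> u \<in> R \<and> inverse u \<in> R"
  by (auto simp: unit_set_def)

lemma tau_powi_unit_imp:
  assumes "\<tau> powi k = u" "u \<in> unit_set R" shows "k = 0"
proof -
  have aux: False if "\<tau> ^ Suc m = v" "v \<in> unit_set R" for m v
  proof -
    have "inverse \<tau> = \<tau> ^ m * inverse v" using that(1)[symmetric] by (simp add: field_simps)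
    also have "\<dots> \<in> R" using that(2) by (auto simp: unit_iff intro!: R_mult R_power tau_in_R)
    finally show False using tau_not_unit by simp
  qed
  show ?thesis
  proof (cases k rule: int_cases3)
    case (pos n)
    then have "\<tau> ^ Suc (n - 1) = u" using assms(1) by simp
    then show ?thesis using aux assms(2) by blast
  next
    case (neg n)
    then have "\<tau> ^ n = inverse u" using assms(1)
      by (auto simp: power_int_minus)
    then have "\<tau> ^ Suc (n - 1) = inverse u" using neg by simp
    moreover have "inverse u \<in> unit_set R" using assms(2) by (auto simp: unit_iff)
    ultimately show ?thesis using aux by blast
  qed simp
qed

lemma val_eqI:
  assumes "u \<in> unit_set R" "x = \<tau> powi k * u"
  shows "val x = k"
  unfolding valuation_def
proof (rule the_equality)
  fix l assume "\<exists>u\<in>unit_set R. x = \<tau> powi l * u"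
  then obtain w where w: "w \<in> unit_set R" "x = \<tau> powi l * w" by blast
  have nz: "w \<noteq> 0" "u \<noteq> 0" using w assms by (auto simp: unit_iff)
  have "\<tau> powi (l - k) = u * inverse w"
    using w(2) assms(2) nz by (simp add: power_int_diff field_simps)
  moreover have "u * inverse w \<in> unit_set R"
    using w(1) assms(1) by (auto simp: unit_iff intro: R_mult)
  ultimately show "l = k" using tau_powi_unit_imp[of "l - k"] by simp
qed (use assms in blast)

lemma val_decomposition:
  assumes "x \<noteq> 0" obtains u where "u \<in> unit_set R" "x = \<tau> powi val x * u"
  using unit_decomposition[OF assms] val_eqI by metis

lemma val_mult: "x \<noteq> 0 \<Longrightarrow> y \<noteq> 0 \<Longrightarrow> val (x * y) = val x + val y"
proof -
  assume "x \<noteq> 0" "y \<noteq> 0"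
  then obtain u w where u: "u \<in> unit_set R" "x = \<tau> powi val x * u"
    and w: "w \<in> unit_set R" "y = \<tau> powi val y * w"
    using val_decomposition by metis
  have "x * y = (\<tau> powi val x * u) * (\<tau> powi val y * w)" using u(2) w(2) by (rule arg_cong2)
  also have "\<dots> = \<tau> powi (val x + val y) * (u * w)" by (simp add: power_int_add)
  finally show ?thesis using u w by (intro val_eqI[of "u * w"]) (auto simp: unit_iff R_mult)
qed

lemma unit_1 [simp]: "1 \<in> unit_set R" by (simp add: unit_iff)

lemma val_powi [simp]: "val (\<tau> powi k) = k"
  by (intro val_eqI[OF unit_1]) simp

lemma val_tau [simp]: "val \<tau> = 1" using val_powi[of 1] by simp
lemma val_1 [simp]: "val 1 = 0" using val_powi[of 0] by simp

lemma val_pow [simp]: "val (\<tau> ^ k) = int k"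
  using val_powi[of "int k"] by simp

lemma val_inverse [simp]: "val (inverse x) = - val x" if "x \<noteq> 0"
  using val_mult[of x "inverse x"] that by simp

lemma val_divide: "x \<noteq> 0 \<Longrightarrow> y \<noteq> 0 \<Longrightarrow> val (x / y) = val x - val y"
  by (simp add: divide_inverse val_mult)

lemma R_iff_val: "x \<noteq> 0 \<Longrightarrow> x \<in> R \<longleftrightarrow> 0 \<le> val x"
proof
  assume x: "x \<noteq> 0"
  obtain u where u: "u \<in> unit_set R" "x = \<tau> powi val x * u" using val_decomposition x by blast
  { assume "0 \<le> val x"
    then have "\<tau> powi val x = \<tau> ^ nat (val x)" by (simp add: power_int_def)
    then have "\<tau> powi val x \<in> R" by (simp add: R_power tau_in_R)
    then show "x \<in> R" using u by (metis R_mult unit_iff) }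
  assume "x \<in> R"
  show "0 \<le> val x"
  proof (rule ccontr)
    assume neg: "\<not> 0 \<le> val x"
    have "u \<noteq> 0" using u by (simp add: unit_iff)
    then have "\<tau> powi val x = x * inverse u"
      using u(2) by (metis mult.assoc mult.right_neutral right_inverse)
    then have "\<tau> powi val x \<in> R" using \<open>x \<in> R\<close> u by (metis R_mult unit_iff)
    then have "\<tau> powi val x * \<tau> ^ nat (- val x - 1) \<in> R" by (simp add: R_mult R_power tau_in_R)
    moreover have "\<tau> powi val x * \<tau> ^ nat (- val x - 1) = \<tau> powi (val x + int (nat (- val x - 1)))"
      by (simp only: power_int_add tau_nonzero power_int_of_nat simp_thms)
    moreover have "val x + int (nat (- val x - 1)) = -1" using neg by simp
    ultimately show False using tau_not_unit by (simp add: power_int_minus)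
  qed
qed

definition ideal :: "int \<Rightarrow> 'f set" where "ideal k = {x. x = 0 \<or> k \<le> val x}"

lemma ideal_0: "ideal 0 = R"
proof (rule Set.set_eqI)
  fix x show "x \<in> ideal 0 \<longleftrightarrow> x \<in> R"
    by (cases "x = 0") (auto simp: ideal_def R_iff_val)
qed

lemma ideal_iff_R: "x \<in> ideal k \<longleftrightarrow> \<tau> powi (- k) * x \<in> R"
  by (cases "x = 0") (auto simp: ideal_def R_iff_val val_mult)

lemma zero_in_ideal [simp]: "0 \<in> ideal k" by (simp add: ideal_def)

lemma ideal_add: "x \<in> ideal k \<Longrightarrow> y \<in> ideal k \<Longrightarrow> x + y \<in> ideal k"
  by (simp add: ideal_iff_R distrib_left R_add)

lemma ideal_minus: "x \<in> ideal k \<Longrightarrow> - x \<in> ideal k"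
  using R_minus by (fastforce simp: ideal_iff_R)

lemma ideal_diff: "x \<in> ideal k \<Longrightarrow> y \<in> ideal k \<Longrightarrow> x - y \<in> ideal k"
  using ideal_add[of x k "- y"] ideal_minus by simp

lemma ideal_mult: "x \<in> ideal k \<Longrightarrow> y \<in> ideal l \<Longrightarrow> x * y \<in> ideal (k + l)"
  by (cases "x = 0 \<or> y = 0") (auto simp: ideal_def val_mult)

lemma ideal_mult_le: "x \<in> ideal k \<Longrightarrow> y \<in> ideal l \<Longrightarrow> m \<le> k + l \<Longrightarrow> x * y \<in> ideal m"
  using ideal_mult[of x k y l] by (auto simp: ideal_def)

lemma ideal_mono: "x \<in> ideal k \<Longrightarrow> l \<le> k \<Longrightarrow> x \<in> ideal l"
  by (auto simp: ideal_def)

lemma unit_iff_val: "u \<in> unit_set R \<longleftrightarrow> u \<noteq> 0 \<and> val u = 0"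
  by (auto simp: unit_iff R_iff_val)

lemma unit_mult: "u \<in> unit_set R \<Longrightarrow> w \<in> unit_set R \<Longrightarrow> u * w \<in> unit_set R"
  and unit_divide: "u \<in> unit_set R \<Longrightarrow> w \<in> unit_set R \<Longrightarrow> u / w \<in> unit_set R"
  and unit_inverse: "u \<in> unit_set R \<Longrightarrow> inverse u \<in> unit_set R"
  and unit_minus: "u \<in> unit_set R \<Longrightarrow> - u \<in> unit_set R"
  and unit_nonzero: "u \<in> unit_set R \<Longrightarrow> u \<noteq> 0"
  and unit_in_R: "u \<in> unit_set R \<Longrightarrow> u \<in> R"
  by (auto simp: unit_iff R_mult R_minus divide_inverse)

lemma val_minus [simp]: "val (- x) = val x"
proof (cases "x = 0")
  case False
  have "val (- 1) = 0" using unit_minus[OF unit_1] unit_iff_val by blast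
  then show ?thesis using False val_mult[of "- 1" x] by simp
qed simp

lemma unit_add_ideal:
  assumes "u \<in> unit_set R" "x \<in> ideal 1"
  shows "u + x \<in> unit_set R"
proof -
  have 1: "u + x \<in> R" using assms unit_in_R ideal_mono[of x 1 0] by (simp add: ideal_0 R_add)
  have "u + x \<notin> ideal 1"
  proof
    assume "u + x \<in> ideal 1"
    then have "u + x - x \<in> ideal 1" using assms(2) by (rule ideal_diff)
    then show False using assms(1) by (auto simp: unit_iff_val ideal_def)
  qed
  then show ?thesis using 1 by (auto simp: unit_iff_val ideal_def R_iff_val)
qed

lemma nonunit_in_ideal: "x \<in> R \<Longrightarrow> x \<notin> unit_set R \<Longrightarrow> x \<in> ideal 1"
  by (cases "x = 0") (auto simp: unit_iff_val ideal_def R_iff_val)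

lemma finite_ideal_quotient:
  "\<exists>S. finite S \<and> S \<subseteq> ideal k \<and> (\<forall>x\<in>ideal k. \<exists>s\<in>S. x - s \<in> ideal (k + int m))"
proof (induction m)
  case 0
  show ?case by (intro exI[of _ "{0}"]) auto
next
  case (Suc m)
  then obtain S where S: "finite S" "S \<subseteq> ideal k" "\<forall>x\<in>ideal k. \<exists>s\<in>S. x - s \<in> ideal (k + int m)"
    by blast
  obtain S0 where S0: "finite S0" "S0 \<subseteq> R" "\<forall>x\<in>R. \<exists>s\<in>S0. \<exists>y\<in>R. x - s = \<tau> * y"
    using finite_residue by blast
  let ?q = "\<tau> powi (k + int m)"
  let ?T = "(\<lambda>(s, t). s + ?q * t) ` (S \<times> S0)"
  have q: "?q \<in> ideal (k + int m)" by (simp add: ideal_def)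
  have "?T \<subseteq> ideal k"
  proof clarify
    fix s t assume st: "s \<in> S" "t \<in> S0"
    then have "t \<in> ideal 0" using S0 ideal_0 by blast
    with q have "?q * t \<in> ideal k" by (rule ideal_mult_le) simp
    then show "s + ?q * t \<in> ideal k" using st S by (intro ideal_add) auto
  qed
  moreover have "\<exists>s\<in>?T. x - s \<in> ideal (k + int (Suc m))" if x: "x \<in> ideal k" for x
  proof -
    obtain s where s: "s \<in> S" "x - s \<in> ideal (k + int m)" using S x by blast
    then have "\<tau> powi (- (k + int m)) * (x - s) \<in> R" by (simp only: ideal_iff_R)
    then obtain t y where t: "t \<in> S0" "y \<in> R" "\<tau> powi (- (k + int m)) * (x - s) - t = \<tau> * y"
      using S0 by blast
    have "?q * \<tau> powi (- (k + int m)) = 1" by (simp only: power_int_minus) simp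
    then have "x - (s + ?q * t) = ?q * (\<tau> powi (- (k + int m)) * (x - s) - t)"
      by (simp only: right_diff_distrib mult.assoc[symmetric]) simp
    also have "\<dots> = ?q * \<tau> * y" by (simp only: t(3) mult.assoc)
    also have "\<dots> \<in> ideal (k + int (Suc m))"
      using t(2) by (cases "y = 0") (auto simp: ideal_def val_mult R_iff_val)
    finally have "x - (s + ?q * t) \<in> ideal (k + int (Suc m))" .
    moreover have "s + ?q * t \<in> ?T"
      using s(1) t(1) by (intro image_eqI[of _ _ "(s, t)"]) simp_all
    ultimately show ?thesis by (rule bexI)
  qed
  moreover have "finite ?T" using S(1) S0(1) by (intro finite_imageI finite_cartesian_product)
  ultimately show ?case by (intro exI[of _ ?T]) simp
qed

text \<open>This is the source of the finiteness of orbits: on a smooth vector the entries of a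
  matrix matter only modulo an ideal.\<close>

lemma finite_approximation:
  obtains S where "finite S" "\<And>x. x \<in> ideal k \<Longrightarrow> \<exists>s\<in>S. x - s \<in> ideal m"
proof -
  obtain S where S: "finite S" "\<forall>x\<in>ideal k. \<exists>s\<in>S. x - s \<in> ideal (k + int (nat (m - k)))"
    using finite_ideal_quotient[of k "nat (m - k)"] by blast
  have "m \<le> k + int (nat (m - k))" by simp
  show ?thesis
  proof (rule that[OF S(1)])
    fix x assume "x \<in> ideal k"
    then obtain s where "s \<in> S" "x - s \<in> ideal (k + int (nat (m - k)))" using S(2) by blast
    then show "\<exists>s\<in>S. x - s \<in> ideal m"
      using ideal_mono \<open>m \<le> k + int (nat (m - k))\<close> by blast
  qed
qed

text \<open>The classes of 0 and 1 differ; finiteness of the quotient has to be shown too, as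
  \<open>card\<close> of an infinite set is 0. With a base of at least 2, \<open>fabs\<close> tends
  to 0 along the powers of \<tau>, which relates the topology of the group to the ideals.\<close>

lemma residue_card_ge_2: "residue_card R \<tau> \<ge> 2"
proof -
  define T where "T = (\<lambda>z. \<tau> * z) ` R"
  have T_iff: "x \<in> T \<longleftrightarrow> (\<exists>z\<in>R. x = \<tau> * z)" for x unfolding T_def by blast
  have T_neg: "y - x \<in> T" if h: "x - y \<in> T" for x y
  proof -
    obtain z where "z \<in> R" "x - y = \<tau> * z" using h T_iff by blast
    then show ?thesis unfolding T_iff by (intro bexI[of _ "- z"]) (auto simp: R_minus algebra_simps)
  qed
  have T_trans: "x - z \<in> T" if h: "x - y \<in> T" "y - z \<in> T" for x y z
  proof -
    obtain a b where ab: "a \<in> R" "x - y = \<tau> * a" "b \<in> R" "y - z = \<tau> * b" using h T_iff by blast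
    have "x - z = (x - y) + (y - z)" by simp
    also have "\<dots> = \<tau> * (a + b)" by (simp only: ab distrib_left)
    finally show ?thesis unfolding T_iff using ab R_add by blast
  qed
  have T_0: "0 \<in> T" unfolding T_iff by (intro bexI[of _ 0]) auto
  have T_1: "1 \<notin> T"
  proof
    assume "1 \<in> T"
    then obtain z where "z \<in> R" "\<tau> * z = 1" unfolding T_iff by metis
    then show False using tau_not_unit inverse_unique[of \<tau> z] by simp
  qed
  define r where "r = {(x, y). x \<in> R \<and> y \<in> R \<and> x - y \<in> T}"
  have r_iff: "y \<in> r `` {x} \<longleftrightarrow> x \<in> R \<and> y \<in> R \<and> x - y \<in> T" for x y
    unfolding r_def by blast
  obtain S where S: "finite S" "S \<subseteq> R" "\<forall>x\<in>R. \<exists>s\<in>S. x - s \<in> T"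
    using finite_residue unfolding T_iff by blast
  have sub: "R // r \<subseteq> (\<lambda>s. r `` {s}) ` S"
  proof
    fix C assume "C \<in> R // r"
    then obtain x where x: "x \<in> R" "C = r `` {x}" by (rule quotientE)
    then obtain s where s: "s \<in> S" "s \<in> R" "x - s \<in> T" using S by blast
    have "r `` {x} = r `` {s}"
      by (rule Set.set_eqI) (use x(1) s(2) T_trans[OF s(3)] T_trans[OF T_neg[OF s(3)]] in \<open>auto simp only: r_iff\<close>)
    then show "C \<in> (\<lambda>s. r `` {s}) ` S" using x(2) s(1) by simp
  qed
  have fin: "finite (R // r)" by (rule finite_surj[OF S(1) sub])
  have "1 \<notin> r `` {0}" "1 \<in> r `` {1}" using T_neg[of 0 1] T_0 T_1 by (auto simp only: r_iff diff_0_right diff_self R_0 R_1)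
  then have "r `` {0} \<noteq> r `` {1}" by metis
  then have "card {r `` {0}, r `` {1}} = 2" by simp
  moreover have "{r `` {0}, r `` {1}} \<subseteq> R // r"
    using quotientI[OF R_0, of r] quotientI[OF R_1, of r] by simp
  ultimately have "2 \<le> card (R // r)" using card_mono[OF fin] by metis
  then show ?thesis by (simp only: residue_card_def r_def T_def)
qed

lemma fabs_small:
  assumes "e > 0"
  obtains m :: nat where "\<And>x. x \<in> ideal (int m) \<Longrightarrow> fabs R \<tau> x < e"
proof -
  let ?q = "real (residue_card R \<tau>)"
  have q: "?q \<ge> 2" using residue_card_ge_2 by simp
  obtain m where m: "(1/2::real) ^ m < e" using real_arch_pow_inv[OF assms, of "1/2"] by auto
  have "fabs R \<tau> x < e" if x: "x \<in> ideal (int m)" for x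
  proof (cases "x = 0")
    case False
    then have "val x \<ge> int m" using x by (simp add: ideal_def)
    then have "?q powi (- val x) \<le> ?q powi (- int m)"
      using q by (intro power_int_increasing) auto
    also have "\<dots> = (1 / ?q) ^ m" by (simp add: power_int_minus power_divide divide_inverse power_inverse)
    also have "\<dots> \<le> (1/2) ^ m" using q by (intro power_mono) (auto simp: field_simps)
    finally show ?thesis using m False by (simp add: fabs_def)
  qed (simp add: fabs_def assms)
  then show ?thesis using that by blast
qed

end

section \<open>The ring of integers as a discrete valuation ring\<close>

context padic_extension
begin

text \<open>The ring of integers has a finite residue field because a family in it which is linearly independent
  modulo the uniformizer is linearly independent over the p-adic numbers.\<close>

lemma dvr_field_int_ring:
  assumes "uniformizer int_ring \<tau>"
  shows "dvr_field int_ring \<tau>"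
proof -
  have U: "(\<lambda>y. \<tau> * y) ` int_ring = int_ring - unit_set int_ring" using assms by (simp add: uniformizer_def)
  have tau: "\<tau> \<in> int_ring" "\<tau> \<notin> unit_set int_ring" using U image_eqI[of "\<tau>" "\<lambda>y. \<tau> * y" 1 int_ring] by auto
  have nonunit: "\<exists>y\<in>int_ring. x = \<tau> * y" if "x \<in> int_ring" "x \<notin> unit_set int_ring" for x using U that by blast
  have not_unit: "\<tau> * y \<noteq> 1" if "y \<in> int_ring" for y
  proof
    assume "\<tau> * y = 1"
    then have "\<tau> \<in> unit_set int_ring" using tau that by (auto simp: unit_set_def inverse_unique)
    then show False using tau by simp
  qed
  have p_nonunit: "of_nat p \<notin> unit_set int_ring" using inverse_p_notin_int_ring by (auto simp: unit_set_def)
  have tau0: "\<tau> \<noteq> 0" using nonunit[OF int_ring_of_nat p_nonunit] p_nonzero by force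
  obtain p' where p': "p' \<in> int_ring" "of_nat p = \<tau> * p'" using nonunit[OF int_ring_of_nat p_nonunit] by blast
  have small: "\<exists>y\<in>Zp. a = of_nat p * y" if "a \<in> Zp" "N a \<noteq> 1" for a
    using Zp_divide_p[of a] that p_nonzero
    by (intro bexI[of _ "a / of_nat p"]) (auto simp: Zp_def simp del: p_nonzero)
  have unit: "a \<noteq> 0 \<and> inverse a \<in> int_ring" if "a \<in> Zp" "N a = 1" for a
    using that Zp_divide[of 1 a] Zp_subset_int_ring by (auto simp: Zp_def divide_inverse)

  \<comment> \<open>Some power of \<tau> is divisible by p. In a monic equation for \<tau> let m be
    the first index with a unit coefficient: the terms from m on add up to \<tau>^m times a unit,
    since \<tau> is not a unit, and the terms below m are divisible by p.\<close>
  obtain i t where it: "t \<in> int_ring" "\<tau> ^ i = of_nat p * t"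
  proof -
    obtain K a where a: "\<And>i. i < K \<Longrightarrow> a i \<in> Zp" "\<tau> ^ K = (\<Sum>i<K. a i * \<tau> ^ i)"
      using int_ring_relation[OF tau(1)] by blast
    define b where "b = (\<lambda>i. - a i)(K := 1)"
    have b: "b i \<in> Zp" if "i \<le> K" for i using a(1) that by (auto simp: b_def)
    have "(\<Sum>i\<le>K. b i * \<tau> ^ i) = \<tau> ^ K + (\<Sum>i<K. - (a i * \<tau> ^ i))"
      by (simp add: lessThan_Suc_atMost[symmetric] b_def)
    then have sum0: "(\<Sum>i\<le>K. b i * \<tau> ^ i) = 0" using a(2) by (simp add: sum_negf)
    define m where "m = (LEAST i. i \<le> K \<and> N (b i) = 1)"
    have m: "m \<le> K \<and> N (b m) = 1"
      unfolding m_def by (rule LeastI[of _ K]) (simp add: b_def)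
    have "N (b i) \<noteq> 1" if "i < m" for i
      using not_less_Least[of i "\<lambda>i. i \<le> K \<and> N (b i) = 1"] that m unfolding m_def[symmetric] by auto
    then have "\<forall>i. \<exists>y. i < m \<longrightarrow> y \<in> Zp \<and> b i = of_nat p * y"
      using small b m by (metis le_trans less_imp_le)
    from choice[OF this] obtain c where c: "\<And>i. i < m \<Longrightarrow> c i \<in> Zp \<and> b i = of_nat p * c i" by blast
    define v where "v = (\<Sum>i\<in>{m<..K}. b i * \<tau> ^ (i - m - 1))"
    define u where "u = b m + \<tau> * v"
    have vO: "v \<in> int_ring" unfolding v_def using b tau by (intro int_ring_sum int_ring_mult int_ring_power) (auto intro: Zp_subset_int_ring)
    have "\<tau> ^ m * (\<tau> * v) = (\<Sum>i\<in>{m<..K}. b i * \<tau> ^ i)"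
      unfolding v_def sum_distrib_left
    proof (rule sum.cong)
      fix i assume "i \<in> {m<..K}"
      then have "i = m + (1 + (i - m - 1))" by simp
      then have "\<tau> ^ i = \<tau> ^ m * (\<tau> * \<tau> ^ (i - m - 1))" by (metis power_add power_one_right)
      then show "\<tau> ^ m * (\<tau> * (b i * \<tau> ^ (i - m - 1))) = b i * \<tau> ^ i" by simp
    qed simp
    moreover have "(\<Sum>i\<le>K. b i * \<tau> ^ i) = (\<Sum>i<m. b i * \<tau> ^ i) + b m * \<tau> ^ m + (\<Sum>i\<in>{m<..K}. b i * \<tau> ^ i)"
    proof -
      have "{..K} = {..<m} \<union> {m..K}" using m by auto
      then have "(\<Sum>i\<le>K. b i * \<tau> ^ i) = (\<Sum>i<m. b i * \<tau> ^ i) + (\<Sum>i\<in>{m..K}. b i * \<tau> ^ i)"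
        by (simp only:) (intro sum.union_disjoint, auto)
      then show ?thesis using m by (simp add: sum.head)
    qed
    ultimately have "\<tau> ^ m * u = - (\<Sum>i<m. b i * \<tau> ^ i)"
      using sum0 by (simp add: u_def algebra_simps eq_neg_iff_add_eq_0)
    also have "\<dots> = of_nat p * (- (\<Sum>i<m. c i * \<tau> ^ i))"
      using c by (simp add: sum_distrib_left mult.assoc)
    finally have eq: "\<tau> ^ m * u = of_nat p * (- (\<Sum>i<m. c i * \<tau> ^ i))" .
    have uO: "u \<in> int_ring" unfolding u_def using b m vO tau Zp_subset_int_ring by auto
    have "u \<in> unit_set int_ring"
    proof (rule ccontr)
      assume "u \<notin> unit_set int_ring"
      then obtain y where y: "y \<in> int_ring" "u = \<tau> * y" using nonunit uO by blast
      then have "b m = \<tau> * (y - v)" by (simp add: u_def algebra_simps)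
      moreover have "b m \<noteq> 0" using unit[of "b m"] b m by simp
      ultimately have "\<tau> * ((y - v) * inverse (b m)) = 1" by (metis mult.assoc right_inverse)
      moreover have "(y - v) * inverse (b m) \<in> int_ring" using y vO unit[of "b m"] b m by auto
      ultimately show False using not_unit by blast
    qed
    then have u: "u \<noteq> 0" "inverse u \<in> int_ring" by (auto simp: unit_set_def)
    show ?thesis
    proof
      show "- (\<Sum>i<m. c i * \<tau> ^ i) * inverse u \<in> int_ring"
        using u c tau by (intro int_ring_mult int_ring_minus int_ring_sum int_ring_power) (auto intro: Zp_subset_int_ring)
      show "\<tau> ^ m = of_nat p * (- (\<Sum>i<m. c i * \<tau> ^ i) * inverse u)"
        using eq u by (simp add: field_simps)
    qed
  qed

  \<comment> \<open>An element divisible by all powers of \<tau> is divisible by all powers of p.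
    But r divides some power of p, so 1 / p would be integral.\<close>
  have decomp: "\<exists>k. \<exists>u\<in>unit_set int_ring. r = \<tau> ^ k * u" if r: "r \<in> int_ring" "r \<noteq> 0" for r
  proof (rule ccontr)
    assume contra: "\<not> ?thesis"
    have div: "\<exists>y\<in>int_ring. r = \<tau> ^ k * y" for k
    proof (induction k)
      case (Suc k)
      then obtain y where y: "y \<in> int_ring" "r = \<tau> ^ k * y" by blast
      then have "y \<notin> unit_set int_ring" using contra by blast
      then obtain z where "z \<in> int_ring" "y = \<tau> * z" using nonunit y by blast
      then show ?case using y by (intro bexI[of _ z]) auto
    qed (use r in auto)
    obtain j s where js: "s \<in> int_ring" "of_nat p ^ j = r * s" using int_ring_divides_p_power r by blast
    obtain y where y: "y \<in> int_ring" "r = \<tau> ^ (i * Suc j) * y" using div by blast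
    have "\<tau> ^ (i * Suc j) = (of_nat p * t) ^ Suc j" using it by (simp only: power_mult)
    then have "of_nat p ^ j = (of_nat p * t) ^ Suc j * y * s" using js y by simp
    also have "\<dots> = of_nat p ^ j * (of_nat p * (t ^ Suc j * y * s))" by (simp add: power_mult_distrib)
    finally have "of_nat p ^ j * 1 = of_nat p ^ j * (of_nat p * (t ^ Suc j * y * s))" by simp
    then have "of_nat p * (t ^ Suc j * y * s) = 1" using p_nonzero by (metis mult_cancel_left power_not_zero)
    then have "inverse (of_nat p) = t ^ Suc j * y * s" by (rule inverse_unique)
    also have "\<dots> \<in> int_ring" using it y js by (intro int_ring_mult int_ring_power)
    finally show False using inverse_p_notin_int_ring by simp
  qed

  show ?thesis
  proof
    show "inverse \<tau> \<notin> int_ring" using not_unit tau0 by force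
    show "\<exists>k. \<exists>u\<in>unit_set int_ring. x = \<tau> powi k * u" if x: "x \<noteq> 0" for x
    proof -
      obtain l where l: "of_nat p ^ l * x \<in> int_ring" using p_power_scale_int_ring by blast
      obtain k u where u: "u \<in> unit_set int_ring" "of_nat p ^ l * x = \<tau> ^ k * u"
        using decomp[OF l] x p_nonzero by (metis mult_eq_0_iff power_not_zero)
      obtain k' u' where u': "u' \<in> unit_set int_ring" "of_nat p ^ l = \<tau> ^ k' * u'"
        using decomp[of "of_nat p ^ l"] p_nonzero by (metis int_ring_of_nat int_ring_power power_not_zero)
      have "x = \<tau> powi (int k - int k') * (u * inverse u')"
        using u u' tau0 by (simp add: power_int_diff field_simps unit_set_def)
      moreover have "u * inverse u' \<in> unit_set int_ring" using u u' by (auto simp: unit_set_def)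
      ultimately show ?thesis by blast
    qed
    obtain d where d: "\<And>(I :: nat set) r. finite I \<Longrightarrow> d < card I \<Longrightarrow>
      \<exists>e. (\<forall>i\<in>I. e i \<in> Zp) \<and> (\<exists>i\<in>I. N (e i) = 1) \<and> (\<Sum>i\<in>I. e i * r i) = 0"
      using linear_dependence by blast
    \<comment> \<open>Linear independence modulo \<tau> over the residue field of the p-adic
      integers, expressed by integral coefficients: a combination divisible by \<tau> has no unit
      coefficient.\<close>
    define ind where "ind m r \<longleftrightarrow> (\<forall>i<m. r i \<in> int_ring) \<and>
      (\<forall>c. (\<forall>i<m. c i \<in> Zp) \<and> (\<exists>y\<in>int_ring. (\<Sum>i<m. c i * r i) = \<tau> * y) \<longrightarrow> (\<forall>i<m. N (c i) \<noteq> 1))"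
      for m and r :: "nat \<Rightarrow> 'f"
    have ind_D: "N (c i) \<noteq> 1"
      if "ind m r" "\<forall>i<m. c i \<in> Zp" "y \<in> int_ring" "(\<Sum>i<m. c i * r i) = \<tau> * y" "i < m" for m r c y i
    proof -
      have "\<exists>y\<in>int_ring. (\<Sum>i<m. c i * r i) = \<tau> * y" using that(4,3) by (rule bexI)
      then have "\<forall>i<m. N (c i) \<noteq> 1" using that(1,2) unfolding ind_def by blast
      then show ?thesis using that(5) by blast
    qed
    have bound: "m \<le> d" if "ind m r" for m r
    proof (rule ccontr)
      assume "\<not> m \<le> d"
      then obtain e where e: "\<forall>i<m. e i \<in> Zp" "\<exists>i<m. N (e i) = 1" "(\<Sum>i<m. e i * r i) = \<tau> * 0"
        using d[of "{..<m}" r] by auto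
      then show False using ind_D[OF that e(1) int_ring_0 e(3)] by blast
    qed
    have ex0: "\<exists>r. ind 0 r" by (simp add: ind_def)
    define m where "m = (GREATEST m. \<exists>r. ind m r)"
    have bound': "\<And>k. \<exists>r. ind k r \<Longrightarrow> k \<le> d" using bound by blast
    have "\<exists>r. ind m r" unfolding m_def by (rule GreatestI_nat[of "\<lambda>m. \<exists>r. ind m r", OF ex0 bound'])
    then obtain r where r: "ind m r" by blast
    have max: "\<not> ind (Suc m) r'" for r'
    proof
      assume "ind (Suc m) r'"
      then have "\<exists>r. ind (Suc m) r" by blast
      then have "Suc m \<le> m"
        using Greatest_le_nat[of "\<lambda>m. \<exists>r. ind m r" "Suc m" d] bound' unfolding m_def by simp
      then show False by simp
    qed
    \<comment> \<open>For an independent family of maximal length, the combinations with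
      coefficients 0, ..., p - 1 represent all residue classes.\<close>
    define S where "S = (\<lambda>c. \<Sum>i<m. of_nat (c i) * r i) ` ({..<m} \<rightarrow>\<^sub>E {..<p})"
    have rO: "r i \<in> int_ring" if "i < m" for i using r that by (simp add: ind_def)
    have "finite S" unfolding S_def by (intro finite_imageI finite_PiE) auto
    moreover have "S \<subseteq> int_ring" unfolding S_def using rO by (auto intro!: int_ring_sum int_ring_mult)
    moreover have "\<exists>s\<in>S. \<exists>y\<in>int_ring. x - s = \<tau> * y" if x: "x \<in> int_ring" for x
    proof -
      obtain c y i where c: "\<forall>i<Suc m. c i \<in> Zp" "y \<in> int_ring" "(\<Sum>i<Suc m. c i * (r(m := x)) i) = \<tau> * y"
        "i < Suc m" "N (c i) = 1"
        using max[of "r(m := x)"] rO x unfolding ind_def by (auto simp: less_Suc_eq)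
      have eq: "(\<Sum>i<m. c i * r i) + c m * x = \<tau> * y" using c(3) by simp
      \<comment> \<open>By maximality the family extended by x is dependent. If the coefficient of x
        were not a unit, its term would be divisible by \<tau> and the family itself would be
        dependent.\<close>
      have cm: "N (c m) = 1"
      proof (rule ccontr)
        assume n1: "N (c m) \<noteq> 1"
        then obtain z where z: "z \<in> Zp" "c m = of_nat p * z" using small c(1) by blast
        have "(\<Sum>i<m. c i * r i) = \<tau> * (y - p' * z * x)" using eq z p' by (simp add: algebra_simps)
        moreover have "y - p' * z * x \<in> int_ring"
          using c z p' x by (intro int_ring_diff int_ring_mult) (auto intro: Zp_subset_int_ring)
        moreover have "i < m" using c(4,5) n1 by (cases "i = m") auto
        moreover have "\<forall>i<m. c i \<in> Zp" using c(1) by simp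
        ultimately show False using ind_D[OF r] c(5) by blast
      qed
      define b where "b i = - c i / c m" for i
      have b: "b i \<in> Zp" if "i < m" for i
        unfolding b_def using c(1) cm that by (intro Zp_divide) (auto simp: Zp_def N_minus)
      have "\<forall>i. \<exists>k. i < m \<longrightarrow> k < p \<and> N (b i - of_nat k) < 1"
      proof (intro allI)
        fix i show "\<exists>k. i < m \<longrightarrow> k < p \<and> N (b i - of_nat k) < 1"
          using Zp_residue[OF b[of i]] by metis
      qed
      from choice[OF this] obtain k where k: "\<And>i. i < m \<Longrightarrow> k i < p \<and> N (b i - of_nat (k i)) < 1"
        by blast
      have "\<forall>i. \<exists>z. i < m \<longrightarrow> z \<in> Zp \<and> b i - of_nat (k i) = of_nat p * z"
      proof (intro allI)
        fix i show "\<exists>z. i < m \<longrightarrow> z \<in> Zp \<and> b i - of_nat (k i) = of_nat p * z"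
          using small[of "b i - of_nat (k i)"] k[of i] Zp_diff[OF b[of i] Zp_of_nat[of "k i"]]
          by (cases "i < m") auto
      qed
      from choice[OF this] obtain z where
        z: "\<And>i. i < m \<Longrightarrow> z i \<in> Zp \<and> b i - of_nat (k i) = of_nat p * z i" by blast
      have unit_cm: "c m \<noteq> 0" "inverse (c m) \<in> int_ring" using unit cm c(1) by auto
      have "c m * x = \<tau> * y - (\<Sum>i<m. c i * r i)" using eq by (simp add: algebra_simps)
      then have "x = \<tau> * (y * inverse (c m)) - (\<Sum>i<m. c i * r i) / c m"
        using unit_cm by (simp add: field_simps)
      also have "(\<Sum>i<m. c i * r i) / c m = - (\<Sum>i<m. b i * r i)"
        unfolding sum_divide_distrib sum_negf[symmetric] by (intro sum.cong) (auto simp: b_def)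
      finally have x_eq: "x = \<tau> * (y * inverse (c m)) + (\<Sum>i<m. b i * r i)" by simp
      have "(\<Sum>i<m. b i * r i) - (\<Sum>i<m. of_nat (k i) * r i) = (\<Sum>i<m. (b i - of_nat (k i)) * r i)"
        by (simp add: sum_subtractf left_diff_distrib)
      also have "\<dots> = (\<Sum>i<m. \<tau> * (p' * z i * r i))"
        using z p' by (intro sum.cong) auto
      also have "\<dots> = \<tau> * (\<Sum>i<m. p' * z i * r i)" by (simp add: sum_distrib_left)
      finally have "x - (\<Sum>i<m. of_nat (k i) * r i)
          = \<tau> * (y * inverse (c m) + (\<Sum>i<m. p' * z i * r i))"
        using x_eq by (simp add: algebra_simps)
      moreover have "y * inverse (c m) + (\<Sum>i<m. p' * z i * r i) \<in> int_ring"
        using c unit_cm z p' rO by (intro int_ring_add int_ring_mult int_ring_sum) (auto intro: Zp_subset_int_ring)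
      moreover have "(\<Sum>i<m. of_nat (k i) * r i) \<in> S"
        unfolding S_def using k by (intro image_eqI[of _ _ "restrict k {..<m}"]) auto
      ultimately show ?thesis by blast
    qed
    ultimately show "\<exists>S. finite S \<and> S \<subseteq> int_ring \<and> (\<forall>x\<in>int_ring. \<exists>s\<in>S. \<exists>y\<in>int_ring. x - s = \<tau> * y)" by blast
  qed (use tau tau0 in auto)
qed

end

section \<open>Smooth representations by matrix entries\<close>

text \<open>The action is a function of the four entries, so that matrix identities become field
  identities within reach of \<open>simp\<close>; smoothness is expressed by ideals in place of the
  topology.\<close>

locale gl2_rep = dvr_field R \<tau> + vector_space s
  for R :: "'f::field set" and \<tau> :: 'f and s :: "complex \<Rightarrow> 'v::ab_group_add \<Rightarrow> 'v" +
  fixes \<rho> :: "'f \<Rightarrow> 'f \<Rightarrow> 'f \<Rightarrow> 'f \<Rightarrow> 'v \<Rightarrow> 'v" and \<omega> :: "'f \<Rightarrow> complex"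
  assumes act_add: "a * d - b * c \<noteq> 0 \<Longrightarrow> \<rho> a b c d (v + w) = \<rho> a b c d v + \<rho> a b c d w"
    and act_scale: "a * d - b * c \<noteq> 0 \<Longrightarrow> \<rho> a b c d (s z v) = s z (\<rho> a b c d v)"
    and act_one [simp]: "\<rho> 1 0 0 1 v = v"
    and act_act: "a * d - b * c \<noteq> 0 \<Longrightarrow> a' * d' - b' * c' \<noteq> 0 \<Longrightarrow>
      \<rho> a b c d (\<rho> a' b' c' d' v)
        = \<rho> (a * a' + b * c') (a * b' + b * d') (c * a' + d * c') (c * b' + d * d') v"
    and smooth: "\<exists>m::nat. \<forall>a b c d. a * d - b * c \<noteq> 0 \<and> a - 1 \<in> ideal (int m) \<and> b \<in> ideal (int m)
      \<and> c \<in> ideal (int m) \<and> d - 1 \<in> ideal (int m) \<longrightarrow> \<rho> a b c d v = v"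
    and central: "a \<noteq> 0 \<Longrightarrow> \<rho> a 0 0 a v = s (\<omega> a) v"
    and irreducible: "subspace W \<Longrightarrow>
      (\<And>a b c d v. a * d - b * c \<noteq> 0 \<Longrightarrow> v \<in> W \<Longrightarrow> \<rho> a b c d v \<in> W) \<Longrightarrow> W = {0} \<or> W = UNIV"
begin

abbreviation upper :: "'f \<Rightarrow> 'v \<Rightarrow> 'v" where "upper u \<equiv> \<rho> 1 u 0 1"
abbreviation lower :: "'f \<Rightarrow> 'v \<Rightarrow> 'v" where "lower u \<equiv> \<rho> 1 0 u 1"
abbreviation diag :: "'f \<Rightarrow> 'f \<Rightarrow> 'v \<Rightarrow> 'v" where "diag a d \<equiv> \<rho> a 0 0 d"
abbreviation shift :: "int \<Rightarrow> 'v \<Rightarrow> 'v" where "shift k \<equiv> \<rho> (\<tau> powi k) 0 0 1"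

lemma act_cong: "a = a' \<Longrightarrow> b = b' \<Longrightarrow> c = c' \<Longrightarrow> d = d' \<Longrightarrow> \<rho> a b c d v = \<rho> a' b' c' d' v"
  by simp

lemma act_zero [simp]: "a * d - b * c \<noteq> 0 \<Longrightarrow> \<rho> a b c d 0 = 0"
  using act_scale[of a d b c 0 0] by simp

lemma act_minus: "a * d - b * c \<noteq> 0 \<Longrightarrow> \<rho> a b c d (- v) = - \<rho> a b c d v"
  using act_add[of a d b c v "- v"] by (simp add: eq_neg_iff_add_eq_0 add.commute)

lemma act_diff: "a * d - b * c \<noteq> 0 \<Longrightarrow> \<rho> a b c d (v - w) = \<rho> a b c d v - \<rho> a b c d w"
  using act_add[of a d b c v "- w"] by (simp add: act_minus)

lemma act_sum: "a * d - b * c \<noteq> 0 \<Longrightarrow> \<rho> a b c d (sum f S) = (\<Sum>x\<in>S. \<rho> a b c d (f x))"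
  by (induction S rule: infinite_finite_induct) (simp_all add: act_add)

text \<open>The entries of the products of a matrix with its inverse, in the form in which
  \<open>act_act\<close> produces them.\<close>

lemma matrix_inverse:
  fixes a b c d :: 'f
  assumes "a * d - b * c = D" "D \<noteq> 0"
  shows "d / D * a + - b / D * c = 1" "- c / D * b + a / D * d = 1"
    "a * (d / D) + b * (- c / D) = 1" "c * (- b / D) + d * (a / D) = 1"
    "d / D * b + - b / D * d = 0" "- c / D * a + a / D * c = 0"
    "a * (- b / D) + b * (a / D) = 0" "c * (d / D) + d * (- c / D) = 0"
    "d / D * (a / D) - (- b / D) * (- c / D) = inverse D"
proof -
  have "d / D * (a / D) - (- b / D) * (- c / D) = (a * d - b * c) / (D * D)"
    by (simp add: diff_divide_distrib mult.commute)
  then show "d / D * (a / D) - (- b / D) * (- c / D) = inverse D"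
    unfolding assms(1) using assms(2) by (simp add: field_simps)
qed (use assms in \<open>auto simp: field_simps\<close>)

lemma act_inverse:
  assumes "a * d - b * c = D" "D \<noteq> 0"
  shows "\<rho> (d / D) (- b / D) (- c / D) (a / D) (\<rho> a b c d v) = v"
    and "\<rho> a b c d (\<rho> (d / D) (- b / D) (- c / D) (a / D) v) = v"
proof -
  note e = matrix_inverse[OF assms]
  have det: "a * d - b * c \<noteq> 0" "d / D * (a / D) - (- b / D) * (- c / D) \<noteq> 0"
    using assms(2) unfolding e assms(1) by auto
  show "\<rho> (d / D) (- b / D) (- c / D) (a / D) (\<rho> a b c d v) = v"
    unfolding act_act[OF det(2,1)] e by simp
  show "\<rho> a b c d (\<rho> (d / D) (- b / D) (- c / D) (a / D) v) = v"
    unfolding act_act[OF det] e by simp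
qed

lemma act_inject: "a * d - b * c \<noteq> 0 \<Longrightarrow> \<rho> a b c d v = \<rho> a b c d w \<longleftrightarrow> v = w"
  using act_inverse(1)[OF refl, of a d b c] by metis

lemma act_eq_0: "a * d - b * c \<noteq> 0 \<Longrightarrow> \<rho> a b c d v = 0 \<longleftrightarrow> v = 0"
  using act_inject[of a d b c v 0] by simp

text \<open>The group \<open>iwahori i j\<close> is the conjugate of the congruence subgroup of level \<open>i + j\<close> which
  stabilizes a segment of length \<open>i + j\<close> in the Bruhat--Tits tree.\<close>

definition iwahori :: "int \<Rightarrow> int \<Rightarrow> 'f \<Rightarrow> 'f \<Rightarrow> 'f \<Rightarrow> 'f \<Rightarrow> bool" where
  "iwahori i j a b c d \<longleftrightarrow>
     a \<in> R \<and> b \<in> ideal i \<and> c \<in> ideal j \<and> d \<in> R \<and> a * d - b * c \<in> unit_set R"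

definition fixed :: "int \<Rightarrow> int \<Rightarrow> 'v \<Rightarrow> bool" where
  "fixed i j v \<longleftrightarrow> (\<forall>a b c d. iwahori i j a b c d \<longrightarrow> \<rho> a b c d v = v)"

definition orbit :: "int \<Rightarrow> int \<Rightarrow> 'v \<Rightarrow> 'v set" where
  "orbit i j v = {w. \<exists>a b c d. iwahori i j a b c d \<and> w = \<rho> a b c d v}"

section \<open>The conjugate Iwahori groups and their orbits\<close>

lemma iwahori_det: "iwahori i j a b c d \<Longrightarrow> a * d - b * c \<noteq> 0"
  unfolding iwahori_def using unit_nonzero by blast

lemma ideal_R_mult: "x \<in> R \<Longrightarrow> y \<in> ideal k \<Longrightarrow> x * y \<in> ideal k"
  using ideal_mult_le[of x 0 y k k] by (simp add: ideal_0)

lemma ideal_mult_R: "x \<in> ideal k \<Longrightarrow> y \<in> R \<Longrightarrow> x * y \<in> ideal k"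
  using ideal_R_mult[of y x k] by (simp add: mult.commute)

lemma ideal_mult_in_R: "x \<in> ideal k \<Longrightarrow> y \<in> ideal l \<Longrightarrow> 0 \<le> k + l \<Longrightarrow> x * y \<in> R"
  using ideal_mult_le[of x k y l 0] by (simp add: ideal_0)

lemma ideal_divide_unit: "x \<in> ideal k \<Longrightarrow> d \<in> unit_set R \<Longrightarrow> x / d \<in> ideal k"
  unfolding divide_inverse by (intro ideal_mult_R) (auto intro: unit_in_R unit_inverse)

lemma iwahori_mult:
  assumes "0 \<le> i + j" "iwahori i j a b c d" "iwahori i j a' b' c' d'"
  shows "iwahori i j (a * a' + b * c') (a * b' + b * d') (c * a' + d * c') (c * b' + d * d')"
proof -
  have h: "a \<in> R" "b \<in> ideal i" "c \<in> ideal j" "d \<in> R" "a * d - b * c \<in> unit_set R"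
    "a' \<in> R" "b' \<in> ideal i" "c' \<in> ideal j" "d' \<in> R" "a' * d' - b' * c' \<in> unit_set R"
    using assms by (auto simp: iwahori_def)
  have det: "(a * a' + b * c') * (c * b' + d * d') - (a * b' + b * d') * (c * a' + d * c')
      = (a * d - b * c) * (a' * d' - b' * c')" by (simp add: algebra_simps)
  have "b * c' \<in> R" "c * b' \<in> R"
    using ideal_mult_in_R[OF h(2,8)] ideal_mult_in_R[OF h(3,7)] assms(1) by auto
  then show ?thesis unfolding iwahori_def det using h
    by (simp add: R_add R_mult ideal_add ideal_R_mult ideal_mult_R unit_mult)
qed

lemma iwahori_inverse:
  assumes "iwahori i j a b c d"
  defines "D \<equiv> a * d - b * c"
  shows "iwahori i j (d / D) (- b / D) (- c / D) (a / D)"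
proof -
  have h: "a \<in> R" "b \<in> ideal i" "c \<in> ideal j" "d \<in> R" "D \<in> unit_set R"
    using assms by (auto simp: iwahori_def)
  have D: "D \<noteq> 0" "inverse D \<in> unit_set R" "inverse D \<in> R"
    using unit_nonzero[OF h(5)] unit_inverse[OF h(5)] unit_in_R[OF unit_inverse[OF h(5)]] by auto
  have "d / D * (a / D) - (- b / D) * (- c / D) \<in> unit_set R"
    using matrix_inverse(9)[of a d b c D] D(1,2) by (simp add: D_def)
  then show ?thesis unfolding iwahori_def using h D
    by (auto simp: divide_inverse intro!: R_mult ideal_minus ideal_mult_R)
qed

lemma orbit_self: "v \<in> orbit i j v"
  unfolding orbit_def
  by (rule CollectI, intro exI[of _ 1] exI[of _ 0]) (simp add: iwahori_def)

lemma finite_image_if_key: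
  assumes "finite (g ` X)" "\<And>x y. x \<in> X \<Longrightarrow> y \<in> X \<Longrightarrow> g x = g y \<Longrightarrow> f x = f y"
  shows "finite (f ` X)"
proof -
  have "f ` X \<subseteq> (\<lambda>z. f (SOME x. x \<in> X \<and> g x = z)) ` (g ` X)"
  proof clarify
    fix x assume x: "x \<in> X"
    have "(SOME y. y \<in> X \<and> g y = g x) \<in> X \<and> g (SOME y. y \<in> X \<and> g y = g x) = g x"
      by (rule someI[of "\<lambda>y. y \<in> X \<and> g y = g x" x]) (simp add: x)
    then have "f x = f (SOME y. y \<in> X \<and> g y = g x)" using assms(2) x by metis
    then show "f x \<in> (\<lambda>z. f (SOME x. x \<in> X \<and> g x = z)) ` (g ` X)" using x by blast
  qed
  then show ?thesis using assms(1) finite_surj by metis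
qed

text \<open>The inverse of the first matrix times the second is congruent to 1 modulo
  \<open>ideal m\<close>, hence fixes v. The bound M makes up for i and j, one of which may be
  negative.\<close>

lemma act_eq_if_close:
  assumes ij: "0 \<le> i + j"
    and k: "iwahori i j a b c d" and k': "iwahori i j a' b' c' d'"
    and m: "\<And>a b c d. a * d - b * c \<noteq> 0 \<Longrightarrow> a - 1 \<in> ideal m \<Longrightarrow> b \<in> ideal m \<Longrightarrow> c \<in> ideal m
      \<Longrightarrow> d - 1 \<in> ideal m \<Longrightarrow> \<rho> a b c d v = v"
    and M: "m \<le> M" "m \<le> i + M" "m \<le> j + M"
    and close: "a' - a \<in> ideal M" "b' - b \<in> ideal M" "c' - c \<in> ideal M" "d' - d \<in> ideal M"
  shows "\<rho> a' b' c' d' v = \<rho> a b c d v"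
proof -
  define D where "D = a * d - b * c"
  define p q r t where pq: "p = d / D" "q = - b / D" "r = - c / D" "t = a / D"
  have D: "D \<noteq> 0" using iwahori_det[OF k] by (simp add: D_def)
  note e = matrix_inverse[OF D_def[symmetric] D, folded pq]
  note inv = act_inverse[OF D_def[symmetric] D, folded pq]
  have h: "p \<in> R" "q \<in> ideal i" "r \<in> ideal j" "t \<in> R"
    using iwahori_inverse[OF k] unfolding iwahori_def D_def pq by blast+
  have det: "p * t - q * r \<noteq> 0" using D e by simp
  have det': "a' * d' - b' * c' \<noteq> 0" using iwahori_det[OF k'] .
  have x: "x * y \<in> ideal m" if "x \<in> R" "y \<in> ideal M" for x y
    using ideal_R_mult[OF that] M ideal_mono by blast
  have y: "x * y \<in> ideal m" if "x \<in> ideal i" "y \<in> ideal M" for x y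
    using ideal_mult_le[OF that M(2)] .
  have z: "x * y \<in> ideal m" if "x \<in> ideal j" "y \<in> ideal M" for x y
    using ideal_mult_le[OF that M(3)] .
  have "\<rho> p q r t (\<rho> a' b' c' d' v) = v"
    unfolding act_act[OF det det']
  proof (rule m)
    have "(p * a' + q * c') * (r * b' + t * d') - (p * b' + q * d') * (r * a' + t * c')
        = (p * t - q * r) * (a' * d' - b' * c')"
      by (simp only: algebra_simps)
    then show "(p * a' + q * c') * (r * b' + t * d') - (p * b' + q * d') * (r * a' + t * c') \<noteq> 0"
      using det det' by simp
    have "p * a' + q * c' - (p * a + q * c) = p * (a' - a) + q * (c' - c)" by (simp add: algebra_simps)
    then show "p * a' + q * c' - 1 \<in> ideal m"
      unfolding e using x[OF h(1) close(1)] y[OF h(2) close(3)] by (simp only: ideal_add)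
    have "r * b' + t * d' - (r * b + t * d) = r * (b' - b) + t * (d' - d)" by (simp add: algebra_simps)
    then show "r * b' + t * d' - 1 \<in> ideal m"
      unfolding e using z[OF h(3) close(2)] x[OF h(4) close(4)] by (simp only: ideal_add)
    have "p * b' + q * d' - (p * b + q * d) = p * (b' - b) + q * (d' - d)" by (simp add: algebra_simps)
    then show "p * b' + q * d' \<in> ideal m"
      unfolding e diff_zero using x[OF h(1) close(2)] y[OF h(2) close(4)] by (simp only: ideal_add)
    have "r * a' + t * c' - (r * a + t * c) = r * (a' - a) + t * (c' - c)" by (simp add: algebra_simps)
    then show "r * a' + t * c' \<in> ideal m"
      unfolding e diff_zero using z[OF h(3) close(1)] x[OF h(4) close(3)] by (simp only: ideal_add)
  qed
  then show ?thesis using inv(2)[of "\<rho> a' b' c' d' v"] by simp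
qed

lemma finite_orbit:
  assumes "0 \<le> i + j" shows "finite (orbit i j v)"
proof -
  obtain m :: nat where m: "\<And>a b c d. a * d - b * c \<noteq> 0 \<Longrightarrow> a - 1 \<in> ideal (int m) \<Longrightarrow> b \<in> ideal (int m)
      \<Longrightarrow> c \<in> ideal (int m) \<Longrightarrow> d - 1 \<in> ideal (int m) \<Longrightarrow> \<rho> a b c d v = v"
    using smooth[of v] by blast
  define M where "M = int m + \<bar>i\<bar> + \<bar>j\<bar>"
  have M: "int m \<le> M" "int m \<le> i + M" "int m \<le> j + M" by (auto simp: M_def)
  obtain S where S: "finite S" "\<And>x. x \<in> ideal (min 0 (min i j)) \<Longrightarrow> \<exists>s\<in>S. x - s \<in> ideal M"
    using finite_approximation by blast
  \<comment> \<open>Entries are rounded to finitely many representatives; the rounded entries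
    determine the action on v.\<close>
  define r where "r x = (SOME s. s \<in> S \<and> x - s \<in> ideal M)" for x
  have r: "r x \<in> S \<and> x - r x \<in> ideal M" if "x \<in> ideal (min 0 (min i j))" for x
    unfolding r_def by (rule someI_ex) (use S(2)[OF that] in blast)
  have in_ideal: "a \<in> ideal (min 0 (min i j)) \<and> b \<in> ideal (min 0 (min i j)) \<and> c \<in> ideal (min 0 (min i j))
     \<and> d \<in> ideal (min 0 (min i j))" if "iwahori i j a b c d" for a b c d
    using that ideal_mono[of a 0] ideal_mono[of b i] ideal_mono[of c j] ideal_mono[of d 0]
    unfolding iwahori_def ideal_0 by simp
  have diff: "y - x \<in> ideal M" if "x - z \<in> ideal M" "y - z \<in> ideal M" for x y z
    using ideal_diff[OF that(2,1)] by simp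
  let ?X = "{(a, b, c, d). iwahori i j a b c d}"
  let ?g = "\<lambda>(a, b, c, d). (r a, r b, r c, r d)"
  let ?f = "\<lambda>(a, b, c, d). \<rho> a b c d v"
  have "?g ` ?X \<subseteq> S \<times> S \<times> S \<times> S" using in_ideal r by auto
  then have "finite (?g ` ?X)" using S(1) by (meson finite_SigmaI finite_subset)
  then have "finite (?f ` ?X)"
  proof (rule finite_image_if_key)
    fix x y assume xy: "x \<in> ?X" "y \<in> ?X" "?g x = ?g y"
    obtain a b c d where x: "x = (a, b, c, d)" by (cases x)
    obtain a' b' c' d' where y: "y = (a', b', c', d')" by (cases y)
    have k: "iwahori i j a b c d" "iwahori i j a' b' c' d'"
      and eq: "r a = r a'" "r b = r b'" "r c = r c'" "r d = r d'" using xy unfolding x y by auto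
    have "\<rho> a' b' c' d' v = \<rho> a b c d v"
    proof (rule act_eq_if_close[OF assms k m M])
      show "a' - a \<in> ideal M" using in_ideal[OF k(1)] in_ideal[OF k(2)] r[of a] r[of a'] eq diff by metis
      show "b' - b \<in> ideal M" using in_ideal[OF k(1)] in_ideal[OF k(2)] r[of b] r[of b'] eq diff by metis
      show "c' - c \<in> ideal M" using in_ideal[OF k(1)] in_ideal[OF k(2)] r[of c] r[of c'] eq diff by metis
      show "d' - d \<in> ideal M" using in_ideal[OF k(1)] in_ideal[OF k(2)] r[of d] r[of d'] eq diff by metis
    qed
    then show "?f x = ?f y" by (simp add: x y)
  qed
  moreover have "orbit i j v = ?f ` ?X" unfolding orbit_def by force
  ultimately show ?thesis by simp
qed

text \<open>The group permutes the orbit, which is finite, so a finite sum takes the place of an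
  integral over a compact group.\<close>

lemma orbit_sum_fixed:
  assumes "0 \<le> i + j" shows "fixed i j (\<Sum>(orbit i j v))"
  unfolding fixed_def
proof (intro allI impI)
  fix a b c d assume k: "iwahori i j a b c d"
  note det = iwahori_det[OF k]
  have sub: "\<rho> a b c d ` orbit i j v \<subseteq> orbit i j v"
  proof clarify
    fix w assume "w \<in> orbit i j v"
    then obtain a' b' c' d' where k': "iwahori i j a' b' c' d'" "w = \<rho> a' b' c' d' v"
      unfolding orbit_def by blast
    show "\<rho> a b c d w \<in> orbit i j v"
      unfolding k'(2) act_act[OF det iwahori_det[OF k'(1)]] orbit_def
      using iwahori_mult[OF assms k k'(1)] by blast
  qed
  have inj: "inj_on (\<rho> a b c d) (orbit i j v)"
    by (rule inj_onI) (simp add: act_inject[OF det])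
  have "\<rho> a b c d ` orbit i j v = orbit i j v"
    using endo_inj_surj[OF finite_orbit[OF assms] sub inj] .
  then have "\<Sum>(orbit i j v) = (\<Sum>x\<in>orbit i j v. \<rho> a b c d x)"
    using sum.reindex[OF inj, of "\<lambda>x. x"] by simp
  also have "\<dots> = \<rho> a b c d (\<Sum>(orbit i j v))"
    using act_sum[OF det, of "\<lambda>x. x"] by simp
  finally show "\<rho> a b c d (\<Sum>(orbit i j v)) = \<Sum>(orbit i j v)" by (rule sym)
qed

section \<open>Fixed vectors and triangular matrices\<close>

lemma fixedD: "fixed i j v \<Longrightarrow> iwahori i j a b c d \<Longrightarrow> \<rho> a b c d v = v"
  unfolding fixed_def by blast

lemma fixed_mono: "fixed i j v \<Longrightarrow> i \<le> i' \<Longrightarrow> j \<le> j' \<Longrightarrow> fixed i' j' v"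
  unfolding fixed_def iwahori_def using ideal_mono by blast

lemma fixed_upper: "fixed i j v \<Longrightarrow> u \<in> ideal i \<Longrightarrow> upper u v = v"
  by (rule fixedD) (auto simp: iwahori_def)

lemma fixed_lower: "fixed i j v \<Longrightarrow> u \<in> ideal j \<Longrightarrow> lower u v = v"
  by (rule fixedD) (auto simp: iwahori_def)

lemma fixed_diag: "fixed i j v \<Longrightarrow> a \<in> unit_set R \<Longrightarrow> d \<in> unit_set R \<Longrightarrow> diag a d v = v"
  by (rule fixedD) (auto simp: iwahori_def intro: unit_in_R unit_mult)

lemma diag_upper: "a \<noteq> 0 \<Longrightarrow> d \<noteq> 0 \<Longrightarrow> diag a d (upper u v) = upper (a * u / d) (diag a d v)"
  by (simp add: act_act)

lemma upper_diag: "a \<noteq> 0 \<Longrightarrow> d \<noteq> 0 \<Longrightarrow> upper u (diag a d v) = diag a d (upper (u * d / a) v)"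
  by (simp add: act_act)

lemma lower_diag: "a \<noteq> 0 \<Longrightarrow> d \<noteq> 0 \<Longrightarrow> lower u (diag a d v) = diag a d (lower (u * a / d) v)"
  by (simp add: act_act)

lemma diag_diag: "a \<noteq> 0 \<Longrightarrow> d \<noteq> 0 \<Longrightarrow> a' \<noteq> 0 \<Longrightarrow> d' \<noteq> 0 \<Longrightarrow> diag a d (diag a' d' v) = diag (a * a') (d * d') v"
  by (simp add: act_act)

lemma upper_upper: "upper u (upper u' v) = upper (u + u') v"
  by (simp add: act_act add.commute)

lemma lower_lower: "lower u (lower u' v) = lower (u + u') v"
  by (simp add: act_act add.commute)

lemma shift_shift: "shift k (shift l v) = shift (k + l) v"
  by (simp add: act_act power_int_add)

lemma shift_0 [simp]: "shift 0 v = v" by simp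

text \<open>Conjugation by the diagonal matrix carries one group to the other: the segment moves by
  k along the standard apartment and keeps its length i + j.\<close>

lemma fixed_shift:
  assumes "fixed i j v" shows "fixed (i + k) (j - k) (shift k v)"
  unfolding fixed_def
proof (intro allI impI)
  fix a b c d assume h: "iwahori (i + k) (j - k) a b c d"
  let ?t = "\<tau> powi k"
  have t: "?t \<noteq> 0" by simp
  have "b / ?t \<in> ideal i"
    using h by (cases "b = 0") (auto simp: iwahori_def ideal_def val_divide)
  moreover have "c * ?t \<in> ideal j"
    using h by (cases "c = 0") (auto simp: iwahori_def ideal_def val_mult)
  ultimately have "iwahori i j a (b / ?t) (c * ?t) d" using h by (simp add: iwahori_def)
  then have "\<rho> a (b / ?t) (c * ?t) d v = v" by (rule fixedD[OF assms])
  moreover have "\<rho> a b c d (shift k v) = shift k (\<rho> a (b / ?t) (c * ?t) d v)"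
    using iwahori_det[OF h] by (simp add: act_act mult.commute)
  ultimately show "\<rho> a b c d (shift k v) = shift k v" by simp
qed

lemma iwahori_decomposition:
  assumes "iwahori i j a b c d" "d \<noteq> 0"
  shows "\<rho> a b c d v = upper (b / d) (\<rho> ((a * d - b * c) / d) 0 c d v)"
  using iwahori_det[OF assms(1)] assms(2) by (simp add: act_act field_simps)

text \<open>For positive length b c lies in the maximal ideal, so a d is a unit. For length 0 the
  group is conjugate to the maximal compact one, and the Weyl element shows that the conclusion
  fails.\<close>

lemma iwahori_diagonal_units:
  assumes "iwahori i j a b c d" "0 < i + j"
  shows "a \<in> unit_set R" "d \<in> unit_set R"
proof -
  have h: "a \<in> R" "b \<in> ideal i" "c \<in> ideal j" "d \<in> R" "a * d - b * c \<in> unit_set R"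
    using assms by (auto simp: iwahori_def)
  have "b * c \<in> ideal 1" using h(2,3) by (rule ideal_mult_le) (use assms(2) in simp)
  then have "a * d \<in> unit_set R" using unit_add_ideal[OF h(5), of "b * c"] by simp
  then have "a \<noteq> 0 \<and> d \<noteq> 0 \<and> val a + val d = 0" by (auto simp: unit_iff_val val_mult)
  moreover have "a \<noteq> 0 \<Longrightarrow> 0 \<le> val a" "d \<noteq> 0 \<Longrightarrow> 0 \<le> val d" using h R_iff_val by auto
  ultimately show "a \<in> unit_set R" "d \<in> unit_set R" by (auto simp: unit_iff_val)
qed

text \<open>Modulo \<open>W\<close> every term is 0 or \<open>f x\<close>, and the term at x occurs.
  So a positive multiple of \<open>f x\<close> lies in \<open>W\<close>, and complex scalars allow
  division. All averages below are evaluated in this way.\<close>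

lemma subspace_sum_pigeonhole:
  assumes W: "subspace W" and fin: "finite Q" and x: "x \<in> Q" and sum: "(\<Sum>y\<in>Q. f y) \<in> W"
    and alt: "\<And>y. y \<in> Q \<Longrightarrow> f y \<in> W \<or> f y - f x \<in> W"
  shows "f x \<in> W"
proof (rule ccontr)
  assume nx: "f x \<notin> W"
  let ?P = "{y \<in> Q. f y - f x \<in> W}"
  have split: "(\<Sum>y\<in>Q. f y) = (\<Sum>y\<in>?P. f y) + (\<Sum>y\<in>Q - ?P. f y)"
    using fin by (subst sum.subset_diff[of ?P Q]) (auto simp: add.commute)
  have "(\<Sum>y\<in>Q - ?P. f y) \<in> W" using alt by (intro subspace_sum[OF W]) blast
  moreover have "(\<Sum>y\<in>?P. f y - f x) \<in> W" by (intro subspace_sum[OF W]) blast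
  ultimately have "(\<Sum>y\<in>Q. f y) - (\<Sum>y\<in>?P. f y - f x) - (\<Sum>y\<in>Q - ?P. f y) \<in> W"
    using sum by (intro subspace_diff[OF W])
  also have "(\<Sum>y\<in>Q. f y) - (\<Sum>y\<in>?P. f y - f x) - (\<Sum>y\<in>Q - ?P. f y) = (\<Sum>y\<in>?P. f x)"
    unfolding split by (simp add: sum_subtractf)
  also have "\<dots> = s (of_nat (card ?P)) (f x)" by (rule sum_constant_scale)
  finally have "s (of_nat (card ?P)) (f x) \<in> W" .
  moreover have "card ?P \<noteq> 0" using fin x subspace_0[OF W] by (auto simp: card_eq_0_iff)
  ultimately have "s (inverse (of_nat (card ?P))) (s (of_nat (card ?P)) (f x)) \<in> W"
    using subspace_scale[OF W] by blast
  moreover have "inverse (of_nat (card ?P)) * of_nat (card ?P) = (1 :: complex)"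
    using \<open>card ?P \<noteq> 0\<close> by (intro left_inverse) (simp only: of_nat_eq_0_iff not_False_eq_True)
  ultimately show False using nx by (simp only: scale_scale scale_one)
qed

text \<open>\<open>W\<close> is not assumed to be invariant. The span of the orbit of v is, and
  irreducibility is applied to that span.\<close>

lemma cyclic:
  assumes W: "subspace W" and v: "v \<noteq> 0"
    and orb: "\<And>a b c d. a * d - b * c \<noteq> 0 \<Longrightarrow> \<rho> a b c d v \<in> W"
  shows "W = UNIV"
proof -
  define G where "G = {w. \<exists>a b c d. a * d - b * c \<noteq> 0 \<and> w = \<rho> a b c d v}"
  have "\<rho> a b c d w \<in> span G" if k: "a * d - b * c \<noteq> 0" and w: "w \<in> span G" for a b c d w
    using w
  proof (induction rule: span_induct_alt)
    case base
    show ?case using k by (simp add: span_zero)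
  next
    case (step z x y)
    then obtain a' b' c' d' where x: "a' * d' - b' * c' \<noteq> 0" "x = \<rho> a' b' c' d' v"
      unfolding G_def by blast
    have "(a * a' + b * c') * (c * b' + d * d') - (a * b' + b * d') * (c * a' + d * c')
      = (a * d - b * c) * (a' * d' - b' * c')" by (simp add: algebra_simps)
    then have "(a * a' + b * c') * (c * b' + d * d') - (a * b' + b * d') * (c * a' + d * c') \<noteq> 0"
      using k x(1) by simp
    then have "\<rho> a b c d x \<in> G" unfolding x(2) act_act[OF k x(1)] G_def by blast
    then show ?case using step by (simp add: act_add[OF k] act_scale[OF k] span_add span_scale span_base)
  qed
  then have "span G = {0} \<or> span G = UNIV" by (intro irreducible) auto
  moreover have "v \<in> G" unfolding G_def by (rule CollectI, intro exI[of _ 1] exI[of _ 0]) simp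
  ultimately have "span G = UNIV" using v span_base by blast
  moreover have "span G \<subseteq> W" using W orb by (intro span_minimal) (auto simp: G_def)
  ultimately show ?thesis by blast
qed

end

section \<open>Subspaces stable under the diagonal torus\<close>

context dvr_field
begin

lemma val_1_plus: "1 + x \<noteq> 0 \<Longrightarrow> 0 \<le> val (1 + x) \<or> (val (1 + x) = val x \<and> val x < 0)"
proof (cases "x \<in> R")
  case True
  assume "1 + x \<noteq> 0"
  then show ?thesis using R_add[OF R_1 True] R_iff_val by blast
next
  case False
  then have x: "x \<noteq> 0" by auto
  moreover have "val x < 0" using False R_iff_val[OF x] by simp
  ultimately have x: "x \<noteq> 0" "val x < 0" by auto
  then have "inverse x \<in> ideal 1" by (simp add: ideal_def)
  then have "1 + inverse x \<in> unit_set R" using unit_add_ideal[OF unit_1] by blast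
  then have u: "1 + inverse x \<noteq> 0" "val (1 + inverse x) = 0" by (auto simp: unit_iff_val)
  have "1 + x = x * (1 + inverse x)" using x by (simp add: field_simps)
  then have "val (1 + x) = val x" using val_mult[OF x(1) u(1)] u by simp
  then show ?thesis using x by simp
qed

end

text \<open>Level means plain invariance here; in the application the central character is trivial
  on units.\<close>

locale new_vector_rep = gl2_rep R \<tau> s \<rho> \<omega>
  for R :: "'f::field set" and \<tau> :: 'f and s :: "complex \<Rightarrow> 'v::ab_group_add \<Rightarrow> 'v"
    and \<rho> :: "'f \<Rightarrow> 'f \<Rightarrow> 'f \<Rightarrow> 'f \<Rightarrow> 'v \<Rightarrow> 'v" and \<omega> :: "'f \<Rightarrow> complex" +
  fixes v :: 'v and n :: nat
  assumes n_pos: "1 \<le> n" and v_fixed: "fixed 0 (int n) v" and v_nonzero: "v \<noteq> 0"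
    and new_unique: "fixed 0 (int n) w \<Longrightarrow> \<exists>z. w = s z v"
    and new_minimal: "m < n \<Longrightarrow> fixed 0 (int m) w \<Longrightarrow> w = 0"
begin

text \<open>This matrix normalizes \<open>iwahori 0 (int n)\<close>, hence sends v to a fixed
  vector, which is a multiple of v by uniqueness. In the tree it reverses the path of v.\<close>

lemma atkin_lehner:
  obtains \<epsilon> where "\<epsilon> \<noteq> 0" "\<rho> 0 1 (\<tau> ^ n) 0 v = s \<epsilon> v"
proof -
  let ?t = "\<tau> ^ n"
  have t: "?t \<noteq> 0" by simp
  have "fixed 0 (int n) (\<rho> 0 1 ?t 0 v)"
    unfolding fixed_def
  proof (intro allI impI)
    fix a b c d assume k: "iwahori 0 (int n) a b c d"
    have c: "c / ?t \<in> ideal 0"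
      using k by (cases "c = 0") (auto simp: iwahori_def ideal_def val_divide)
    have b: "b * ?t \<in> ideal (int n)"
      using k by (cases "b = 0") (auto simp: iwahori_def ideal_def val_mult)
    have det: "d * a - c / ?t * (b * ?t) = a * d - b * c" by (simp add: mult.commute)
    have k': "iwahori 0 (int n) d (c / ?t) (b * ?t) a"
      using k b c unfolding iwahori_def det by blast
    have "\<rho> a b c d (\<rho> 0 1 ?t 0 v) = \<rho> 0 1 ?t 0 (\<rho> d (c / ?t) (b * ?t) a v)"
      using iwahori_det[OF k] iwahori_det[OF k'] by (simp add: act_act mult.commute)
    then show "\<rho> a b c d (\<rho> 0 1 ?t 0 v) = \<rho> 0 1 ?t 0 v" unfolding fixedD[OF v_fixed k'] .
  qed
  then obtain \<epsilon> where e: "\<rho> 0 1 ?t 0 v = s \<epsilon> v" using new_unique by blast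
  have "\<epsilon> \<noteq> 0"
  proof
    assume "\<epsilon> = 0"
    then have "\<rho> 0 1 ?t 0 v = 0" using e by simp
    then show False using act_eq_0[of 0 0 1 ?t v] v_nonzero by simp
  qed
  with e that show ?thesis by blast
qed

lemma scale_mem_iff: "subspace W \<Longrightarrow> \<epsilon> \<noteq> 0 \<Longrightarrow> s \<epsilon> x \<in> W \<longleftrightarrow> x \<in> W"
  using subspace_scale[of W "s \<epsilon> x" "inverse \<epsilon>"] subspace_scale[of W x \<epsilon>] by auto

lemma weyl_new:
  obtains z where "\<rho> 0 1 1 0 v = s z (shift (int n) v)"
proof -
  obtain \<epsilon> where e: "\<epsilon> \<noteq> 0" "\<rho> 0 1 (\<tau> ^ n) 0 v = s \<epsilon> v" by (rule atkin_lehner)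
  have "s \<epsilon> (\<rho> 0 1 1 0 v) = \<rho> 0 1 1 0 (\<rho> 0 1 (\<tau> ^ n) 0 v)" by (simp add: e act_scale)
  also have "\<dots> = shift (int n) v" by (simp add: act_act)
  finally have "s (inverse \<epsilon>) (s \<epsilon> (\<rho> 0 1 1 0 v)) = s (inverse \<epsilon>) (shift (int n) v)" by (rule arg_cong)
  then have "\<rho> 0 1 1 0 v = s (inverse \<epsilon>) (shift (int n) v)" using e(1) by simp
  then show ?thesis by (rule that)
qed

definition torus_stable :: "'v set \<Rightarrow> bool" where
  "torus_stable W \<longleftrightarrow> subspace W \<and> (\<forall>a d w. a \<noteq> 0 \<and> d \<noteq> 0 \<and> w \<in> W \<longrightarrow> diag a d w \<in> W) \<and>
     (\<forall>a d w. a \<in> unit_set R \<and> d \<in> unit_set R \<longrightarrow> diag a d w - w \<in> W)"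

lemma torus_stableD:
  assumes "torus_stable W"
  shows "subspace W" "a \<noteq> 0 \<Longrightarrow> d \<noteq> 0 \<Longrightarrow> w \<in> W \<Longrightarrow> diag a d w \<in> W"
    "a \<in> unit_set R \<Longrightarrow> d \<in> unit_set R \<Longrightarrow> diag a d w - w \<in> W"
  using assms unfolding torus_stable_def by blast+

section \<open>Unipotent translates of the new vector\<close>

lemma orbit_minus1_cases:
  assumes "y \<in> orbit (- 1) (int n) v"
  obtains b where "b \<in> ideal (- 1)" "y = upper b v" | z where "y = s z (shift (- 1) v)"
proof -
  obtain a b c d where k: "iwahori (- 1) (int n) a b c d" and y: "y = \<rho> a b c d v"
    using assms unfolding orbit_def by blast
  have h: "a \<in> R" "b \<in> ideal (- 1)" "c \<in> ideal (int n)" "d \<in> R" "a * d - b * c \<in> unit_set R"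
    using k unfolding iwahori_def by blast+
  show ?thesis
  proof (cases "d \<in> unit_set R")
    case True
    then have d: "d \<noteq> 0" by (rule unit_nonzero)
    have "iwahori 0 (int n) ((a * d - b * c) / d) 0 c d"
      unfolding iwahori_def using h d True by (auto intro: unit_in_R unit_divide)
    then have "y = upper (b / d) v"
      unfolding y iwahori_decomposition[OF k d] using fixedD[OF v_fixed] by simp
    then show ?thesis using that(1) ideal_divide_unit[OF h(2) True] by blast
  next
    case False
    have n: "n = 1"
    proof (rule ccontr)
      assume "n \<noteq> 1"
      then have "0 < - 1 + int n" using n_pos by simp
      then show False using iwahori_diagonal_units(2)[OF k] False by blast
    qed
    have d1: "d \<in> ideal 1" using nonunit_in_ideal h(4) False by blast
    have div: "x / \<tau> \<in> R" if "x \<in> ideal 1" for x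
      using that by (cases "x = 0") (auto simp: ideal_def R_iff_val val_divide)
    have c: "c / \<tau> \<in> R" using h(3) n div by simp
    have d: "d / \<tau> \<in> ideal 0" using div[OF d1] by (simp add: ideal_0)
    have a: "a * \<tau> \<in> ideal 1" using h(1) by (cases "a = 0") (auto simp: ideal_def R_iff_val val_mult)
    have b: "b * \<tau> \<in> R" using h(2) by (cases "b = 0") (auto simp: ideal_def R_iff_val val_mult)
    have det: "c / \<tau> * (b * \<tau>) - d / \<tau> * (a * \<tau>) = - (a * d - b * c)" by (simp add: mult.commute)
    have k': "iwahori 0 (int n) (c / \<tau>) (d / \<tau>) (a * \<tau>) (b * \<tau>)"
      unfolding iwahori_def det using a b c d unit_minus[OF h(5)] n by simp
    have "y = \<rho> 0 (inverse \<tau>) \<tau> 0 (\<rho> (c / \<tau>) (d / \<tau>) (a * \<tau>) (b * \<tau>) v)"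
      unfolding y using iwahori_det[OF k'] by (simp add: act_act field_simps)
    also have "\<dots> = \<rho> 0 (inverse \<tau>) \<tau> 0 v" unfolding fixedD[OF v_fixed k'] ..
    also have "\<dots> = shift (- 1) (\<rho> 0 1 (\<tau> ^ n) 0 v)" by (simp add: n act_act power_int_minus)
    also obtain \<epsilon> where "\<rho> 0 1 (\<tau> ^ n) 0 v = s \<epsilon> v" by (rule atkin_lehner)
    then have "shift (- 1) (\<rho> 0 1 (\<tau> ^ n) 0 v) = s \<epsilon> (shift (- 1) v)" by (simp add: act_scale)
    finally show ?thesis by (rule that(2))
  qed
qed

text \<open>The group fixes the path of v without its first vertex. After a shift by 1 the sum over
  the new first edges has level n - 1, below the conductor.\<close>

lemma orbit_minus1_sum: "\<Sum>(orbit (- 1) (int n) v) = 0"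
proof -
  have "fixed (- 1) (int n) (\<Sum>(orbit (- 1) (int n) v))" using n_pos by (intro orbit_sum_fixed) simp
  then have "fixed (- 1 + 1) (int n - 1) (shift 1 (\<Sum>(orbit (- 1) (int n) v)))" by (rule fixed_shift)
  then have "fixed 0 (int (n - 1)) (shift 1 (\<Sum>(orbit (- 1) (int n) v)))" using n_pos by (simp add: of_nat_diff)
  then have "shift 1 (\<Sum>(orbit (- 1) (int n) v)) = 0" using n_pos by (intro new_minimal[of "n - 1"]) auto
  then show ?thesis by (subst (asm) act_eq_0) auto
qed

text \<open>Induction on - val u. In the vanishing sum over the new first edges a term either
  belongs to a smaller - val u, hence to \<open>W\<close>, or arises from the given one by a
  diagonal unit.\<close>

lemma upper_mem:
  assumes W: "torus_stable W" and vW: "v \<in> W"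
  shows "upper u v \<in> W"
proof -
  note sub = torus_stableD(1)[OF W]
  have *: "\<forall>u. u \<in> ideal (- int m) \<longrightarrow> upper u v \<in> W" for m
  proof (induction m)
    case 0
    then show ?case using vW fixed_upper[OF v_fixed] by simp
  next
    case (Suc m)
    show ?case
    proof (intro allI impI)
      fix u assume u: "u \<in> ideal (- int (Suc m))"
      show "upper u v \<in> W"
      proof (cases "u \<in> ideal (- int m)")
        case True
        then show ?thesis using Suc by blast
      next
        case False
        then have uv: "u \<noteq> 0" "val u = - int (Suc m)" using u by (auto simp: ideal_def)
        show ?thesis
        proof (rule subspace_sum_pigeonhole[OF sub, where Q = "orbit (- 1) (int n) v" and f = "upper u" and x = v])
          show "finite (orbit (- 1) (int n) v)" using n_pos by (intro finite_orbit) simp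
          show "v \<in> orbit (- 1) (int n) v" by (rule orbit_self)
          have "(\<Sum>y\<in>orbit (- 1) (int n) v. upper u y) = upper u (\<Sum>(orbit (- 1) (int n) v))"
            by (rule act_sum[symmetric]) simp
          then show "(\<Sum>y\<in>orbit (- 1) (int n) v. upper u y) \<in> W"
            by (simp add: orbit_minus1_sum subspace_0[OF sub])
          fix y assume "y \<in> orbit (- 1) (int n) v"
          then show "upper u y \<in> W \<or> upper u y - upper u v \<in> W"
          proof (cases rule: orbit_minus1_cases)
            case (1 b)
            then have y: "upper u y = upper (u + b) v" by (simp add: upper_upper)
            show ?thesis
            proof (cases "u + b \<in> ideal (- int m)")
              case True
              then show ?thesis using Suc y by simp
            next
              case ub: False
              have "b \<in> ideal (- int (Suc m))" using 1(1) by (rule ideal_mono) simp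
              then have "u + b \<in> ideal (- int (Suc m))" using u by (intro ideal_add)
              then have ubv: "u + b \<noteq> 0" "val (u + b) = - int (Suc m)" using ub by (auto simp: ideal_def)
              then have unit: "(u + b) / u \<in> unit_set R" using uv by (simp add: unit_iff_val val_divide)
              have "diag ((u + b) / u) 1 (upper u v) = upper (u + b) (diag ((u + b) / u) 1 v)"
                using uv ubv by (subst diag_upper) auto
              also have "\<dots> = upper u y" using y fixed_diag[OF v_fixed unit unit_1] by simp
              finally show ?thesis using torus_stableD(3)[OF W unit unit_1, of "upper u v"] by simp
            qed
          next
            case (2 z)
            \<comment> \<open>This occurs only for n = 1, when one vertex is left and the path may
              turn back along the apartment. Pulling out the shift replaces u by u \<tau>, which the
              induction hypothesis covers.\<close>
            have "upper u y = s z (upper u (shift (- 1) v))" using 2 by (simp add: act_scale)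
            also have "upper u (shift (- 1) v) = shift (- 1) (upper (u * \<tau>) v)"
              by (subst upper_diag) (auto simp: power_int_minus divide_inverse)
            finally have eq: "upper u y = s z (shift (- 1) (upper (u * \<tau>) v))" .
            have "u * \<tau> \<in> ideal (- int m)" using uv by (simp add: ideal_def val_mult)
            then have "upper (u * \<tau>) v \<in> W" using Suc by blast
            then have "shift (- 1) (upper (u * \<tau>) v) \<in> W" by (intro torus_stableD(2)[OF W]) auto
            then show ?thesis unfolding eq using subspace_scale[OF sub] by blast
          qed
        qed
      qed
    qed
  qed
  have "u \<in> ideal (- int (nat (- val u)))" by (simp add: ideal_def)
  then show ?thesis using * by blast
qed

text \<open>Conjugation by the Atkin-Lehner element exchanges upper and lower unipotent matrices and
  swaps the two diagonal entries, so \<open>upper_mem\<close> applies to the preimage of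
  \<open>W\<close>.\<close>

lemma lower_mem:
  assumes W: "torus_stable W" and vW: "v \<in> W"
  shows "lower c v \<in> W"
proof -
  note sub = torus_stableD(1)[OF W]
  let ?t = "\<tau> ^ n"
  obtain \<epsilon> where e: "\<epsilon> \<noteq> 0" "\<rho> 0 1 ?t 0 v = s \<epsilon> v" by (rule atkin_lehner)
  define W' where "W' = {w. \<rho> 0 1 ?t 0 w \<in> W}"
  have W': "w \<in> W' \<longleftrightarrow> \<rho> 0 1 ?t 0 w \<in> W" for w by (simp add: W'_def)
  have det: "(0::'f) * 0 - 1 * ?t \<noteq> 0" by simp
  have comm: "\<rho> 0 1 ?t 0 (diag a d w) = diag d a (\<rho> 0 1 ?t 0 w)" if "a \<noteq> 0" "d \<noteq> 0" for a d w
    using that by (simp add: act_act mult.commute)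
  have "torus_stable W'"
    unfolding torus_stable_def
  proof (intro conjI allI impI)
    show "subspace W'"
      by (rule subspaceI) (auto simp: W' act_add[OF det] act_scale[OF det] act_zero[OF det]
          subspace_0[OF sub] subspace_add[OF sub] subspace_scale[OF sub])
    fix a d w
    show "diag a d w \<in> W'" if "a \<noteq> 0 \<and> d \<noteq> 0 \<and> w \<in> W'"
      using that torus_stableD(2)[OF W] by (simp add: W' comm)
    show "diag a d w - w \<in> W'" if "a \<in> unit_set R \<and> d \<in> unit_set R"
      using that torus_stableD(3)[OF W] by (simp add: W' comm act_diff[OF det] unit_nonzero)
  qed
  moreover have "v \<in> W'" using e vW subspace_scale[OF sub] by (simp add: W')
  ultimately have "\<rho> 0 1 ?t 0 (upper (c / ?t) v) \<in> W" using upper_mem W' by blast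
  also have "\<rho> 0 1 ?t 0 (upper (c / ?t) v) = lower c (\<rho> 0 1 ?t 0 v)" by (simp add: act_act)
  also have "\<dots> = s \<epsilon> (lower c v)" by (simp add: e act_scale)
  finally show ?thesis using scale_mem_iff[OF sub e(1)] by blast
qed

text \<open>Reversal of the path in the tree which corresponds to the translate of the new vector.\<close>

lemma reversal:
  assumes W: "torus_stable W" and c: "c \<noteq> 0"
    and h: "upper (- (1 + u * c) * c / \<tau> ^ n) (lower (\<tau> ^ n / c) v) \<in> W"
  shows "upper u (lower c v) \<in> W"
proof -
  let ?t = "\<tau> ^ n"
  obtain \<epsilon> where e: "\<epsilon> \<noteq> 0" "\<rho> 0 1 ?t 0 v = s \<epsilon> v" by (rule atkin_lehner)
  have "s \<epsilon> (upper u (lower c v)) = upper u (lower c (\<rho> 0 1 ?t 0 v))" by (simp add: e act_scale)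
  also have "\<dots> = diag (- ?t / c) c (upper (- (1 + u * c) * c / ?t) (lower (?t / c) v))"
    using c by (simp add: act_act) (simp add: field_simps)
  also have "\<dots> \<in> W" using h c by (intro torus_stableD(2)[OF W]) auto
  finally show ?thesis using scale_mem_iff[OF torus_stableD(1)[OF W] e(1)] by blast
qed

section \<open>Translates whose paths leave the standard apartment\<close>

lemma lower_cong:
  assumes "c - c' \<in> ideal (int n)" shows "lower c v = lower c' v"
proof -
  have "lower c v = lower c' (lower (c - c') v)" by (simp add: lower_lower)
  then show ?thesis using fixed_lower[OF v_fixed assms] by simp
qed

text \<open>The average over \<open>iwahori 0 (int (n - 1))\<close> changes only the last edge of
  the path and vanishes because its level is below the conductor. The inequality makes every such
  change the effect of a diagonal unit.\<close>

lemma mem_if_index_neg: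
  assumes W: "torus_stable W"
    and c: "c \<noteq> 0" "1 \<le> val c" and u: "u \<noteq> 0" "val u < 0" and uc: "1 + u * c \<noteq> 0"
    and index: "- val u + val c + val (1 + u * c) < int n"
  shows "upper u (lower c v) \<in> W"
proof -
  note sub = torus_stableD(1)[OF W]
  have vuc: "val (u * c) = val u + val c" using u c by (simp add: val_mult)
  \<comment> \<open>This leaves room for the last edge: adding an element of
    \<open>ideal (int n - 1)\<close> to c keeps its valuation.\<close>
  have i: "val c < int n - 1" using val_1_plus[OF uc] index c u vuc by linarith
  then have n2: "2 \<le> n" using c by linarith
  let ?Q = "orbit 0 (int (n - 1)) v"
  have sum: "\<Sum>?Q = 0" using n2 by (intro new_minimal[of "n - 1"] orbit_sum_fixed) auto
  show ?thesis
  proof (rule subspace_sum_pigeonhole[OF sub, where Q = ?Q and f = "\<lambda>y. upper u (lower c y)" and x = v])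
    show "finite ?Q" by (intro finite_orbit) simp
    show "v \<in> ?Q" by (rule orbit_self)
    have "(\<Sum>y\<in>?Q. upper u (lower c y)) = upper u (lower c (\<Sum>?Q))"
      by (simp add: act_sum)
    moreover have "upper u (lower c 0) = 0" by simp
    ultimately show "(\<Sum>y\<in>?Q. upper u (lower c y)) \<in> W"
      by (simp only: sum subspace_0[OF sub])
    fix y assume "y \<in> ?Q"
    then obtain a b c1 d where k: "iwahori 0 (int (n - 1)) a b c1 d" and y: "y = \<rho> a b c1 d v"
      unfolding orbit_def by blast
    have a: "a \<in> unit_set R" using n2 by (intro iwahori_diagonal_units(1)[OF k]) simp
    then have a0: "a \<noteq> 0" by (rule unit_nonzero)
    have h: "b \<in> ideal 0" "c1 \<in> ideal (int (n - 1))" "a * d - b * c1 \<in> unit_set R"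
      using k unfolding iwahori_def by blast+
    have k': "iwahori 0 (int n) a b 0 ((a * d - b * c1) / a)"
      unfolding iwahori_def using a a0 h by (auto intro: unit_in_R unit_divide)
    define r where "r = c1 / a"
    have r: "r \<in> ideal (int n - 1)"
      unfolding r_def using ideal_divide_unit[OF h(2) a] n2 by (simp add: of_nat_diff)
    have "y = lower r (\<rho> a b 0 ((a * d - b * c1) / a) v)"
      unfolding y r_def using a0 iwahori_det[OF k'] by (simp add: act_act field_simps)
    then have "y = lower r v" unfolding fixedD[OF v_fixed k'] .
    then have fy: "upper u (lower c y) = upper u (lower (c + r) v)" by (simp add: lower_lower)
    define c' where "c' = c + r"
    have "r / c \<in> ideal 1" using r c i by (cases "r = 0") (auto simp: ideal_def val_divide)
    then have "1 + r / c \<in> unit_set R" by (rule unit_add_ideal[OF unit_1])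
    moreover have "c' = c * (1 + r / c)" using c by (simp add: c'_def field_simps)
    ultimately have c': "c' \<noteq> 0" "val c' = val c"
      using c val_mult[of c "1 + r / c"] by (auto simp: unit_iff_val)
    \<comment> \<open>The solution of c' (1 + e (1 + u c)) = c. The diagonal matrix with entries 1 +
      e and 1 will carry the translate for c to the one for c'. Since r has valuation at least n -
      1, the bound on the index is what makes e u integral.\<close>
    define e where "e = - r / (c' * (1 + u * c))"
    have "c' * (e * (1 + u * c)) = - r" using c' uc by (simp add: e_def)
    then have er: "c' * (1 + e * (1 + u * c)) = c" by (simp add: distrib_left c'_def)
    have e: "e \<in> ideal (- val u)"
      using r c' uc index by (cases "r = 0") (auto simp: e_def ideal_def val_divide val_mult)
    have e1: "e \<in> ideal 1" using e by (rule ideal_mono) (use u in simp)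
    have eu: "e * u \<in> R"
      using e u by (cases "e = 0") (auto simp: ideal_def R_iff_val val_mult)
    have alpha: "1 + e \<in> unit_set R" using e1 by (rule unit_add_ideal[OF unit_1])
    define A where "A = 1 + e * (1 + u * c)"
    define B where "B = e * u"
    have A0: "A \<noteq> 0" using er c by (auto simp: A_def)
    have A: "A \<in> unit_set R"
      using er c' A0 val_mult[OF c'(1) A0] by (simp add: unit_iff_val A_def)
    have "c' * B \<in> ideal 1"
      using eu c' c unfolding B_def by (intro ideal_mult_R) (auto simp: ideal_def)
    then have D: "1 - c' * B \<in> unit_set R"
      using unit_add_ideal[OF unit_1 ideal_minus] by fastforce
    \<comment> \<open>The stabilizing matrix that makes up the difference between the translate for
      c' and the diagonal translate for c.\<close>
    have k'': "iwahori 0 (int n) A B 0 (1 - c' * B)"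
      unfolding iwahori_def using unit_mult[OF A D] A D eu by (simp add: ideal_0 unit_in_R B_def)
    have cA: "c' * A = c" using er by (simp add: A_def)
    have "A - B * c = A * (1 - c' * B)" using cA by (simp add: algebra_simps flip: cA)
    then have det: "A * 1 - B * c \<noteq> 0" using A0 unit_nonzero[OF D] by simp
    have "lower c' (\<rho> A B 0 (1 - c' * B) v) = \<rho> A B c 1 v"
      using iwahori_det[OF k''] cA by (simp add: act_act)
    then have "upper u (lower c' v) = upper u (\<rho> A B c 1 v)"
      unfolding fixedD[OF v_fixed k''] by simp
    also have "\<dots> = \<rho> (A + u * c) (B + u) c 1 v" using det by (simp add: act_act)
    also have "\<dots> = \<rho> ((1 + e) * (1 + u * c)) ((1 + e) * u) c 1 v"
      by (rule act_cong) (simp_all add: A_def B_def algebra_simps)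
    also have "\<dots> = diag (1 + e) 1 (upper u (lower c v))"
      using unit_nonzero[OF alpha] by (simp add: act_act)
    finally have "upper u (lower c y) = diag (1 + e) 1 (upper u (lower c v))"
      unfolding fy c'_def .
    then show "upper u (lower c y) \<in> W \<or> upper u (lower c y) - upper u (lower c v) \<in> W"
      using torus_stableD(3)[OF W alpha unit_1] by simp
  qed
qed

text \<open>When the two branches of the path have equal length, the conjugate Iwahori subgroup moves the
  translate of the new vector only inside its orbit under the diagonal units.\<close>

lemma mem_if_index_zero:
  assumes W: "torus_stable W" and vW: "v \<in> W"
    and c: "c \<noteq> 0" "1 \<le> val c" "val c < int n" and u: "u \<noteq> 0" and uc: "1 + u * c \<noteq> 0"
    and index: "- val u + val c + val (1 + u * c) = int n"
  shows "upper u (lower c v) \<in> W"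
proof -
  note sub = torus_stableD(1)[OF W]
  define x where "x = upper u (lower c v)"
  \<comment> \<open>The group of the average fixes the segment from the vertex k to the vertex k - n
    of the standard apartment, so the average will be a multiple of
    \<open>shift k v\<close>.\<close>
  define k where "k = val (1 + u * c)"
  let ?Q = "orbit k (int n - k) x"
  \<comment> \<open>Adding b to u multiplies u by the unit S. The diagonal matrix with entries S and
    1 does the same and also divides c by S; by the equation for the index this changes c only
    modulo \<open>ideal (int n)\<close>.\<close>
  have upper_x: "\<exists>t1\<in>unit_set R. \<exists>t2\<in>unit_set R. upper b x = diag t1 t2 x" if b: "b \<in> ideal k" for b
  proof -
    define S where "S = 1 + b / u"
    have "b / u \<in> ideal 1"
      using b u index c by (cases "b = 0") (auto simp: ideal_def val_divide k_def)
    then have S: "S \<in> unit_set R" unfolding S_def by (rule unit_add_ideal[OF unit_1])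
    then have S0: "S \<noteq> 0" "val S = 0" by (auto simp: unit_iff_val)
    have "c / S - c = - (c * (b / u)) / S" using S0 by (simp add: S_def field_simps)
    also have "\<dots> \<in> ideal (int n)"
      using b u c S0 index by (cases "b = 0") (auto simp: ideal_def val_divide val_mult k_def)
    finally have "lower (c / S) v = lower c v" by (rule lower_cong)
    moreover have "diag S 1 x = upper (S * u) (lower (c / S) (diag S 1 v))"
      unfolding x_def using S0 by (simp add: act_act distrib_left mult.assoc)
    moreover have "diag S 1 v = v" using fixed_diag[OF v_fixed S unit_1] .
    moreover have "S * u = b + u" using u by (simp add: S_def field_simps)
    ultimately have "diag S 1 x = upper b x" by (simp add: x_def upper_upper)
    then show ?thesis using S unit_1 by (intro bexI[of _ S] bexI[of _ 1]) auto
  qed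
  \<comment> \<open>Here the unit is 1 + r u, and c is changed by r (1 + u c), which lies in
    \<open>ideal (int n)\<close> by the choice of k.\<close>
  have lower_x: "\<exists>t1\<in>unit_set R. \<exists>t2\<in>unit_set R. lower r x = diag t1 t2 x"
    if r: "r \<in> ideal (int n - k)" for r
  proof -
    define t where "t = 1 + r * u"
    have "r * u \<in> ideal 1"
      using r u index c by (cases "r = 0") (auto simp: ideal_def val_mult k_def)
    then have t: "t \<in> unit_set R" unfolding t_def by (rule unit_add_ideal[OF unit_1])
    then have t0: "t \<noteq> 0" by (rule unit_nonzero)
    have "c + r * (1 + u * c) - c \<in> ideal (int n)"
      using r uc by (cases "r = 0") (auto simp: ideal_def val_mult k_def)
    then have eq: "lower (c + r * (1 + u * c)) v = lower c v" by (rule lower_cong)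
    have "lower r x = \<rho> (1 + u * c) u (c + r * (1 + u * c)) t v"
      unfolding x_def by (simp add: act_act t_def algebra_simps)
    moreover have "diag 1 t (upper u (lower (c + r * (1 + u * c)) (diag (inverse t) 1 v)))
      = \<rho> ((1 + u * (c + r * (1 + u * c))) * inverse t) u ((c + r * (1 + u * c)) * (t * inverse t)) t v"
      using t0 by (simp add: act_act, intro act_cong) (simp_all add: algebra_simps)
    moreover have "(1 + u * (c + r * (1 + u * c))) * inverse t = 1 + u * c"
    proof -
      have "1 + u * (c + r * (1 + u * c)) = (1 + u * c) * t" by (simp add: t_def algebra_simps)
      then show ?thesis using t0 by simp
    qed
    moreover have "diag (inverse t) 1 v = v" using fixed_diag[OF v_fixed unit_inverse[OF t] unit_1] .
    ultimately have "lower r x = diag 1 t x" using t0 eq by (simp add: x_def)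
    then show ?thesis using t unit_1 by (intro bexI[of _ 1] bexI[of _ t]) auto
  qed
  have "fixed k (int n - k) (\<Sum>?Q)" by (intro orbit_sum_fixed) simp
  then have "fixed (k + - k) (int n - k - - k) (shift (- k) (\<Sum>?Q))" by (rule fixed_shift)
  then have "fixed 0 (int n) (shift (- k) (\<Sum>?Q))" by simp
  then obtain z where z: "shift (- k) (\<Sum>?Q) = s z v" using new_unique by blast
  have "\<Sum>?Q = shift k (shift (- k) (\<Sum>?Q))" by (simp add: act_act power_int_minus)
  also have "\<dots> = s z (shift k v)" unfolding z by (simp add: act_scale)
  finally have sum: "\<Sum>?Q = s z (shift k v)" .
  have "x \<in> W"
  proof (rule subspace_sum_pigeonhole[OF sub, where Q = ?Q and f = "\<lambda>y. y" and x = x])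
    show "finite ?Q" by (intro finite_orbit) simp
    show "x \<in> ?Q" by (rule orbit_self)
    show "\<Sum>?Q \<in> W"
      unfolding sum by (intro subspace_scale[OF sub] torus_stableD(2)[OF W] vW) auto
    fix y assume "y \<in> ?Q"
    then obtain a b c1 d where k: "iwahori k (int n - k) a b c1 d" and y: "y = \<rho> a b c1 d x"
      unfolding orbit_def by blast
    have h: "b \<in> ideal k" "c1 \<in> ideal (int n - k)" "a * d - b * c1 \<in> unit_set R"
      using k unfolding iwahori_def by blast+
    have d: "d \<in> unit_set R" using n_pos by (intro iwahori_diagonal_units(2)[OF k]) simp
    define al where "al = (a * d - b * c1) / d"
    have al: "al \<in> unit_set R" unfolding al_def using h(3) d by (rule unit_divide)
    note nz = unit_nonzero[OF d] unit_nonzero[OF al]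
    have "y = upper (b / d) (\<rho> al 0 c1 d x)"
      unfolding y al_def by (rule iwahori_decomposition[OF k nz(1)])
    also have "\<rho> al 0 c1 d x = lower (c1 / al) (diag al d x)" using nz by (simp add: act_act)
    also have "\<dots> = diag al d (lower (c1 / d) x)" using nz by (subst lower_diag) auto
    also obtain t1 t2 where t: "t1 \<in> unit_set R" "t2 \<in> unit_set R" "lower (c1 / d) x = diag t1 t2 x"
      using lower_x[OF ideal_divide_unit[OF h(2) d]] by blast
    note nz' = nz unit_nonzero[OF t(1)] unit_nonzero[OF t(2)]
    have "diag al d (lower (c1 / d) x) = diag (al * t1) (d * t2) x"
      unfolding t(3) using nz' by (simp add: diag_diag)
    also have "upper (b / d) \<dots> = diag (al * t1) (d * t2) (upper (b / d * (d * t2) / (al * t1)) x)"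
      using nz' by (subst upper_diag) auto
    also have "b / d * (d * t2) / (al * t1) = b / (al * t1 / t2)" using nz' by simp
    also obtain t3 t4 where t': "t3 \<in> unit_set R" "t4 \<in> unit_set R"
      "upper (b / (al * t1 / t2)) x = diag t3 t4 x"
      using upper_x[OF ideal_divide_unit[OF h(1) unit_divide[OF unit_mult[OF al t(1)] t(2)]]] by blast
    have "diag (al * t1) (d * t2) (upper (b / (al * t1 / t2)) x) = diag (al * t1 * t3) (d * t2 * t4) x"
      unfolding t'(3) using nz' unit_nonzero[OF t'(1)] unit_nonzero[OF t'(2)] by (subst diag_diag) auto
    finally have "y = diag (al * t1 * t3) (d * t2 * t4) x" .
    moreover have "al * t1 * t3 \<in> unit_set R" "d * t2 * t4 \<in> unit_set R"
      using al d t(1,2) t'(1,2) by (auto intro: unit_mult)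
    ultimately show "y \<in> W \<or> y - x \<in> W" using torus_stableD(3)[OF W] by simp
  qed
  then show ?thesis by (simp add: x_def)
qed

text \<open>Under \<open>reversal\<close> the quantity val (1 + u c) + val c - val u turns into 2 n
  minus itself, so values above n reduce to values below n. The reversal also settles the degenerate
  cases val c = 0 and 1 + u c = 0.\<close>

lemma upper_lower_mem:
  assumes W: "torus_stable W" and vW: "v \<in> W" and cR: "c \<in> R"
  shows "upper u (lower c v) \<in> W"
proof -
  have easy: "upper u (lower c v) \<in> W" if "c \<in> ideal (int n)" for u c
    using fixed_lower[OF v_fixed that] upper_mem[OF W vW] by simp
  \<comment> \<open>An upper triangular matrix in the stabilizer of v splits off on the right, and a
    lower unipotent translate remains.\<close>
  have integral: "upper u (lower c v) \<in> W" if u: "u \<in> R" and c: "c \<in> ideal 1" for u c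
  proof -
    define x where "x = 1 + u * c"
    have x: "x \<in> unit_set R" unfolding x_def by (intro unit_add_ideal unit_1 ideal_R_mult u c)
    then have x0: "x \<noteq> 0" by (rule unit_nonzero)
    have k: "iwahori 0 (int n) x u 0 (inverse x)"
      unfolding iwahori_def using x u x0 by (auto simp: ideal_0 intro: unit_in_R unit_inverse)
    have "upper u (lower c v) = \<rho> x u c 1 v" by (simp add: act_act x_def)
    also have "\<dots> = lower (c / x) (\<rho> x u 0 (inverse x) v)"
      using x0 by (simp add: act_act) (simp add: x_def field_simps)
    also have "\<dots> = lower (c / x) v" unfolding fixedD[OF v_fixed k] ..
    finally show ?thesis using lower_mem[OF W vW] by simp
  qed
  show ?thesis
  proof (cases "c = 0 \<or> int n \<le> val c")
    case True
    then show ?thesis by (intro easy) (auto simp: ideal_def)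
  next
    case False
    then have c: "c \<noteq> 0" "0 \<le> val c" "val c < int n" using cR R_iff_val by auto
    let ?u = "- (1 + u * c) * c / \<tau> ^ n" and ?c = "\<tau> ^ n / c"
    have vc': "?c \<noteq> 0" "val ?c = int n - val c" using c by (auto simp: val_divide)
    show ?thesis
    proof (cases "val c = 0")
      case True
      show ?thesis by (rule reversal[OF W c(1)], rule easy) (use True vc' in \<open>auto simp: ideal_def\<close>)
    next
      case False
      then have c1: "1 \<le> val c" using c by simp
      show ?thesis
      proof (cases "u \<in> R")
        case True
        then show ?thesis using c1 by (intro integral) (auto simp: ideal_def)
      next
        case False
        then have "u \<noteq> 0" by auto
        then have u: "u \<noteq> 0" "val u < 0" using False R_iff_val[of u] by auto
        show ?thesis
        proof (cases "1 + u * c = 0")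
          case True
          then show ?thesis using reversal[OF W c(1), of u] lower_mem[OF W vW] by simp
        next
          case uc: False
          have vu': "?u \<noteq> 0" "val ?u = val (1 + u * c) + val c - int n"
          proof -
            have "?u = - ((1 + u * c) * c / \<tau> ^ n)" by (simp only: mult_minus_left divide_minus_left)
            moreover have "(1 + u * c) * c / \<tau> ^ n \<noteq> 0"
              "val ((1 + u * c) * c / \<tau> ^ n) = val (1 + u * c) + val c - int n"
              using uc c by (simp_all add: val_divide val_mult)
            ultimately show "?u \<noteq> 0" "val ?u = val (1 + u * c) + val c - int n"
              by (simp_all only: val_minus neg_equal_0_iff_equal not_False_eq_True)
          qed
          have eq: "1 + ?u * ?c = - (u * c)" using c by (simp add: field_simps)
          have "1 + ?u * ?c \<noteq> 0" "val (1 + ?u * ?c) = val u + val c"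
            unfolding eq using u c by (auto simp: val_mult)
          note rev = vc' vu' this
          consider "- val u + val c + val (1 + u * c) < int n" | "- val u + val c + val (1 + u * c) = int n"
            | "- val u + val c + val (1 + u * c) > int n" by linarith
          then show ?thesis
          proof cases
            case 1
            then show ?thesis using mem_if_index_neg[OF W c(1) c1 u uc] by blast
          next
            case 2
            then show ?thesis using mem_if_index_zero[OF W vW c(1) c1 c(3) u(1) uc] by blast
          next
            case 3
            show ?thesis
            proof (rule reversal[OF W c(1)], cases "?u \<in> R")
              case True
              then show "upper ?u (lower ?c v) \<in> W"
                using rev c by (intro integral) (auto simp: ideal_def)
            next
              case False
              then have "val ?u < 0" using R_iff_val[OF rev(3)] by simp
              moreover have "- val ?u + val ?c + val (1 + ?u * ?c) < int n"
                unfolding rev(2,4,6) using 3 by simp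
              ultimately show "upper ?u (lower ?c v) \<in> W"
                using rev c by (intro mem_if_index_neg[OF W]) auto
            qed
          qed
        qed
      qed
    qed
  qed
qed

text \<open>Up to diagonal matrices on the left, a matrix is \<open>upper\<close> times
  \<open>lower\<close> with integral parameter, or, up to the stabilizer of v on the right,
  \<open>upper\<close> times the Weyl element. The latter sends v to a multiple of
  \<open>shift (int n) v\<close>, so that only \<open>upper_mem\<close> is required.\<close>

theorem torus_stable_eq_UNIV:
  assumes W: "torus_stable W" and vW: "v \<in> W"
  shows "W = UNIV"
proof (rule cyclic[OF torus_stableD(1)[OF W] v_nonzero])
  fix a b c d :: 'f assume det: "a * d - b * c \<noteq> 0"
  define D where "D = a * d - b * c"
  have D: "D \<noteq> 0" using det by (simp add: D_def)
  show "\<rho> a b c d v \<in> W"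
  proof (cases "d \<noteq> 0 \<and> c / d \<in> R")
    case True
    then have "\<rho> a b c d v = diag (D / d) d (upper (b * d / D) (lower (c / d) v))"
      using D by (simp add: act_act, intro act_cong) (simp_all add: D_def field_simps)
    also have "\<dots> \<in> W"
      using True D by (intro torus_stableD(2)[OF W] upper_lower_mem[OF W vW]) auto
    finally show ?thesis .
  next
    case False
    have c: "c \<noteq> 0" "- d / c \<in> ideal 0"
    proof -
      show c0: "c \<noteq> 0" using False det by auto
      show "- d / c \<in> ideal 0"
      proof (cases "d = 0")
        case True
        then show ?thesis by simp
      next
        case d0: False
        then have "val (c / d) < 0" using False c0 R_iff_val[of "c / d"] by simp
        then show ?thesis using c0 d0 by (simp add: ideal_def val_divide)
      qed
    qed
    obtain z where z: "\<rho> 0 1 1 0 v = s z (shift (int n) v)" by (rule weyl_new)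
    have "\<rho> a b c d v = \<rho> a b c d (upper (- d / c) v)" using fixed_upper[OF v_fixed c(2)] by simp
    also have "\<dots> = upper (a / c) (diag (- D / c) c (\<rho> 0 1 1 0 v))"
      using c D det by (simp add: act_act, intro act_cong) (simp_all add: D_def field_simps)
    also have "\<dots> = s z (upper (a / c) (diag (- D / c) c (shift (int n) v)))"
      using c D by (simp add: z act_scale)
    also have "diag (- D / c) c (shift (int n) v) = diag (- D / c * \<tau> ^ n) c v"
      using c D by (subst diag_diag) auto
    also have "upper (a / c) \<dots> = diag (- D / c * \<tau> ^ n) c (upper (a / c * c / (- D / c * \<tau> ^ n)) v)"
      using c D by (subst upper_diag) auto
    finally have "\<rho> a b c d v = s z (diag (- D / c * \<tau> ^ n) c (upper (a / c * c / (- D / c * \<tau> ^ n)) v))" .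
    also have "\<dots> \<in> W"
      using c D by (intro subspace_scale[OF torus_stableD(1)[OF W]] torus_stableD(2)[OF W] upper_mem[OF W vW]) auto
    finally show ?thesis .
  qed
qed

end

section \<open>Invariant trilinear forms\<close>

context gl2_rep
begin

section \<open>Spherical vectors\<close>

lemma weyl_iwahori: "iwahori 0 0 0 1 1 0"
  unfolding iwahori_def ideal_0 using unit_minus[OF unit_1] by simp

lemma weyl_shift:
  assumes "fixed 0 0 v"
  shows "\<rho> 0 1 (\<tau> powi k) 0 v = s (\<omega> (\<tau> powi k)) (shift (- k) v)"
proof -
  have "\<rho> 0 1 (\<tau> powi k) 0 v = \<rho> 0 1 (\<tau> powi k) 0 (\<rho> 0 1 1 0 v)"
    using fixedD[OF assms weyl_iwahori] by simp
  also have "\<dots> = diag (\<tau> powi k) (\<tau> powi k) (shift (- k) v)"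
    by (simp add: act_act power_int_minus)
  finally show ?thesis by (simp add: central)
qed

lemma diag_shift:
  assumes "fixed 0 0 v" "a \<noteq> 0" "d \<noteq> 0"
  shows "diag a d (shift k v) = s (\<omega> d) (shift (val a - val d + k) v)"
proof -
  have nz: "a / d \<noteq> 0" using assms by simp
  obtain u where u: "u \<in> unit_set R" "a / d = \<tau> powi val (a / d) * u"
    using val_decomposition[OF nz] by blast
  have "diag a d (shift k v) = diag d d (diag (a / d) 1 (shift k v))"
    using assms by (simp add: diag_diag)
  also have "diag (a / d) 1 (shift k v) = diag (\<tau> powi val (a / d) * u) 1 (shift k v)"
    by (simp only: u(2)[symmetric])
  also have "\<dots> = shift (val (a / d) + k) (diag u 1 v)"
    using unit_nonzero[OF u(1)] by (simp add: act_act power_int_add mult_ac)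
  also have "diag u 1 v = v" using fixed_diag[OF assms(1) u(1) unit_1] .
  finally show ?thesis using assms by (simp add: central val_divide)
qed

text \<open>The sum over the orbit of \<open>shift (- 1) v\<close> is the Hecke operator applied to \<open>v\<close>.\<close>

lemma hecke_vanishing:
  fixes l :: "'v \<Rightarrow> complex"
  assumes v: "fixed 0 0 v" and unique: "\<And>w. fixed 0 0 w \<Longrightarrow> \<exists>z. w = s z v"
    and l_add: "\<And>x y. l (x + y) = l x + l y" and l_scale: "\<And>z x. l (s z x) = z * l x"
    and l_lower: "\<And>c. c \<in> R \<Longrightarrow> l (lower c (shift (- 1) v)) = l (shift (- 1) v)"
    and l0: "l v = 0" and l1: "l (shift 1 v) = 0"
  shows "l (shift (- 1) v) = 0"
proof -
  define x where "x = shift (- 1) v"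
  define W where "W = {w. l w = 0}"
  have W: "w \<in> W \<longleftrightarrow> l w = 0" for w by (simp add: W_def)
  have l_zero: "l 0 = 0" using l_scale[of 0 0] by simp
  have sub: "subspace W" by (rule subspaceI) (auto simp: W l_add l_scale l_zero)
  have l_diff: "l (y - w) = l y - l w" for y w
    using l_add[of "y - w" w] by simp
  have x_fixed: "fixed (- 1) 1 x" using fixed_shift[OF v, of "- 1"] by (simp add: x_def)
  have "x \<in> W"
  proof (rule subspace_sum_pigeonhole[OF sub, where Q = "orbit 0 0 x" and f = "\<lambda>y. y" and x = x])
    show "finite (orbit 0 0 x)" by (rule finite_orbit) simp
    show "x \<in> orbit 0 0 x" by (rule orbit_self)
    obtain z where "\<Sum>(orbit 0 0 x) = s z v" using unique orbit_sum_fixed[of 0 0 x] by auto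
    then show "\<Sum>(orbit 0 0 x) \<in> W" using l0 by (simp add: W l_scale)
    fix y assume "y \<in> orbit 0 0 x"
    then obtain a b c d where k: "iwahori 0 0 a b c d" and y: "y = \<rho> a b c d x"
      unfolding orbit_def by blast
    have h: "a \<in> R" "b \<in> R" "c \<in> R" "d \<in> R" "a * d - b * c \<in> unit_set R"
      using k unfolding iwahori_def ideal_0 by blast+
    \<comment> \<open>With a unit in the upper left corner, the upper triangular factor on the right
      stabilizes x. These matrices give the neighbours of the vertex 0 on which l takes the same
      value as on x.\<close>
    have red: "\<rho> a b c d x = lower (c / a) x"
      if "a \<in> unit_set R" "b \<in> R" "a * d - b * c \<in> unit_set R" for a b c d
    proof -
      have a: "a \<noteq> 0" using that(1) by (rule unit_nonzero)
      have k': "iwahori (- 1) 1 a b 0 ((a * d - b * c) / a)"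
        unfolding iwahori_def using that a ideal_mono[of b 0 "- 1"]
        by (auto simp: ideal_0 intro: unit_in_R unit_divide)
      have "\<rho> a b c d x = lower (c / a) (\<rho> a b 0 ((a * d - b * c) / a) x)"
        using a unit_nonzero[OF that(3)] by (simp add: act_act, intro act_cong) (simp_all add: field_simps)
      then show ?thesis unfolding fixedD[OF x_fixed k'] .
    qed
    show "y \<in> W \<or> y - x \<in> W"
    proof (cases "a \<in> unit_set R")
      case True
      have "c / a \<in> R" using ideal_divide_unit[of c 0 a] h(3) True by (simp add: ideal_0)
      then have "l (lower (c / a) x) = l x" unfolding x_def by (rule l_lower)
      then have "l y = l x" unfolding y red[OF True h(2,5)] .
      then show ?thesis by (simp add: W l_diff)
    next
      case False
      \<comment> \<open>The one remaining neighbour is the vertex 1: exchanging the rows leads back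
        to x, and the Weyl element maps x to a multiple of \<open>shift 1 v\<close>.\<close>
      then have a1: "a \<in> ideal 1" using nonunit_in_ideal h(1) by blast
      have bc: "b * c \<in> unit_set R"
        using unit_add_ideal[OF unit_minus[OF h(5)] ideal_mult_R[OF a1 h(4)]] by simp
      then have "b \<noteq> 0" "c \<noteq> 0" by (auto dest: unit_nonzero)
      then have c: "c \<in> unit_set R"
        using bc h(2,3) by (auto simp: unit_iff_val val_mult R_iff_val)
      have det: "c * b - d * a \<in> unit_set R"
        using unit_minus[OF h(5)] by (simp add: mult.commute)
      have "y = \<rho> 0 1 1 0 (\<rho> c d a b x)" unfolding y using unit_nonzero[OF det] by (simp add: act_act)
      also have "\<rho> c d a b x = lower (a / c) x" by (rule red[OF c h(4) det])
      also have "\<dots> = x" by (rule fixed_lower[OF x_fixed ideal_divide_unit[OF a1 c]])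
      also have "\<rho> 0 1 1 0 x = \<rho> 0 1 (\<tau> powi - 1) 0 v" by (simp add: x_def act_act)
      also have "\<dots> = s (\<omega> (\<tau> powi - 1)) (shift 1 v)" using weyl_shift[OF v, of "- 1"] by simp
      finally show ?thesis using l1 by (simp add: W l_scale)
    qed
  qed
  then show ?thesis by (simp add: W x_def)
qed

text \<open>Only the effect on a spherical vector is recorded, so the right factor of the
  decomposition is absorbed by v and the diagonal factor becomes a shift with a scalar.\<close>

lemma cartan_decomposition:
  assumes v: "fixed 0 0 v" and det: "a * d - b * c \<noteq> 0"
  shows "\<exists>a' b' c' d' z k. iwahori 0 0 a' b' c' d' \<and> \<rho> a b c d v = \<rho> a' b' c' d' (s z (shift k v))"
proof -
  define C where "C w \<longleftrightarrow> (\<exists>a' b' c' d' z k. iwahori 0 0 a' b' c' d' \<and> w = \<rho> a' b' c' d' (s z (shift k v)))"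
    for w
  have C_act: "C (\<rho> a b c d w)" if k: "iwahori 0 0 a b c d" and w: "C w" for a b c d w
  proof -
    obtain a' b' c' d' z i where k': "iwahori 0 0 a' b' c' d'" "w = \<rho> a' b' c' d' (s z (shift i v))"
      using w unfolding C_def by blast
    have "\<rho> a b c d w = \<rho> (a * a' + b * c') (a * b' + b * d') (c * a' + d * c') (c * b' + d * d') (s z (shift i v))"
      unfolding k'(2) by (rule act_act[OF iwahori_det[OF k] iwahori_det[OF k'(1)]])
    moreover have "iwahori 0 0 (a * a' + b * c') (a * b' + b * d') (c * a' + d * c') (c * b' + d * d')"
      by (rule iwahori_mult[OF _ k k'(1)]) simp
    ultimately show ?thesis unfolding C_def by blast
  qed
  have C_diag: "C (diag a d v)" if "a \<noteq> 0" "d \<noteq> 0" for a d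
  proof -
    have "diag a d v = \<rho> 1 0 0 1 (s (\<omega> d) (shift (val a - val d) v))"
      using diag_shift[OF v that, of 0] by simp
    moreover have "iwahori 0 0 1 0 0 1" by (simp add: iwahori_def)
    ultimately show ?thesis unfolding C_def by blast
  qed
  have k_upper: "iwahori 0 0 1 u 0 1" and k_lower: "iwahori 0 0 1 0 u 1" if "u \<in> R" for u
    using that by (auto simp: iwahori_def ideal_0)
  have v_lower: "lower u v = v" and v_upper: "upper u v = v" if "u \<in> R" for u
    using that fixed_lower[OF v] fixed_upper[OF v] by (auto simp: ideal_0)
  have dichotomy: "x / y \<in> R \<or> (x \<noteq> 0 \<and> y / x \<in> R)" if "y \<noteq> 0" for x y
    using that by (cases "x = 0") (auto simp: R_iff_val val_divide)
  have C_triangular: "C (\<rho> a b 0 d v)" if nz: "a \<noteq> 0" "d \<noteq> 0" for a b d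
  proof (cases "b / d \<in> R")
    case True
    have "\<rho> a b 0 d v = upper (b / d) (diag a d v)" using nz by (simp add: act_act)
    then show ?thesis using C_act[OF k_upper[OF True] C_diag[OF nz]] by simp
  next
    case bd: False
    show ?thesis
    proof (cases "b / a \<in> R")
      case True
      have "\<rho> a b 0 d v = diag a d (upper (b / a) v)" using nz by (simp add: act_act)
      then show ?thesis using C_diag[OF nz] v_upper[OF True] by simp
    next
      case False
      then have b: "b \<noteq> 0" "d / b \<in> R" "a / b \<in> R" using bd dichotomy[of d b] dichotomy[of a b] nz by auto
      \<comment> \<open>Now b has the smallest valuation of the three entries. With b as pivot,
        integral row and column operations leave a diagonal matrix and the Weyl element.\<close>
      have "\<rho> a b 0 d v = lower (d / b) (\<rho> 0 1 1 0 (diag (- a * d / b) b (lower (a / b) v)))"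
        using b nz by (simp add: act_act, intro act_cong) (simp_all add: field_simps)
      moreover have "C (diag (- a * d / b) b v)" using b nz by (intro C_diag) auto
      ultimately show ?thesis
        using C_act[OF k_lower[OF b(2)] C_act[OF weyl_iwahori]] v_lower[OF b(3)] by simp
    qed
  qed
  have main: "C (\<rho> a b c d v)" if "a * d - b * c \<noteq> 0" "d \<noteq> 0" "c / d \<in> R" for a b c d
  proof -
    have "\<rho> a b c d v = \<rho> ((a * d - b * c) / d) b 0 d (lower (c / d) v)"
      using that by (simp add: act_act, intro act_cong) (simp_all add: field_simps)
    then show ?thesis using C_triangular[of "(a * d - b * c) / d" d b] that v_lower by simp
  qed
  have "C (\<rho> a b c d v)"
  proof (cases "d \<noteq> 0 \<and> c / d \<in> R")
    case True
    then show ?thesis using main det by blast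
  next
    case False
    then have c: "c \<noteq> 0" "d / c \<in> R" using dichotomy[of d c] det by (auto, cases "d = 0", auto)
    have "\<rho> a b c d v = \<rho> a b c d (\<rho> 0 1 1 0 v)" using fixedD[OF v weyl_iwahori] by simp
    also have "\<dots> = \<rho> b a d c v" using det by (simp add: act_act)
    finally show ?thesis using main[of b c a d] c det by (simp add: mult.commute)
  qed
  then show ?thesis unfolding C_def .
qed

end

section \<open>The trilinear form on shifts of the spherical vectors\<close>

locale trilinear_setting = dvr_field R \<tau> +
  r1: gl2_rep R \<tau> s1 \<rho>1 \<omega>1 + r2: gl2_rep R \<tau> s2 \<rho>2 \<omega>2 + r3: new_vector_rep R \<tau> s3 \<rho>3 \<omega>3 v3 n
  for R :: "'f::field set" and \<tau> :: 'f
    and s1 :: "complex \<Rightarrow> 'a::ab_group_add \<Rightarrow> 'a" and \<rho>1 \<omega>1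
    and s2 :: "complex \<Rightarrow> 'b::ab_group_add \<Rightarrow> 'b" and \<rho>2 \<omega>2
    and s3 :: "complex \<Rightarrow> 'c::ab_group_add \<Rightarrow> 'c" and \<rho>3 \<omega>3 v3 n +
  fixes v1 :: 'a and v2 :: 'b and L :: "'a \<Rightarrow> 'b \<Rightarrow> 'c \<Rightarrow> complex"
  assumes v1: "r1.fixed 0 0 v1" "v1 \<noteq> 0" "r1.fixed 0 0 x \<Longrightarrow> \<exists>k. x = s1 k v1"
    and v2: "r2.fixed 0 0 v2" "v2 \<noteq> 0" "r2.fixed 0 0 y \<Longrightarrow> \<exists>k. y = s2 k v2"
    and L_add: "L (x + x') y z = L x y z + L x' y z" "L x (y + y') z = L x y z + L x y' z"
      "L x y (z + z') = L x y z + L x y z'"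
    and L_scale: "L (s1 k x) y z = k * L x y z" "L x (s2 k y) z = k * L x y z"
      "L x y (s3 k z) = k * L x y z"
    and L_invariant: "a * d - b * c \<noteq> 0 \<Longrightarrow> L (\<rho>1 a b c d x) (\<rho>2 a b c d y) (\<rho>3 a b c d z) = L x y z"
begin

lemma L_zero: "L 0 y z = 0" "L x 0 z = 0" "L x y 0 = 0"
  using L_scale(1)[of 0 0 y z] L_scale(2)[of x 0 0 z] L_scale(3)[of x y 0 0] by simp_all

lemma L_sum3: "L x y (sum f S) = (\<Sum>i\<in>S. L x y (f i))"
  by (induction S rule: infinite_finite_induct) (simp_all add: L_zero L_add)

lemma L_diff3: "L x y (z - z') = L x y z - L x y z'"
  using L_add(3)[of x y "z - z'" z'] by simp

lemma L_shift: "L (r1.shift i x) (r2.shift j y) z = L (r1.shift (i - k) x) (r2.shift (j - k) y) (r3.shift (- k) z)"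
proof -
  have "L (r1.shift i x) (r2.shift j y) z
      = L (r1.shift (- k) (r1.shift i x)) (r2.shift (- k) (r2.shift j y)) (r3.shift (- k) z)"
    by (rule L_invariant[symmetric]) simp
  then show ?thesis by (simp only: r1.shift_shift r2.shift_shift add.commute[of "- k"] diff_conv_add_uminus[symmetric])
qed

context
  assumes vanishing: "L (r1.shift (- int n) v1) v2 v3 = 0"
begin

text \<open>The group \<open>iwahori 0 (int d)\<close> fixes the first two arguments, so by
  invariance the form is constant on the orbit of z in the third one.\<close>

lemma L_near_neg:
  assumes "d \<le> n" shows "L (r1.shift (- int d) v1) v2 z = 0"
proof -
  let ?x = "r1.shift (- int d) v1" and ?Q = "r3.orbit 0 (int d) z"
  have "r1.fixed (0 + - int d) (0 - - int d) ?x" by (rule r1.fixed_shift[OF v1(1)])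
  then have x: "r1.fixed 0 (int d) ?x" by (rule r1.fixed_mono) auto
  have y: "r2.fixed 0 (int d) v2" by (rule r2.fixed_mono[OF v2(1)]) auto
  have eq: "L ?x v2 w = L ?x v2 z" if "w \<in> ?Q" for w
  proof -
    obtain a b c e where k: "r3.iwahori 0 (int d) a b c e" and w: "w = \<rho>3 a b c e z"
      using \<open>w \<in> ?Q\<close> unfolding r3.orbit_def by blast
    have "L ?x v2 z = L (\<rho>1 a b c e ?x) (\<rho>2 a b c e v2) (\<rho>3 a b c e z)"
      by (rule L_invariant[symmetric, OF r3.iwahori_det[OF k]])
    then show ?thesis unfolding r1.fixedD[OF x k] r2.fixedD[OF y k] w by simp
  qed
  have "L ?x v2 (\<Sum>?Q) = (\<Sum>w\<in>?Q. L ?x v2 w)" by (rule L_sum3)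
  also have "\<dots> = of_nat (card ?Q) * L ?x v2 z" using eq by simp
  finally have sum: "L ?x v2 (\<Sum>?Q) = of_nat (card ?Q) * L ?x v2 z" .
  have sum_fixed: "r3.fixed 0 (int d) (\<Sum>?Q)" by (rule r3.orbit_sum_fixed) simp
  have "L ?x v2 (\<Sum>?Q) = 0"
  proof (cases "d = n")
    case True
    then obtain c where "\<Sum>?Q = s3 c v3" using r3.new_unique sum_fixed by blast
    then show ?thesis using vanishing True by (simp add: L_scale)
  next
    case False
    then have "\<Sum>?Q = 0" using r3.new_minimal[OF _ sum_fixed] assms by simp
    then show ?thesis by (simp add: L_zero)
  qed
  moreover have "card ?Q \<noteq> 0"
    using r3.finite_orbit[of 0 "int d" z] r3.orbit_self[of z 0 "int d"] by (auto simp: card_eq_0_iff)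
  ultimately show ?thesis using sum by simp
qed

text \<open>The Weyl element fixes \<open>v2\<close> and exchanges positive and negative shifts of
  \<open>v1\<close> up to a scalar.\<close>

lemma L_near_pos:
  assumes "d \<le> n" shows "L (r1.shift (int d) v1) v2 z = 0"
proof -
  have "L (r1.shift (int d) v1) v2 z
      = L (\<rho>1 0 1 1 0 (r1.shift (int d) v1)) (\<rho>2 0 1 1 0 v2) (\<rho>3 0 1 1 0 z)"
    by (rule L_invariant[symmetric]) simp
  also have "\<rho>1 0 1 1 0 (r1.shift (int d) v1) = \<rho>1 0 1 (\<tau> powi int d) 0 v1" by (simp add: r1.act_act)
  also have "\<dots> = s1 (\<omega>1 (\<tau> powi int d)) (r1.shift (- int d) v1)" by (rule r1.weyl_shift[OF v1(1)])
  also have "\<rho>2 0 1 1 0 v2 = v2" by (rule r2.fixedD[OF v2(1) r2.weyl_iwahori])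
  finally show ?thesis using L_near_neg[OF assms] by (simp only: L_scale) simp
qed

lemma L_near:
  assumes "\<bar>i - j\<bar> \<le> int n"
  shows "L (r1.shift i v1) (r2.shift j v2) z = 0"
proof -
  have eq: "L (r1.shift i v1) (r2.shift j v2) z = L (r1.shift (i - j) v1) v2 (r3.shift (- j) z)"
    using L_shift[of i v1 j v2 z j] by simp
  have "nat \<bar>i - j\<bar> \<le> n" using assms by simp
  then have "L (r1.shift (- int (nat \<bar>i - j\<bar>)) v1) v2 (r3.shift (- j) z) = 0"
    "L (r1.shift (int (nat \<bar>i - j\<bar>)) v1) v2 (r3.shift (- j) z) = 0"
    by (rule L_near_neg L_near_pos)+
  then show ?thesis unfolding eq by (cases "i \<le> j") simp_all
qed

section \<open>Hecke relations and reflection\<close>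

lemma lower_shift_fixed1: "r1.lower c (r1.shift k v1) = r1.shift k v1" if "0 \<le> k" "c \<in> R"
proof -
  have "r1.fixed (0 + k) (0 - k) (r1.shift k v1)" by (rule r1.fixed_shift[OF v1(1)])
  moreover have "c \<in> ideal (0 - k)" using that ideal_mono[of c 0] by (simp add: ideal_0)
  ultimately show ?thesis by (rule r1.fixed_lower)
qed

lemma lower_shift_fixed2: "r2.lower c (r2.shift k v2) = r2.shift k v2" if "0 \<le> k" "c \<in> R"
proof -
  have "r2.fixed (0 + k) (0 - k) (r2.shift k v2)" by (rule r2.fixed_shift[OF v2(1)])
  moreover have "c \<in> ideal (0 - k)" using that ideal_mono[of c 0] by (simp add: ideal_0)
  ultimately show ?thesis by (rule r2.fixed_lower)
qed

lemma lower_shift_fixed3: "r3.lower c (r3.shift k v3) = r3.shift k v3" if "int n \<le> k" "c \<in> R"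
proof -
  have "r3.fixed (0 + k) (int n - k) (r3.shift k v3)" by (rule r3.fixed_shift[OF r3.v_fixed])
  moreover have "c \<in> ideal (int n - k)" using that ideal_mono[of c 0] by (simp add: ideal_0)
  ultimately show ?thesis by (rule r3.fixed_lower)
qed

text \<open>A shift by - (i + 1) puts the first vector at -1. The other two are then shifted by j -
  i - 1 >= 0 and by - i - 1 >= n, where integral \<open>lower c\<close> fixes them. So the Hecke
  relation between the positions -1, 0 and 1 applies.\<close>

lemma hecke_step1:
  assumes "i < - int n" "i < j"
    and "L (r1.shift (i + 1) v1) (r2.shift j v2) v3 = 0" "L (r1.shift (i + 2) v1) (r2.shift j v2) v3 = 0"
  shows "L (r1.shift i v1) (r2.shift j v2) v3 = 0"
proof -
  let ?l = "\<lambda>x. L x (r2.shift (j - i - 1) v2) (r3.shift (- i - 1) v3)"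
  have eq: "?l (r1.shift k v1) = L (r1.shift (i + 1 + k) v1) (r2.shift j v2) v3" for k
  proof -
    have e: "i + 1 + k - (i + 1) = k" "j - (i + 1) = j - i - 1" "- (i + 1) = - i - 1" by simp_all
    show ?thesis using L_shift[of "i + 1 + k" v1 j v2 v3 "i + 1", unfolded e] by (rule sym)
  qed
  have "?l (r1.shift (- 1) v1) = 0"
  proof (rule r1.hecke_vanishing[OF v1(1,3)])
    show "?l v1 = 0" using eq[of 0] assms(3) by simp
    show "?l (r1.shift 1 v1) = 0" using eq[of 1] assms(4) by (simp add: add.assoc)
    fix c assume c: "c \<in> R"
    have "?l (r1.shift (- 1) v1) = L (r1.lower c (r1.shift (- 1) v1))
        (r2.lower c (r2.shift (j - i - 1) v2)) (r3.lower c (r3.shift (- i - 1) v3))"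
      by (rule L_invariant[symmetric]) simp
    also have "r2.lower c (r2.shift (j - i - 1) v2) = r2.shift (j - i - 1) v2"
      using assms c by (intro lower_shift_fixed2) auto
    also have "r3.lower c (r3.shift (- i - 1) v3) = r3.shift (- i - 1) v3"
      using assms c by (intro lower_shift_fixed3) auto
    finally show "?l (r1.lower c (r1.shift (- 1) v1)) = ?l (r1.shift (- 1) v1)" by (rule sym)
  qed (simp_all only: L_add L_scale)
  then show ?thesis unfolding eq by simp
qed

lemma hecke_step2:
  assumes "j < - int n" "j < i"
    and "L (r1.shift i v1) (r2.shift (j + 1) v2) v3 = 0" "L (r1.shift i v1) (r2.shift (j + 2) v2) v3 = 0"
  shows "L (r1.shift i v1) (r2.shift j v2) v3 = 0"
proof -
  let ?l = "\<lambda>y. L (r1.shift (i - j - 1) v1) y (r3.shift (- j - 1) v3)"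
  have eq: "?l (r2.shift k v2) = L (r1.shift i v1) (r2.shift (j + 1 + k) v2) v3" for k
  proof -
    have e: "j + 1 + k - (j + 1) = k" "i - (j + 1) = i - j - 1" "- (j + 1) = - j - 1" by simp_all
    show ?thesis using L_shift[of i v1 "j + 1 + k" v2 v3 "j + 1", unfolded e] by (rule sym)
  qed
  have "?l (r2.shift (- 1) v2) = 0"
  proof (rule r2.hecke_vanishing[OF v2(1,3)])
    show "?l v2 = 0" using eq[of 0] assms(3) by simp
    show "?l (r2.shift 1 v2) = 0" using eq[of 1] assms(4) by (simp add: add.assoc)
    fix c assume c: "c \<in> R"
    have "?l (r2.shift (- 1) v2) = L (r1.lower c (r1.shift (i - j - 1) v1))
        (r2.lower c (r2.shift (- 1) v2)) (r3.lower c (r3.shift (- j - 1) v3))"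
      by (rule L_invariant[symmetric]) simp
    also have "r1.lower c (r1.shift (i - j - 1) v1) = r1.shift (i - j - 1) v1"
      using assms c by (intro lower_shift_fixed1) auto
    also have "r3.lower c (r3.shift (- j - 1) v3) = r3.shift (- j - 1) v3"
      using assms c by (intro lower_shift_fixed3) auto
    finally show "?l (r2.lower c (r2.shift (- 1) v2)) = ?l (r2.shift (- 1) v2)" by (rule sym)
  qed (simp_all only: L_add L_scale)
  then show ?thesis unfolding eq by simp
qed

text \<open>The Atkin-Lehner element of \<open>v3\<close> reflects the apartment at - n / 2, so it
  reverses the order of i and j.\<close>

lemma L_reflect:
  assumes "L (r1.shift (- int n - i) v1) (r2.shift (- int n - j) v2) v3 = 0"
  shows "L (r1.shift i v1) (r2.shift j v2) v3 = 0"
proof -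
  obtain \<epsilon> where e: "\<rho>3 0 1 (\<tau> ^ n) 0 v3 = s3 \<epsilon> v3" by (rule r3.atkin_lehner)
  have x: "\<rho>1 0 1 (\<tau> ^ n) 0 (r1.shift i v1) = s1 (\<omega>1 (\<tau> powi (int n + i))) (r1.shift (- int n - i) v1)"
    using r1.weyl_shift[OF v1(1), of "int n + i"] by (simp add: r1.act_act power_int_add)
  have y: "\<rho>2 0 1 (\<tau> ^ n) 0 (r2.shift j v2) = s2 (\<omega>2 (\<tau> powi (int n + j))) (r2.shift (- int n - j) v2)"
    using r2.weyl_shift[OF v2(1), of "int n + j"] by (simp add: r2.act_act power_int_add)
  have "L (r1.shift i v1) (r2.shift j v2) v3
    = L (\<rho>1 0 1 (\<tau> ^ n) 0 (r1.shift i v1)) (\<rho>2 0 1 (\<tau> ^ n) 0 (r2.shift j v2)) (\<rho>3 0 1 (\<tau> ^ n) 0 v3)"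
    by (rule L_invariant[symmetric]) simp
  also have "\<dots> = 0" unfolding x y e L_scale assms by simp
  finally show ?thesis .
qed

text \<open>A Hecke step needs the smaller index below - n. If it is not, the larger index is
  positive as the distance exceeds n, and the reflection moves it below - n. Both terms of a step
  are nearer because the distance is at least 2.\<close>

lemma L_shifts: "L (r1.shift i v1) (r2.shift j v2) v3 = 0"
proof (induction "nat \<bar>i - j\<bar>" arbitrary: i j rule: less_induct)
  case less
  have IH: "L (r1.shift i' v1) (r2.shift j' v2) v3 = 0" if "\<bar>i' - j'\<bar> < \<bar>i - j\<bar>" for i' j'
    using less[of i' j'] that by simp
  have n: "1 \<le> int n" using r3.n_pos by simp
  show ?case
  proof (cases "\<bar>i - j\<bar> \<le> int n")
    case True
    then show ?thesis by (rule L_near)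
  next
    case False
    then consider "i < - int n" "i < j" | "j < - int n" "j < i"
      | "- int n \<le> i" "i < j" | "- int n \<le> j" "j < i" by linarith
    then show ?thesis
    proof cases
      case 1
      show ?thesis by (rule hecke_step1[OF 1 IH IH]) (use 1 False n in arith)+
    next
      case 2
      show ?thesis by (rule hecke_step2[OF 2 IH IH]) (use 2 False n in arith)+
    next
      case 3
      have "- int n - j < - int n" "- int n - j < - int n - i" using 3 False n by arith+
      from hecke_step2[OF this IH IH] show ?thesis
        by (rule L_reflect) (use 3 False n in arith)+
    next
      case 4
      have "- int n - i < - int n" "- int n - i < - int n - j" using 4 False n by arith+
      from hecke_step1[OF this IH IH] show ?thesis
        by (rule L_reflect) (use 4 False n in arith)+
    qed
  qed
qed

section \<open>From shifts to all vectors\<close>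

lemma L_shifts_all: "L (r1.shift i v1) (r2.shift j v2) z = 0"
proof -
  define W where "W = {z. \<forall>i j. L (r1.shift i v1) (r2.shift j v2) z = 0}"
  have W: "z \<in> W \<longleftrightarrow> (\<forall>i j. L (r1.shift i v1) (r2.shift j v2) z = 0)" for z
    by (simp add: W_def)
  have "r3.torus_stable W"
    unfolding r3.torus_stable_def
  proof (intro conjI allI impI)
    show "r3.subspace W" by (rule r3.subspaceI) (simp_all add: W_def L_add L_scale L_zero)
    fix a d :: 'f and w
    show "r3.diag a d w \<in> W" if h: "a \<noteq> 0 \<and> d \<noteq> 0 \<and> w \<in> W"
      unfolding W
    proof (intro allI)
      fix i j
      have nz: "a \<noteq> 0" "d \<noteq> 0" "inverse a \<noteq> 0" "inverse d \<noteq> 0" using h by auto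
      \<comment> \<open>Invariance moves the torus element to the first two vectors, where it only
        changes the shifts and contributes scalars.\<close>
      have "L (r1.shift i v1) (r2.shift j v2) (r3.diag a d w)
          = L (r1.diag (inverse a) (inverse d) (r1.shift i v1))
              (r2.diag (inverse a) (inverse d) (r2.shift j v2))
              (r3.diag (inverse a) (inverse d) (r3.diag a d w))"
        using nz by (intro L_invariant[symmetric]) simp
      also have "r3.diag (inverse a) (inverse d) (r3.diag a d w) = w" using nz by (simp add: r3.diag_diag)
      also have "L (r1.diag (inverse a) (inverse d) (r1.shift i v1))
              (r2.diag (inverse a) (inverse d) (r2.shift j v2)) w = 0"
        unfolding r1.diag_shift[OF v1(1) nz(3,4)] r2.diag_shift[OF v2(1) nz(3,4)] L_scale
        using h unfolding W by (simp only: mult_zero_right)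
      finally show "L (r1.shift i v1) (r2.shift j v2) (r3.diag a d w) = 0" .
    qed
    show "r3.diag a d w - w \<in> W" if h: "a \<in> unit_set R \<and> d \<in> unit_set R"
      unfolding W
    proof (intro allI)
      fix i j
      have u: "a \<in> unit_set R" "d \<in> unit_set R" "a \<noteq> 0" "d \<noteq> 0"
        using h unit_nonzero by blast+
      have "L (r1.shift i v1) (r2.shift j v2) w
          = L (r1.diag a d (r1.shift i v1)) (r2.diag a d (r2.shift j v2)) (r3.diag a d w)"
        using u by (intro L_invariant[symmetric]) simp
      also have "r1.diag a d (r1.shift i v1) = r1.shift i v1"
        by (rule r1.fixed_diag[OF r1.fixed_shift[OF v1(1)] u(1,2)])
      also have "r2.diag a d (r2.shift j v2) = r2.shift j v2"
        by (rule r2.fixed_diag[OF r2.fixed_shift[OF v2(1)] u(1,2)])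
      finally show "L (r1.shift i v1) (r2.shift j v2) (r3.diag a d w - w) = 0" by (simp only: L_diff3) simp
    qed
  qed
  moreover have "v3 \<in> W" unfolding W by (intro allI L_shifts)
  ultimately have "W = UNIV" by (rule r3.torus_stable_eq_UNIV)
  then have "z \<in> W" by simp
  then show ?thesis unfolding W by simp
qed

text \<open>By the Cartan decomposition the translate is a shift of \<open>v1\<close> moved by the
  maximal compact group, which fixes \<open>v2\<close> and is absorbed by the arbitrary z.\<close>

lemma L_translate1:
  assumes "a * d - b * c \<noteq> 0" shows "L (\<rho>1 a b c d v1) v2 z = 0"
proof -
  obtain a' b' c' d' k i where k: "r1.iwahori 0 0 a' b' c' d'"
    "\<rho>1 a b c d v1 = \<rho>1 a' b' c' d' (s1 k (r1.shift i v1))"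
    using r1.cartan_decomposition[OF v1(1) assms] by blast
  note det = r1.iwahori_det[OF k(1)]
  obtain z' where z': "z = \<rho>3 a' b' c' d' z'"
    using r3.act_inverse(2)[OF refl det, of z, symmetric] by (rule that)
  have "L (\<rho>1 a b c d v1) v2 z = L (\<rho>1 a' b' c' d' (s1 k (r1.shift i v1))) (\<rho>2 a' b' c' d' v2) (\<rho>3 a' b' c' d' z')"
    unfolding k(2) z' r2.fixedD[OF v2(1) k(1)] ..
  also have "\<dots> = k * L (r1.shift i v1) v2 z'" unfolding L_invariant[OF det] L_scale ..
  finally show ?thesis using L_shifts_all[of i 0 z'] by simp
qed

lemma L_translate12:
  assumes g: "a * d - b * c \<noteq> 0" and h: "a' * d' - b' * c' \<noteq> 0"
  shows "L (\<rho>1 a b c d v1) (\<rho>2 a' b' c' d' v2) z = 0"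
proof -
  define D where "D = a' * d' - b' * c'"
  have D: "D \<noteq> 0" using h by (simp add: D_def)
  define p q r t where "p = d' / D" "q = - b' / D" "r = - c' / D" "t = a' / D"
  note pq = this
  have det: "p * t - q * r \<noteq> 0" using r1.matrix_inverse(9)[OF D_def[symmetric] D] D by (simp add: pq)
  have "L (\<rho>1 a b c d v1) (\<rho>2 a' b' c' d' v2) z
      = L (\<rho>1 p q r t (\<rho>1 a b c d v1)) (\<rho>2 p q r t (\<rho>2 a' b' c' d' v2)) (\<rho>3 p q r t z)"
    by (rule L_invariant[symmetric, OF det])
  also have "\<rho>2 p q r t (\<rho>2 a' b' c' d' v2) = v2"
    unfolding pq by (rule r2.act_inverse(1)[OF D_def[symmetric] D])
  also have "L (\<rho>1 p q r t (\<rho>1 a b c d v1)) v2 (\<rho>3 p q r t z) = 0"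
    unfolding r1.act_act[OF det g]
  proof (rule L_translate1)
    have "(p * a + q * c) * (r * b + t * d) - (p * b + q * d) * (r * a + t * c)
        = (p * t - q * r) * (a * d - b * c)" by (simp add: algebra_simps)
    then show "(p * a + q * c) * (r * b + t * d) - (p * b + q * d) * (r * a + t * c) \<noteq> 0"
      using det g by simp
  qed
  finally show ?thesis .
qed

text \<open>The translates of a nonzero vector span an irreducible representation. The first
  argument is freed for all translates of \<open>v2\<close>, and this frees the second.\<close>

theorem L_eq_0: "L x y z = 0"
proof -
  define U where "U = {x. \<forall>a b c d z. a * d - b * c \<noteq> 0 \<longrightarrow> L x (\<rho>2 a b c d v2) z = 0}"
  have "U = UNIV"
  proof (rule r1.cyclic[OF _ v1(2)])
    show "r1.subspace U" by (rule r1.subspaceI) (simp_all add: U_def L_add L_scale L_zero)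
    show "\<rho>1 a b c d v1 \<in> U" if "a * d - b * c \<noteq> 0" for a b c d
      unfolding U_def using L_translate12[OF that] by blast
  qed
  then have "x \<in> U" for x by simp
  then have U: "L x (\<rho>2 a b c d v2) z = 0" if "a * d - b * c \<noteq> 0" for x a b c d z
    using that unfolding U_def by simp
  define U2 where "U2 = {y. \<forall>x z. L x y z = 0}"
  have "U2 = UNIV"
  proof (rule r2.cyclic[OF _ v2(2)])
    show "r2.subspace U2" by (rule r2.subspaceI) (simp_all add: U2_def L_add L_scale L_zero)
    show "\<rho>2 a b c d v2 \<in> U2" if "a * d - b * c \<noteq> 0" for a b c d
      unfolding U2_def using U[OF that] by blast
  qed
  then have "y \<in> U2" by simp
  then show ?thesis unfolding U2_def by simp
qed

end

end

section \<open>The matrix group and the tensor product\<close>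

lemma mat2_nth [simp]:
  "mat2 a b c d $ 1 $ 1 = a" "mat2 a b c d $ 1 $ 2 = b"
  "mat2 a b c d $ 2 $ 1 = c" "mat2 a b c d $ 2 $ 2 = d"
  by (simp_all add: mat2_def)

lemma mat2_eta: "mat2 (A$1$1) (A$1$2) (A$2$1) (A$2$2) = A"
  by (simp add: vec_eq_iff forall_2)

lemma mat2_mult:
  "mat2 a b c d ** mat2 a' b' c' d'
    = mat2 (a * a' + b * c') (a * b' + b * d') (c * a' + d * c') (c * b' + d * d')"
  by (simp add: vec_eq_iff forall_2 matrix_matrix_mult_def sum_2)

lemma mat_eq_mat2: "mat a = mat2 a 0 0 a"
  by (simp add: vec_eq_iff forall_2 mat_def)

lemma det_mat2: "det (mat2 a b c d) = a * d - b * c"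
  by (simp add: det_2)

lemma carrier_GL2: "A \<in> carrier GL2 \<longleftrightarrow> det A \<noteq> 0"
  by (simp add: GL2_def invertible_det_nz)

lemma mat2_in_GL2: "mat2 a b c d \<in> carrier GL2 \<longleftrightarrow> a * d - b * c \<noteq> 0"
  by (simp add: carrier_GL2 det_mat2)

lemma GL2_mult [simp]: "A \<otimes>\<^bsub>GL2\<^esub> B = A ** B"
  and GL2_one [simp]: "\<one>\<^bsub>GL2\<^esub> = mat 1"
  by (simp_all add: GL2_def)

lemma group_GL2: "group (GL2 :: ('f::field^2^2) monoid)"
proof (rule groupI, unfold GL2_mult GL2_one)
  fix A B C :: "'f^2^2"
  show "mat 1 \<in> carrier (GL2 :: ('f^2^2) monoid)" by (simp add: carrier_GL2)
  show "A ** B \<in> carrier GL2" if "A \<in> carrier GL2" "B \<in> carrier GL2"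
    using that by (simp add: carrier_GL2 det_mul)
  show "A ** B ** C = A ** (B ** C)" by (simp add: matrix_mul_assoc)
  show "mat 1 ** A = A" by simp
  assume "A \<in> carrier GL2"
  then obtain B where B: "A ** B = mat 1" "B ** A = mat 1"
    by (auto simp: GL2_def invertible_def)
  then have "B \<in> carrier GL2" by (auto simp: GL2_def invertible_def)
  then show "\<exists>B\<in>carrier GL2. B ** A = mat 1" using B by blast
qed

lemma mat2_nat_pow: "mat2 a 0 0 1 [^]\<^bsub>GL2\<^esub> (k::nat) = mat2 (a ^ k) 0 0 1"
proof -
  interpret group "GL2 :: ('a^2^2) monoid" by (rule group_GL2)
  show ?thesis
    by (induction k) (simp_all add: mat_eq_mat2 mat2_mult mult.commute)
qed

lemma mat2_neg_pow:
  assumes "a \<noteq> 0"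
  shows "mat2 a 0 0 1 [^]\<^bsub>GL2\<^esub> (- int k) = mat2 (a powi (- int k)) 0 0 1"
proof -
  interpret group "GL2 :: ('a^2^2) monoid" by (rule group_GL2)
  have g: "mat2 a 0 0 1 \<in> carrier GL2" using assms by (simp add: mat2_in_GL2)
  have inv: "inv\<^bsub>GL2\<^esub> (mat2 (a ^ k) 0 0 1) = mat2 (a powi (- int k)) 0 0 1"
    using assms by (intro inv_equality) (simp_all add: mat2_in_GL2 mat_eq_mat2 mat2_mult power_int_minus)
  have "mat2 a 0 0 1 [^]\<^bsub>GL2\<^esub> (- int k) = inv\<^bsub>GL2\<^esub> (mat2 a 0 0 1 [^]\<^bsub>GL2\<^esub> int k)"
    using g by (rule int_pow_neg)
  then show ?thesis by (simp add: int_pow_int mat2_nat_pow inv)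
qed

section \<open>Passage from the matrix group to matrix entries\<close>

context dvr_field
begin

text \<open>The open stabilizer of v contains a ball around the identity, and by
  \<open>fabs_small\<close> the ball contains a principal congruence subgroup.\<close>

lemma smooth_if_admissible:
  assumes adm: "admissible R \<tau> s \<pi>" and rep: "representation s \<pi>"
  shows "\<exists>m::nat. \<forall>a b c d. a * d - b * c \<noteq> 0 \<and> a - 1 \<in> ideal (int m) \<and> b \<in> ideal (int m)
      \<and> c \<in> ideal (int m) \<and> d - 1 \<in> ideal (int m) \<longrightarrow> \<pi> (mat2 a b c d) v = v"
proof -
  let ?U = "{g \<in> carrier GL2. \<pi> g v = v}"
  have op: "openin (GL2_topology R \<tau>) ?U" using adm unfolding admissible_def by blast
  have one: "mat2 1 0 0 1 \<in> ?U"
    using rep mat2_in_GL2[of 1 0 0 1] unfolding representation_def mat_eq_mat2[of 1] by simp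
  obtain e where e: "e > 0"
    "\<And>h. h \<in> carrier GL2 \<Longrightarrow> (\<forall>i j. fabs R \<tau> (h$i$j - mat2 1 0 0 1$i$j) < e) \<Longrightarrow> h \<in> ?U"
    using op[unfolded openin_GL2_topology, THEN conjunct2, THEN bspec, OF one] by blast
  obtain m :: nat where m: "\<And>x. x \<in> ideal (int m) \<Longrightarrow> fabs R \<tau> x < e"
    using fabs_small[OF e(1)] by blast
  have "\<pi> (mat2 a b c d) v = v"
    if h: "a * d - b * c \<noteq> 0" "a - 1 \<in> ideal (int m)" "b \<in> ideal (int m)" "c \<in> ideal (int m)"
      "d - 1 \<in> ideal (int m)" for a b c d
  proof -
    have "mat2 a b c d \<in> ?U"
    proof (rule e(2))
      show "mat2 a b c d \<in> carrier GL2" using h(1) by (simp add: mat2_in_GL2)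
      show "\<forall>i j. fabs R \<tau> (mat2 a b c d$i$j - mat2 1 0 0 1$i$j) < e"
        using h m by (simp add: forall_2)
    qed
    then show ?thesis by blast
  qed
  then show ?thesis by blast
qed

lemma gl2_rep_if_irr_adm:
  assumes irr: "irr_adm_inf_rep R \<tau> s \<pi>" and central: "central_character s \<pi> \<omega>"
  shows "gl2_rep R \<tau> s (\<lambda>a b c d. \<pi> (mat2 a b c d)) \<omega>"
proof -
  have rep: "representation s \<pi>" and adm: "admissible R \<tau> s \<pi>" and irred: "irreducible_rep s \<pi>"
    using irr unfolding irr_adm_inf_rep_def by blast+
  interpret vector_space s using rep unfolding representation_def by blast
  have lin: "Vector_Spaces.linear s s (\<pi> g)" if "g \<in> carrier GL2" for g
    using rep that unfolding Defs.representation_def by blast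
  have mult: "\<pi> (g ** h) v = \<pi> g (\<pi> h v)" if "g \<in> carrier GL2" "h \<in> carrier GL2" for g h v
    using rep that unfolding Defs.representation_def by blast
  show ?thesis
  proof
    show "\<pi> (mat2 a b c d) (v + w) = \<pi> (mat2 a b c d) v + \<pi> (mat2 a b c d) w"
      if "a * d - b * c \<noteq> 0" for a b c d v w
    proof -
      interpret l: Vector_Spaces.linear s s "\<pi> (mat2 a b c d)"
        by (rule lin) (use that in \<open>simp add: mat2_in_GL2\<close>)
      show ?thesis by (rule l.add)
    qed
    show "\<pi> (mat2 a b c d) (s z v) = s z (\<pi> (mat2 a b c d) v)"
      if "a * d - b * c \<noteq> 0" for a b c d z v
    proof -
      interpret l: Vector_Spaces.linear s s "\<pi> (mat2 a b c d)"
        by (rule lin) (use that in \<open>simp add: mat2_in_GL2\<close>)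
      show ?thesis by (rule l.scale)
    qed
    show "\<pi> (mat2 1 0 0 1) v = v" for v
      using rep unfolding Defs.representation_def mat_eq_mat2[of 1] by blast
    show "\<pi> (mat2 a b c d) (\<pi> (mat2 a' b' c' d') v)
        = \<pi> (mat2 (a * a' + b * c') (a * b' + b * d') (c * a' + d * c') (c * b' + d * d')) v"
      if "a * d - b * c \<noteq> 0" "a' * d' - b' * c' \<noteq> 0" for a b c d a' b' c' d' v
      using mult[of "mat2 a b c d" "mat2 a' b' c' d'" v] that by (simp add: mat2_in_GL2 mat2_mult)
    show "\<exists>m::nat. \<forall>a b c d. a * d - b * c \<noteq> 0 \<and> a - 1 \<in> ideal (int m) \<and> b \<in> ideal (int m)
      \<and> c \<in> ideal (int m) \<and> d - 1 \<in> ideal (int m) \<longrightarrow> \<pi> (mat2 a b c d) v = v" for v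
      by (rule smooth_if_admissible[OF adm rep])
    show "\<pi> (mat2 a 0 0 a) v = s (\<omega> a) v" if "a \<noteq> 0" for a v
      using central that unfolding central_character_def mat_eq_mat2 by blast
    show "W = {0} \<or> W = UNIV"
      if W: "subspace W" and stable: "\<And>a b c d v. a * d - b * c \<noteq> 0 \<Longrightarrow> v \<in> W \<Longrightarrow> \<pi> (mat2 a b c d) v \<in> W" for W
    proof -
      have "\<pi> g ` W \<subseteq> W" if "g \<in> carrier GL2" for g
      proof (rule image_subsetI)
        fix v assume "v \<in> W"
        then have "\<pi> (mat2 (g$1$1) (g$1$2) (g$2$1) (g$2$2)) v \<in> W"
          using that by (intro stable) (simp add: carrier_GL2 det_2)
        then show "\<pi> g v \<in> W" by (simp only: mat2_eta)
      qed
      then show ?thesis using irred W unfolding irreducible_rep_def by blast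
    qed
  qed
qed

lemma maximal_compact_iff:
  "A \<in> maximal_compact R \<longleftrightarrow> (A$1$1 \<in> R \<and> A$1$2 \<in> R \<and> A$2$1 \<in> R \<and> A$2$2 \<in> R
      \<and> A$1$1 * A$2$2 - A$1$2 * A$2$1 \<in> unit_set R)"
  by (auto simp: maximal_compact_def forall_2 det_2)

lemma tau_power_multiple: "x \<in> (\<lambda>y. \<tau> ^ n * y) ` R \<longleftrightarrow> x \<in> ideal (int n)"
proof
  assume "x \<in> (\<lambda>y. \<tau> ^ n * y) ` R"
  then obtain y where "y \<in> R" "x = \<tau> ^ n * y" by blast
  then show "x \<in> ideal (int n)" by (cases "y = 0") (auto simp: ideal_def val_mult R_iff_val)
next
  assume x: "x \<in> ideal (int n)"
  then have "x / \<tau> ^ n \<in> R" by (cases "x = 0") (auto simp: ideal_def R_iff_val val_divide)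
  then show "x \<in> (\<lambda>y. \<tau> ^ n * y) ` R" by (intro image_eqI[of _ _ "x / \<tau> ^ n"]) auto
qed

end

text \<open>For n > 0 the upper left entry of a matrix in the congruence subgroup is a unit, so the
  factor given by the central character is 1.\<close>

lemma level_space_iff_fixed:
  assumes rep: "gl2_rep R \<tau> s (\<lambda>a b c d. \<pi> (mat2 a b c d)) \<omega>"
    and \<omega>: "n > 0 \<Longrightarrow> (\<And>a. a \<in> unit_set R \<Longrightarrow> \<omega> a = 1)"
  shows "v \<in> level_space R \<tau> s \<pi> \<omega> n \<longleftrightarrow> gl2_rep.fixed R \<tau> (\<lambda>a b c d. \<pi> (mat2 a b c d)) 0 (int n) v"
proof -
  interpret gl2_rep R \<tau> s "\<lambda>a b c d. \<pi> (mat2 a b c d)" \<omega> by (rule rep)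
  show ?thesis
  proof (cases "n = 0")
    case True
    have "v \<in> level_space R \<tau> s \<pi> \<omega> n \<longleftrightarrow> (\<forall>A. A \<in> maximal_compact R \<longrightarrow> \<pi> A v = v)"
      using True by (auto simp: level_space_def)
    also have "\<dots> \<longleftrightarrow> fixed 0 (int n) v"
      unfolding fixed_def iwahori_def True of_nat_0 ideal_0
    proof safe
      fix a b c d assume *: "\<forall>A. A \<in> maximal_compact R \<longrightarrow> \<pi> A v = v"
        "a \<in> R" "b \<in> R" "c \<in> R" "d \<in> R" "a * d - b * c \<in> unit_set R"
      then have "mat2 a b c d \<in> maximal_compact R" by (simp add: maximal_compact_iff)
      then show "\<pi> (mat2 a b c d) v = v" using * by blast
    next
      fix A assume *: "\<forall>a b c d. a \<in> R \<and> b \<in> R \<and> c \<in> R \<and> d \<in> R \<and> a * d - b * c \<in> unit_set R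
        \<longrightarrow> \<pi> (mat2 a b c d) v = v" "A \<in> maximal_compact R"
      then have "\<pi> (mat2 (A$1$1) (A$1$2) (A$2$1) (A$2$2)) v = v" by (simp only: maximal_compact_iff)
      then show "\<pi> A v = v" by (simp only: mat2_eta)
    qed
    finally show ?thesis .
  next
    case False
    have k_iff: "mat2 a b c d \<in> congruence_subgroup R \<tau> n \<longleftrightarrow> iwahori 0 (int n) a b c d" for a b c d
      using ideal_mono[of c "int n" 0]
      by (auto simp: congruence_subgroup_def maximal_compact_iff iwahori_def tau_power_multiple ideal_0)
    have unit: "s (\<omega> a) v = v" if "iwahori 0 (int n) a b c d" for a b c d
      using \<omega> False iwahori_diagonal_units(1)[OF that] by simp
    have "v \<in> level_space R \<tau> s \<pi> \<omega> n
        \<longleftrightarrow> (\<forall>A. A \<in> congruence_subgroup R \<tau> n \<longrightarrow> \<pi> A v = s (\<omega> (A$1$1)) v)"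
      using False by (auto simp: level_space_def)
    also have "\<dots> \<longleftrightarrow> fixed 0 (int n) v"
      unfolding fixed_def
    proof safe
      fix a b c d assume *: "\<forall>A. A \<in> congruence_subgroup R \<tau> n \<longrightarrow> \<pi> A v = s (\<omega> (A$1$1)) v"
        "iwahori 0 (int n) a b c d"
      then have "\<pi> (mat2 a b c d) v = s (\<omega> (mat2 a b c d$1$1)) v" using k_iff by blast
      then show "\<pi> (mat2 a b c d) v = v" using unit[OF *(2)] by simp
    next
      fix A assume *: "\<forall>a b c d. iwahori 0 (int n) a b c d \<longrightarrow> \<pi> (mat2 a b c d) v = v"
        "A \<in> congruence_subgroup R \<tau> n"
      then have k: "iwahori 0 (int n) (A$1$1) (A$1$2) (A$2$1) (A$2$2)" by (simp only: k_iff[symmetric] mat2_eta)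
      then have "\<pi> (mat2 (A$1$1) (A$1$2) (A$2$1) (A$2$2)) v = v" using * by blast
      then show "\<pi> A v = s (\<omega> (A$1$1)) v" unfolding mat2_eta unit[OF k] .
    qed
    finally show ?thesis .
  qed
qed

text \<open>The level is hidden by a quantifier in \<open>new_vector\<close>; minimality identifies
  it with the given conductor.\<close>

lemma new_vector_has_conductor:
  assumes "has_conductor R \<tau> s \<pi> \<omega> n" "new_vector R \<tau> s \<pi> \<omega> v"
  shows "level_space R \<tau> s \<pi> \<omega> n = module.span s {v}"
proof -
  obtain m where m: "has_conductor R \<tau> s \<pi> \<omega> m" "level_space R \<tau> s \<pi> \<omega> m = module.span s {v}"
    using assms(2) unfolding new_vector_def by blast
  have "m = n"
    using assms(1) m(1) unfolding has_conductor_def by (metis linorder_neqE_nat)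
  with m show ?thesis by simp
qed

lemma (in vector_space) span_singleton_conv:
  assumes "S = span {v}" "S \<noteq> {0}"
  shows "v \<noteq> 0" "v \<in> S" "x \<in> S \<Longrightarrow> \<exists>k. x = scale k v"
proof -
  show "v \<noteq> 0" using assms by (auto simp: span_insert_0)
  show "v \<in> S" using assms(1) by (simp add: span_base)
  show "\<exists>k. x = scale k v" if "x \<in> S" using that assms(1) by (auto simp: span_singleton)
qed

section \<open>Linear forms on the tensor product\<close>

lemma tensor_form_vanishes:
  fixes s1 :: "complex \<Rightarrow> 'a::ab_group_add \<Rightarrow> 'a" and s2 :: "complex \<Rightarrow> 'b::ab_group_add \<Rightarrow> 'b"
    and s3 :: "complex \<Rightarrow> 'c::ab_group_add \<Rightarrow> 'c"
  assumes l: "tensor_linear_form s1 s2 s3 l" and pure: "\<And>x y z. l (pure_tensor s1 s2 s3 x y z) = 0"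
    and t: "t \<in> tensor_space s1 s2 s3"
  shows "l t = 0"
proof -
  let ?cls = "\<lambda>f. tensor_eq s1 s2 s3 `` {f}"
  have add: "l (?cls (f + g)) = l (?cls f) + l (?cls g)"
    and scale: "l (?cls (free_scale k f)) = k * l (?cls f)" for f g k
    using l unfolding tensor_linear_form_def Let_def by blast+
  have zero: "l (?cls 0) = 0"
  proof -
    have "free_scale 0 0 = (0 :: 'a \<times> 'b \<times> 'c \<Rightarrow>\<^sub>0 complex)" by (rule poly_mapping_eqI) simp
    then show ?thesis using scale[of 0 0] by simp
  qed
  have single: "l (?cls (Poly_Mapping.single q k)) = 0" for q k
  proof -
    obtain x y z where q: "q = (x, y, z)" by (cases q)
    have "Poly_Mapping.single q k = free_scale k (Poly_Mapping.single q 1)"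
      by (rule poly_mapping_eqI) (simp add: lookup_single when_def)
    then show ?thesis using scale[of k "Poly_Mapping.single q 1"] pure[of x y z]
      by (simp add: q pure_tensor_def)
  qed
  have "l (?cls f) = 0" for f
  proof (induction f rule: update_induct)
    case const
    show ?case by (rule zero)
  next
    case (update f a b)
    have "Poly_Mapping.update a b f = f + Poly_Mapping.single a b"
      using update by (intro poly_mapping_eqI) (auto simp: lookup_add lookup_single lookup_update in_keys_iff when_def)
    then show ?case using update add single by simp
  qed
  moreover obtain f where "t = ?cls f"
    using t unfolding tensor_space_def by (auto elim: quotientE)
  ultimately show ?thesis by simp
qed

text \<open>Each of the six identities comes from one family of generating relations, on which the
  quotient identifies the two sides.\<close>

lemma tensor_form_multilinear:
  assumes l: "tensor_linear_form s1 s2 s3 l"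
  defines "L \<equiv> \<lambda>x y z. l (pure_tensor s1 s2 s3 x y z)"
  shows "L (x + x') y z = L x y z + L x' y z" "L x (y + y') z = L x y z + L x y' z"
    "L x y (z + z') = L x y z + L x y z'"
    and "L (s1 k x) y z = k * L x y z" "L x (s2 k y) z = k * L x y z" "L x y (s3 k z) = k * L x y z"
proof -
  let ?cls = "\<lambda>f. tensor_eq s1 s2 s3 `` {f}" and ?e = "\<lambda>x y z. Poly_Mapping.single (x, y, z) (1::complex)"
  interpret free: vector_space free_scale by (rule vector_space_free_scale)
  have add: "l (?cls (f + g)) = l (?cls f) + l (?cls g)"
    and scale: "l (?cls (free_scale k f)) = k * l (?cls f)" for f g k
    using l unfolding tensor_linear_form_def Let_def by blast+
  have cls: "?cls f = ?cls g" if "f - g \<in> tensor_relations s1 s2 s3" for f g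
    using that equiv_class_eq[OF equiv_tensor_eq, of f g s1 s2 s3]
    unfolding tensor_eq_def by (simp add: free.span_base)
  have add_rel: "l (?cls f) = l (?cls g) + l (?cls h)" if "f - g - h \<in> tensor_relations s1 s2 s3" for f g h
    using cls[of f "g + h"] that add[of g h] by (simp add: diff_diff_eq)
  have scale_rel: "l (?cls f) = k * l (?cls g)" if "f - free_scale k g \<in> tensor_relations s1 s2 s3" for f g k
    using cls[of f "free_scale k g"] that scale[of k g] by simp
  \<comment> \<open>The union of the six families is nested to the left; the chain of rules here and
    in the next five facts selects the family.\<close>
  have rel1: "?e (x + x') y z - ?e x y z - ?e x' y z \<in> tensor_relations s1 s2 s3"
    unfolding tensor_relations_def Let_def
    by (rule UnI1, rule UnI1, rule UnI1, rule UnI1, rule UnI1, rule CollectI, intro exI conjI TrueI, rule HOL.refl)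
  have rel2: "?e x (y + y') z - ?e x y z - ?e x y' z \<in> tensor_relations s1 s2 s3"
    unfolding tensor_relations_def Let_def
    by (rule UnI1, rule UnI1, rule UnI1, rule UnI1, rule UnI2, rule CollectI, intro exI conjI TrueI, rule HOL.refl)
  have rel3: "?e x y (z + z') - ?e x y z - ?e x y z' \<in> tensor_relations s1 s2 s3"
    unfolding tensor_relations_def Let_def
    by (rule UnI1, rule UnI1, rule UnI1, rule UnI2, rule CollectI, intro exI conjI TrueI, rule HOL.refl)
  have rel4: "?e (s1 k x) y z - free_scale k (?e x y z) \<in> tensor_relations s1 s2 s3"
    unfolding tensor_relations_def Let_def
    by (rule UnI1, rule UnI1, rule UnI2, rule CollectI, intro exI conjI TrueI, rule HOL.refl)
  have rel5: "?e x (s2 k y) z - free_scale k (?e x y z) \<in> tensor_relations s1 s2 s3"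
    unfolding tensor_relations_def Let_def
    by (rule UnI1, rule UnI2, rule CollectI, intro exI conjI TrueI, rule HOL.refl)
  have rel6: "?e x y (s3 k z) - free_scale k (?e x y z) \<in> tensor_relations s1 s2 s3"
    unfolding tensor_relations_def Let_def
    by (rule UnI2, rule CollectI, intro exI conjI TrueI, rule HOL.refl)
  show "L (x + x') y z = L x y z + L x' y z" "L x (y + y') z = L x y z + L x y' z"
    "L x y (z + z') = L x y z + L x y z'"
    unfolding L_def pure_tensor_def by (fact add_rel[OF rel1] add_rel[OF rel2] add_rel[OF rel3])+
  show "L (s1 k x) y z = k * L x y z" "L x (s2 k y) z = k * L x y z" "L x y (s3 k z) = k * L x y z"
    unfolding L_def pure_tensor_def
    by (fact scale_rel[OF rel4] scale_rel[OF rel5] scale_rel[OF rel6])+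
qed

section \<open>The value at the test vector\<close>

theorem theorem5:
  fixes p n :: nat
    and E :: "'f::field_char_0 set" and N :: "'f \<Rightarrow> real"
    and R :: "'f set" and \<tau> :: 'f
    and s1 :: "complex \<Rightarrow> 'a::ab_group_add \<Rightarrow> 'a" and \<pi>1 :: "'f^2^2 \<Rightarrow> 'a \<Rightarrow> 'a"
    and s2 :: "complex \<Rightarrow> 'b::ab_group_add \<Rightarrow> 'b" and \<pi>2 :: "'f^2^2 \<Rightarrow> 'b \<Rightarrow> 'b"
    and s3 :: "complex \<Rightarrow> 'c::ab_group_add \<Rightarrow> 'c" and \<pi>3 :: "'f^2^2 \<Rightarrow> 'c \<Rightarrow> 'c"
    and \<omega>1 \<omega>2 \<omega>3 :: "'f \<Rightarrow> complex"
    and v1 :: 'a and v2 :: 'b and v3 :: 'c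
    and \<gamma> :: "'f^2^2"
    and l :: "('a \<times> 'b \<times> 'c \<Rightarrow>\<^sub>0 complex) set \<Rightarrow> complex"
  assumes "finite_extension_of_padics p E N"
    and "R = ring_of_integers E N"
    and "uniformizer R \<tau>"
    and "irr_adm_inf_rep R \<tau> s1 \<pi>1"
    and "irr_adm_inf_rep R \<tau> s2 \<pi>2"
    and "irr_adm_inf_rep R \<tau> s3 \<pi>3"
    and "central_character s1 \<pi>1 \<omega>1"
    and "central_character s2 \<pi>2 \<omega>2"
    and "central_character s3 \<pi>3 \<omega>3"
    and "\<And>a. a \<noteq> 0 \<Longrightarrow> \<omega>1 a * \<omega>2 a * \<omega>3 a = 1"
    and "principal_series R \<tau> s1 \<pi>1" and "unramified R \<tau> s1 \<pi>1 \<omega>1"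
    and "principal_series R \<tau> s2 \<pi>2" and "unramified R \<tau> s2 \<pi>2 \<omega>2"
    and "has_conductor R \<tau> s3 \<pi>3 \<omega>3 n" and "n \<ge> 1"
    and "new_vector R \<tau> s1 \<pi>1 \<omega>1 v1"
    and "new_vector R \<tau> s2 \<pi>2 \<omega>2 v2"
    and "new_vector R \<tau> s3 \<pi>3 \<omega>3 v3"
    and "\<gamma> = mat2 \<tau> 0 0 1"
    and "tensor_linear_form s1 s2 s3 l"
    and "invariant_form s1 s2 s3 \<pi>1 \<pi>2 \<pi>3 l"
    and "\<exists>t\<in>tensor_space s1 s2 s3. l t \<noteq> 0"
  shows "l (pure_tensor s1 s2 s3 (\<pi>1 (\<gamma> [^]\<^bsub>GL2\<^esub> (- int n)) v1) v2 v3) \<noteq> 0"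
proof
  assume zero: "l (pure_tensor s1 s2 s3 (\<pi>1 (\<gamma> [^]\<^bsub>GL2\<^esub> (- int n)) v1) v2 v3) = 0"
  interpret padic_extension p E N using assms(1) by unfold_locales
  have R: "R = int_ring" using assms(2) by (simp add: int_ring_def)
  interpret dvr_field R \<tau> using dvr_field_int_ring assms(3) unfolding R by blast
  interpret r1: gl2_rep R \<tau> s1 "\<lambda>a b c d. \<pi>1 (mat2 a b c d)" \<omega>1
    by (rule gl2_rep_if_irr_adm[OF assms(4,7)])
  interpret r2: gl2_rep R \<tau> s2 "\<lambda>a b c d. \<pi>2 (mat2 a b c d)" \<omega>2
    by (rule gl2_rep_if_irr_adm[OF assms(5,8)])
  interpret r3: gl2_rep R \<tau> s3 "\<lambda>a b c d. \<pi>3 (mat2 a b c d)" \<omega>3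
    by (rule gl2_rep_if_irr_adm[OF assms(6,9)])
  have iff1: "x \<in> level_space R \<tau> s1 \<pi>1 \<omega>1 0 \<longleftrightarrow> r1.fixed 0 0 x" for x
    using level_space_iff_fixed[OF r1.gl2_rep_axioms, of 0 x] by simp
  have iff2: "x \<in> level_space R \<tau> s2 \<pi>2 \<omega>2 0 \<longleftrightarrow> r2.fixed 0 0 x" for x
    using level_space_iff_fixed[OF r2.gl2_rep_axioms, of 0 x] by simp
  have c1: "has_conductor R \<tau> s1 \<pi>1 \<omega>1 0" and c2: "has_conductor R \<tau> s2 \<pi>2 \<omega>2 0"
    using assms(12,14) by (simp_all add: unramified_def)
  have ne: "level_space R \<tau> s1 \<pi>1 \<omega>1 0 \<noteq> {0}" "level_space R \<tau> s2 \<pi>2 \<omega>2 0 \<noteq> {0}"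
    "level_space R \<tau> s3 \<pi>3 \<omega>3 n \<noteq> {0}"
    using c1 c2 assms(15) unfolding has_conductor_def by blast+
  note n1 = r1.span_singleton_conv[OF new_vector_has_conductor[OF c1 assms(17)] ne(1), unfolded iff1]
  note n2 = r2.span_singleton_conv[OF new_vector_has_conductor[OF c2 assms(18)] ne(2), unfolded iff2]
  \<comment> \<open>A scalar matrix with unit entries lies in the maximal compact group and fixes
    the nonzero spherical vector, so the central character is 1 there. The product relation carries
    this over to the third representation.\<close>
  have unit1: "\<omega>1 a = 1" if "a \<in> unit_set R" for a
  proof -
    have "s1 (\<omega>1 a) v1 = v1"
      using r1.fixed_diag[OF n1(2) that that] r1.central[of a v1] unit_nonzero[OF that] by simp
    then have "s1 (\<omega>1 a) v1 = s1 1 v1" by simp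
    then show ?thesis using n1(1) r1.scale_right_imp_eq by blast
  qed
  have unit2: "\<omega>2 a = 1" if "a \<in> unit_set R" for a
  proof -
    have "s2 (\<omega>2 a) v2 = v2"
      using r2.fixed_diag[OF n2(2) that that] r2.central[of a v2] unit_nonzero[OF that] by simp
    then have "s2 (\<omega>2 a) v2 = s2 1 v2" by simp
    then show ?thesis using n2(1) r2.scale_right_imp_eq by blast
  qed
  have unit3: "\<omega>3 a = 1" if "a \<in> unit_set R" for a
    using assms(10)[of a] unit1[OF that] unit2[OF that] unit_nonzero[OF that] by simp
  \<comment> \<open>This is needed for all levels m, as minimality of the conductor concerns the
    levels below n.\<close>
  have iff3: "x \<in> level_space R \<tau> s3 \<pi>3 \<omega>3 m \<longleftrightarrow> r3.fixed 0 (int m) x" for x m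
    using level_space_iff_fixed[OF r3.gl2_rep_axioms, of m x] unit3 by simp
  note n3 = r3.span_singleton_conv[OF new_vector_has_conductor[OF assms(15,19)] ne(3), unfolded iff3]
  have min3: "w = 0" if "m < n" "r3.fixed 0 (int m) w" for m w
    using assms(15) that iff3[of w m] unfolding has_conductor_def by blast
  let ?L = "\<lambda>x y z. l (pure_tensor s1 s2 s3 x y z)"
  interpret trilinear_setting R \<tau> s1 "\<lambda>a b c d. \<pi>1 (mat2 a b c d)" \<omega>1 s2 "\<lambda>a b c d. \<pi>2 (mat2 a b c d)" \<omega>2
    s3 "\<lambda>a b c d. \<pi>3 (mat2 a b c d)" \<omega>3 v3 n v1 v2 ?L
  proof unfold_locales
    show "?L (\<pi>1 (mat2 a b c d) x) (\<pi>2 (mat2 a b c d) y) (\<pi>3 (mat2 a b c d) z) = ?L x y z"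
      if "a * d - b * c \<noteq> 0" for a b c d x y z
    proof -
      have "mat2 a b c d \<in> carrier GL2" using that by (simp add: mat2_in_GL2)
      then show ?thesis using assms(22) unfolding invariant_form_def by blast
    qed
    show "?L (x + x') y z = ?L x y z + ?L x' y z" "?L x (y + y') z = ?L x y z + ?L x y' z"
      "?L x y (z + z') = ?L x y z + ?L x y z'" "?L (s1 k x) y z = k * ?L x y z"
      "?L x (s2 k y) z = k * ?L x y z" "?L x y (s3 k z) = k * ?L x y z" for x x' y y' z z' k
      by (fact tensor_form_multilinear[OF assms(21)])+
    show "\<exists>k. x = s1 k v1" if "r1.fixed 0 0 x" for x using n1(3)[OF that] .
    show "\<exists>k. y = s2 k v2" if "r2.fixed 0 0 y" for y using n2(3)[OF that] .
    show "\<exists>z. w = s3 z v3" if "r3.fixed 0 (int n) w" for w using n3(3)[OF that] .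
    show "w = 0" if "m < n" "r3.fixed 0 (int m) w" for m w using min3[OF that] .
    show "1 \<le> n" by (rule assms(16))
    show "v1 \<noteq> 0" "r1.fixed 0 0 v1" by (rule n1)+
    show "v2 \<noteq> 0" "r2.fixed 0 0 v2" by (rule n2)+
    show "v3 \<noteq> 0" "r3.fixed 0 (int n) v3" by (rule n3)+
  qed
  have "\<gamma> [^]\<^bsub>GL2\<^esub> (- int n) = mat2 (\<tau> powi (- int n)) 0 0 1"
    unfolding assms(20) by (rule mat2_neg_pow) simp
  then have "?L (r1.shift (- int n) v1) v2 v3 = 0" using zero by simp
  from L_eq_0[OF this] have pure: "?L x y z = 0" for x y z .
  obtain t where t: "t \<in> tensor_space s1 s2 s3" "l t \<noteq> 0" using assms(23) by blast
  from tensor_form_vanishes[OF assms(21) pure t(1)] t(2) show False by contradiction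
qed

end
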